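(* Let $(\pi,\mathcal V)=\mathbf{St}_e(\tau)$ be the level $0$ discrete series representation of $G=\mathrm{GL}_n(F)$ attached to $\tau$, with simple type $(J,\lambda)$. Let $w\in W$ and $\tilde w\in\tilde W$. Let $\Psi\in\bar{\mathcal H}_{\tilde\lambda}$ satisfy $\Psi\star\varphi=\tilde\chi(\varphi)\Psi$ for all $\varphi\in\mathcal H_{\tilde\lambda}$. Then the formula $$c_{\Psi,w,\tilde w}(g)=\langle\Psi(g)(w),\tilde w\rangle_\lambda,\qquad g\in G,$$ defines a matrix coefficient of $\pi$. Moreover the support of that matrix coefficient is contained in $J\mathbf WJ$.
   Context: $F$ is a non-archimedean, non-discrete, locally compact field of any characteristic, with ring of integers $\mathfrak o_F$, maximal ideal $\mathfrak p_F$, uniformizer $\varpi_F$, residue field $k_F$ of cardinality $q$, normalized absolute value $\|\ \|$. All representations are on complex vector spaces. Fix $n\geqslant 2$, positive integers $e,f$ with $ef=n$, and put $G=\mathrm{GL}_n(F)$. Representation: $\tau$ is an irreducible unitary level $0$ supercuspidal representation of $\mathrm{GL}_f(F)$; that is, there are an irreducible cuspidal representation $\bar\lambda_0$ of $\mathrm{GL}_f(k_F)$, with inflation $\lambda_0$ to $\mathrm{GL}_f(\mathfrak o_F)$ (space $X_0$), and an extension $\Lambda_0$ of $\lambda_0$ to $F^\times\mathrm{GL}_f(\mathfrak o_F)$ with $\tau\simeq \mathrm{ind}_{F^\times \mathrm{GL}_f(\mathfrak o_F)}^{\mathrm{GL}_f(F)}\Lambda_0$. Write $\tau^a=\|\det\|^a\tau$.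 $(\pi,\mathcal V)=\mathbf{St}_e(\tau)$ is the unique irreducible quotient of the representation of $G$ obtained by normalized parabolic induction from $\tau^{(1-e)/2}\otimes\tau^{(3-e)/2}\otimes\cdots\otimes\tau^{(e-1)/2}$ on the standard Levi subgroup $\mathrm{GL}_f(F)^{e}$; $\tilde{\mathcal V}$ is its contragredient. A matrix coefficient of $\pi$ is a function $g\mapsto\langle\pi(g)v,\tilde v\rangle$ with $v\in\mathcal V,\tilde v\in\tilde{\mathcal V}$. Type: $\mathfrak A$ is the $\mathfrak o_F$-order of $f\times f$ block matrices $(a_{ij})_{1\le i,j\le e}$ with $a_{ij}\in M_f(\mathfrak o_F)$ if $j\ge i$ and $a_{ij}\in\mathfrak p_F M_f(\mathfrak o_F)$ if $j<i$; $\mathfrak P$ is its Jacobson radical, $J=\mathfrak A^\times$, $J^1=1+\mathfrak P$, so $J/J^1\simeq\mathrm{GL}_f(k_F)^e$. $\lambda$ is the inflation of $\bar\lambda_0^{\otimes e}$ to $J$, with space $W=X_0^{\otimes e}$; $(\tilde\lambda,\tilde W)$ is its contragredient, with natural pairing $\langle\ ,\ \rangle_\lambda$ on $W\times\tilde W$. Hecke algebras: $\mathcal H_\lambda$ is the space of compactly supported functions $\varphi:G\to\mathrm{End}_{\mathbb C}(\tilde W)$ with $\varphi(j_1gj_2)=\tilde\lambda(j_1)\varphi(g)\tilde\lambda(j_2)$ for $j_1,j_2\in J$, an algebra under convolution for the Haar measure giving $J$ volume $1$. $\bar{\mathcal H}_{\tilde\lambda}$ is the space of all functions $\Psi:G\to\mathrm{End}_{\mathbb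 C}(W)$ (no support condition) with $\Psi(j_1gj_2)=\lambda(j_1)\Psi(g)\lambda(j_2)$, and $\mathcal H_{\tilde\lambda}$ is its subspace of compactly supported functions. For $\Psi\in\bar{\mathcal H}_{\tilde\lambda}$, $\varphi\in\mathcal H_{\tilde\lambda}$: $(\Psi\star\varphi)(g)=\sum_{x\in G/J}\Psi(x)\varphi(x^{-1}g)$ (finite sum). The map $\varphi\mapsto\tilde\varphi$, $\tilde\varphi(g)={}^t\varphi(g^{-1})$, is an anti-isomorphism $\mathcal H_\lambda\to\mathcal H_{\tilde\lambda}$. Characters: $\mathrm{ind}_J^G\lambda$ is the space of compactly supported $f:G\to W$ with $f(jg)=\lambda(j)f(g)$, $G$ acting by right translation. $\mathrm{Hom}_J(W,\mathcal V)\simeq\mathrm{Hom}_G(\mathrm{ind}_J^G\lambda,\mathcal V)$ is a left $\mathcal H_\lambda$-module by $(\varphi\cdot\alpha)(f)=\alpha(\tilde\varphi\star f)$, $(\tilde\varphi\star f)(g)=\sum_{x\in G/J}\tilde\varphi(x)f(x^{-1}g)$. It is known to be one-dimensional; $\chi$ is the resulting character of $\mathcal H_\lambda$, and $\tilde\chi$ is the character of $\mathcal H_{\tilde\lambda}$ defined by $\tilde\chi(\tilde\varphi)=\chi(\varphi)$. Affine Weyl group: $\mathbf W_0$ is the group of monomial matrices in $\mathrm{GL}_e(F)$ with nonzero entries powers of $\varpi_F$ and determinant $\pm1$, viewed in $G$ by replacing each entry $a$ by the block $aI_f$. $\Pi\in G$ is the $f\times f$ block matrix with blocks $I_f$ at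 positions $(i,i+1)$, $1\le i\le e-1$, block $\varpi_FI_f$ at $(e,1)$, and $0$ elsewhere. $\mathbf W=\Pi^{\mathbb Z}\ltimes\mathbf W_0$. *)

theory Defs
  imports
    Complex_Main
    "HOL-Library.Function_Algebras"
    "HOL-Algebra.Left_Coset"
    "HOL-Analysis.Function_Topology"
    "HOL-Analysis.Abstract_Metric_Spaces"
    "Jordan_Normal_Form.Determinant"
begin

section \<open>Complex vector spaces\<close>

class complex_vector = ab_group_add +
  fixes scaleC :: "complex \<Rightarrow> 'a \<Rightarrow> 'a" (infixr "*\<^sub>C" 75)
  assumes scaleC_add_right: "a *\<^sub>C (x + y) = a *\<^sub>C x + a *\<^sub>C y"
    and scaleC_add_left: "(a + b) *\<^sub>C x = a *\<^sub>C x + b *\<^sub>C x"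
    and scaleC_scaleC: "a *\<^sub>C b *\<^sub>C x = (a * b) *\<^sub>C x"
    and scaleC_one: "1 *\<^sub>C x = x"

instantiation complex :: complex_vector
begin
definition "c *\<^sub>C (z::complex) = c * z"
instance by standard (auto simp: scaleC_complex_def algebra_simps)
end

instantiation "fun" :: (type, complex_vector) complex_vector
begin
definition "c *\<^sub>C f = (\<lambda>x. c *\<^sub>C f x)"
instance
  by standard
    (auto simp: scaleC_fun_def fun_eq_iff scaleC_add_right scaleC_add_left scaleC_scaleC scaleC_one)
end

global_interpretation complex_vector:
  vector_space "scaleC :: complex \<Rightarrow> 'a \<Rightarrow> 'a::complex_vector"
  by unfold_locales (rule scaleC_add_right scaleC_add_left scaleC_scaleC scaleC_one)+

definition linear_on ::
    "'v::complex_vector set \<Rightarrow> 'w::complex_vector set \<Rightarrow> ('v \<Rightarrow> 'w) \<Rightarrow> bool"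
  where "linear_on V W A \<longleftrightarrow>
    (\<forall>x\<in>V. A x \<in> W) \<and>
    (\<forall>x\<in>V. \<forall>y\<in>V. A (x + y) = A x + A y) \<and>
    (\<forall>c. \<forall>x\<in>V. A (c *\<^sub>C x) = c *\<^sub>C A x)"

text \<open>Linear maps between subspaces are extended by zero, so that they form a subspace of the
  type of all functions and two of them are equal iff they agree on \<open>V\<close>.\<close>

definition hom_space ::
    "'v::complex_vector set \<Rightarrow> 'w::complex_vector set \<Rightarrow> ('v \<Rightarrow> 'w) set"
  where "hom_space V W = {A. linear_on V W A \<and> (\<forall>x. x \<notin> V \<longrightarrow> A x = 0)}"

abbreviation lin_dual :: "'v::complex_vector set \<Rightarrow> ('v \<Rightarrow> complex) set"
  where "lin_dual V \<equiv> hom_space V UNIV"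

text \<open>The \<open>e\<close>-th tensor power of \<open>X\<close>, realised inside the \<open>e\<close>-linear forms on
  the dual of \<open>X\<close>: the pure tensor \<open>x\<^sub>0 \<otimes> \<dots> \<otimes> x\<^sub>e\<^sub>-\<^sub>1\<close> is the form
  \<open>(l\<^sub>0, \<dots>, l\<^sub>e\<^sub>-\<^sub>1) \<mapsto> \<Prod> l\<^sub>i(x\<^sub>i)\<close>. The natural map from the algebraic tensor power to
  these forms is injective, also in infinite dimension. Tuples are functions on \<open>nat\<close> of which
  only the values at \<open>i < e\<close> matter.\<close>

type_synonym 'x tensor = "(nat \<Rightarrow> 'x \<Rightarrow> complex) \<Rightarrow> complex"

definition pure_tensor ::
    "nat \<Rightarrow> 'x::complex_vector set \<Rightarrow> (nat \<Rightarrow> 'x) \<Rightarrow> 'x tensor"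
  where "pure_tensor e X x =
    (\<lambda>l. if \<forall>i<e. l i \<in> lin_dual X then \<Prod>i<e. l i (x i) else 0)"

definition tensor_power :: "nat \<Rightarrow> 'x::complex_vector set \<Rightarrow> 'x tensor set"
  where "tensor_power e X =
    complex_vector.span {pure_tensor e X x | x. \<forall>i<e. x i \<in> X}"

text \<open>\<open>tensor_map e X A\<close> is \<open>A\<^sub>0 \<otimes> \<dots> \<otimes> A\<^sub>e\<^sub>-\<^sub>1\<close> for endomorphisms \<open>A\<^sub>i\<close> of \<open>X\<close>.\<close>

definition tensor_map ::
    "nat \<Rightarrow> 'x::complex_vector set \<Rightarrow> (nat \<Rightarrow> 'x \<Rightarrow> 'x) \<Rightarrow> 'x tensor \<Rightarrow> 'x tensor"
  where "tensor_map e X A t =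
    (\<lambda>l. if \<forall>i<e. l i \<in> lin_dual X
          then t (\<lambda>i x. if x \<in> X then l i (A i x) else 0) else 0)"

lemma tensor_map_pure_tensor:
  assumes A: "\<And>i. i < e \<Longrightarrow> linear_on X X (A i)"
    and X: "complex_vector.subspace X"
    and x: "\<And>i. i < e \<Longrightarrow> x i \<in> X"
  shows "tensor_map e X A (pure_tensor e X x) = pure_tensor e X (\<lambda>i. A i (x i))"
proof
  fix l :: "nat \<Rightarrow> 'a \<Rightarrow> complex"
  show "tensor_map e X A (pure_tensor e X x) l = pure_tensor e X (\<lambda>i. A i (x i)) l"
  proof (cases "\<forall>i<e. l i \<in> lin_dual X")
    case True
    have "(\<lambda>y. if y \<in> X then l i (A i y) else 0) \<in> lin_dual X" if "i < e" for i
      using True A[OF that] that X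
      by (auto simp: hom_space_def linear_on_def complex_vector.subspace_add
          complex_vector.subspace_scale)
    then show ?thesis
      using True x by (simp add: tensor_map_def pure_tensor_def)
  next
    case False
    then show ?thesis
      by (simp only: tensor_map_def pure_tensor_def if_False)
  qed
qed

section \<open>Representations\<close>

text \<open>Groups are records of \<^theory>\<open>HOL-Algebra.Group\<close>; a subgroup \<open>H\<close> of \<open>G\<close> is regarded as the
  group \<open>G\<lparr>carrier := H\<rparr>\<close>. A topology on \<open>G\<close> is passed separately as \<open>T\<close>.\<close>

definition representation ::
    "('g, 'b) monoid_scheme \<Rightarrow> 'v::complex_vector set \<Rightarrow> ('g \<Rightarrow> 'v \<Rightarrow> 'v) \<Rightarrow> bool"
  where "representation G V \<pi> \<longleftrightarrow>
    complex_vector.subspace V \<and>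
    (\<forall>g\<in>carrier G. linear_on V V (\<pi> g)) \<and>
    (\<forall>v\<in>V. \<pi> \<one>\<^bsub>G\<^esub> v = v) \<and>
    (\<forall>g\<in>carrier G. \<forall>h\<in>carrier G. \<forall>v\<in>V. \<pi> (g \<otimes>\<^bsub>G\<^esub> h) v = \<pi> g (\<pi> h v))"

definition irreducible_rep ::
    "('g, 'b) monoid_scheme \<Rightarrow> 'v::complex_vector set \<Rightarrow> ('g \<Rightarrow> 'v \<Rightarrow> 'v) \<Rightarrow> bool"
  where "irreducible_rep G V \<pi> \<longleftrightarrow>
    representation G V \<pi> \<and> V \<noteq> {0} \<and>
    (\<forall>U. complex_vector.subspace U \<and> U \<subseteq> V \<and> (\<forall>g\<in>carrier G. \<forall>u\<in>U. \<pi> g u \<in> U)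
      \<longrightarrow> U = {0} \<or> U = V)"

definition smooth_rep ::
    "'g topology \<Rightarrow> ('g, 'b) monoid_scheme \<Rightarrow> 'v::complex_vector set \<Rightarrow> ('g \<Rightarrow> 'v \<Rightarrow> 'v) \<Rightarrow> bool"
  where "smooth_rep T G V \<pi> \<longleftrightarrow>
    representation G V \<pi> \<and> (\<forall>v\<in>V. openin T {g \<in> carrier G. \<pi> g v = v})"

definition unitary_rep ::
    "('g, 'b) monoid_scheme \<Rightarrow> 'v::complex_vector set \<Rightarrow> ('g \<Rightarrow> 'v \<Rightarrow> 'v) \<Rightarrow> bool"
  where "unitary_rep G V \<pi> \<longleftrightarrow> representation G V \<pi> \<and>
    (\<exists>ip :: 'v \<Rightarrow> 'v \<Rightarrow> complex.
      (\<forall>u\<in>V. \<forall>v\<in>V. \<forall>w\<in>V. ip (u + v) w = ip u w + ip v w) \<and>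
      (\<forall>c. \<forall>u\<in>V. \<forall>v\<in>V. ip (c *\<^sub>C u) v = c * ip u v) \<and>
      (\<forall>u\<in>V. \<forall>v\<in>V. ip v u = cnj (ip u v)) \<and>
      (\<forall>u\<in>V. u \<noteq> 0 \<longrightarrow> Re (ip u u) > 0) \<and>
      (\<forall>g\<in>carrier G. \<forall>u\<in>V. \<forall>v\<in>V. ip (\<pi> g u) (\<pi> g v) = ip u v))"

definition intertwiner ::
    "('g, 'b) monoid_scheme \<Rightarrow> 'v::complex_vector set \<Rightarrow> ('g \<Rightarrow> 'v \<Rightarrow> 'v) \<Rightarrow>
      'w::complex_vector set \<Rightarrow> ('g \<Rightarrow> 'w \<Rightarrow> 'w) \<Rightarrow> ('v \<Rightarrow> 'w) set"
  where "intertwiner G V \<pi> W \<sigma> =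
    {A \<in> hom_space V W. \<forall>g\<in>carrier G. \<forall>v\<in>V. A (\<pi> g v) = \<sigma> g (A v)}"

definition isomorphic_reps ::
    "('g, 'b) monoid_scheme \<Rightarrow> 'v::complex_vector set \<Rightarrow> ('g \<Rightarrow> 'v \<Rightarrow> 'v) \<Rightarrow>
      'w::complex_vector set \<Rightarrow> ('g \<Rightarrow> 'w \<Rightarrow> 'w) \<Rightarrow> bool"
  where "isomorphic_reps G V \<pi> W \<sigma> \<longleftrightarrow> (\<exists>A\<in>intertwiner G V \<pi> W \<sigma>. bij_betw A V W)"

text \<open>Contragredient: the smooth vectors in the linear dual, with the action
  \<open>l \<mapsto> l \<circ> \<pi>(g\<^sup>-\<^sup>1)\<close>. The natural pairing is \<open>\<langle>v, l\<rangle> = l v\<close>.\<close>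

definition contra_space ::
    "'g topology \<Rightarrow> ('g, 'b) monoid_scheme \<Rightarrow> 'v::complex_vector set \<Rightarrow> ('g \<Rightarrow> 'v \<Rightarrow> 'v) \<Rightarrow>
      ('v \<Rightarrow> complex) set"
  where "contra_space T G V \<pi> =
    {l \<in> lin_dual V. openin T {g \<in> carrier G. \<forall>v\<in>V. l (\<pi> g v) = l v}}"

definition contra_rep ::
    "('g, 'b) monoid_scheme \<Rightarrow> 'v::complex_vector set \<Rightarrow> ('g \<Rightarrow> 'v \<Rightarrow> 'v) \<Rightarrow>
      'g \<Rightarrow> ('v \<Rightarrow> complex) \<Rightarrow> ('v \<Rightarrow> complex)"
  where "contra_rep G V \<pi> g l = (\<lambda>v. if v \<in> V then l (\<pi> (inv\<^bsub>G\<^esub> g) v) else 0)"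

definition matrix_coefficient ::
    "'g topology \<Rightarrow> ('g, 'b) monoid_scheme \<Rightarrow> 'v::complex_vector set \<Rightarrow> ('g \<Rightarrow> 'v \<Rightarrow> 'v) \<Rightarrow>
      ('g \<Rightarrow> complex) \<Rightarrow> bool"
  where "matrix_coefficient T G V \<pi> c \<longleftrightarrow>
    (\<exists>v\<in>V. \<exists>l\<in>contra_space T G V \<pi>. \<forall>g\<in>carrier G. c g = l (\<pi> g v))"

definition supp_on :: "('g, 'b) monoid_scheme \<Rightarrow> ('g \<Rightarrow> 'a::zero) \<Rightarrow> 'g set"
  where "supp_on G h = {g \<in> carrier G. h g \<noteq> 0}"

text \<open>Functions on \<open>G\<close> are extended by zero outside \<open>carrier G\<close>.\<close>

definition right_translation ::
    "('g, 'b) monoid_scheme \<Rightarrow> 'g \<Rightarrow> ('g \<Rightarrow> 'v::complex_vector) \<Rightarrow> ('g \<Rightarrow> 'v)"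
  where "right_translation G x h = (\<lambda>g. if g \<in> carrier G then h (g \<otimes>\<^bsub>G\<^esub> x) else 0)"

text \<open>Smooth induction from \<open>H\<close> of \<open>(V, \<sigma>)\<close>, and compact induction (support compact modulo \<open>H\<close>;
  for compact \<open>H\<close> this means compact support, and for open \<open>H\<close> and smooth \<open>\<sigma>\<close> the smoothness
  condition is then automatic). The group acts by \<^const>\<open>right_translation\<close>.\<close>

definition ind_space ::
    "'g topology \<Rightarrow> ('g, 'b) monoid_scheme \<Rightarrow> 'g set \<Rightarrow> 'v::complex_vector set \<Rightarrow>
      ('g \<Rightarrow> 'v \<Rightarrow> 'v) \<Rightarrow> ('g \<Rightarrow> 'v) set"
  where "ind_space T G H V \<sigma> =
    {h. (\<forall>g\<in>carrier G. h g \<in> V) \<and> (\<forall>g. g \<notin> carrier G \<longrightarrow> h g = 0) \<and>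
        (\<forall>x\<in>H. \<forall>g\<in>carrier G. h (x \<otimes>\<^bsub>G\<^esub> g) = \<sigma> x (h g)) \<and>
        openin T {x \<in> carrier G. right_translation G x h = h}}"

definition cind_space ::
    "'g topology \<Rightarrow> ('g, 'b) monoid_scheme \<Rightarrow> 'g set \<Rightarrow> 'v::complex_vector set \<Rightarrow>
      ('g \<Rightarrow> 'v \<Rightarrow> 'v) \<Rightarrow> ('g \<Rightarrow> 'v) set"
  where "cind_space T G H V \<sigma> =
    {h \<in> ind_space T G H V \<sigma>. \<exists>C. compactin T C \<and> supp_on G h \<subseteq> H <#>\<^bsub>G\<^esub> C}"

section \<open>Hecke algebras\<close>

definition hecke_bar ::
    "('g, 'b) monoid_scheme \<Rightarrow> 'g set \<Rightarrow> 'w::complex_vector set \<Rightarrow> ('g \<Rightarrow> 'w \<Rightarrow> 'w) \<Rightarrow>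
      ('g \<Rightarrow> 'w \<Rightarrow> 'w) set"
  where "hecke_bar G J W \<sigma> =
    {\<Psi>. (\<forall>g\<in>carrier G. \<Psi> g \<in> hom_space W W) \<and> (\<forall>g. g \<notin> carrier G \<longrightarrow> \<Psi> g = 0) \<and>
        (\<forall>j1\<in>J. \<forall>j2\<in>J. \<forall>g\<in>carrier G. \<forall>w\<in>W.
          \<Psi> (j1 \<otimes>\<^bsub>G\<^esub> g \<otimes>\<^bsub>G\<^esub> j2) w = \<sigma> j1 (\<Psi> g (\<sigma> j2 w)))}"

definition hecke ::
    "'g topology \<Rightarrow> ('g, 'b) monoid_scheme \<Rightarrow> 'g set \<Rightarrow> 'w::complex_vector set \<Rightarrow>
      ('g \<Rightarrow> 'w \<Rightarrow> 'w) \<Rightarrow> ('g \<Rightarrow> 'w \<Rightarrow> 'w) set"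
  where "hecke T G J W \<sigma> =
    {\<phi> \<in> hecke_bar G J W \<sigma>. \<exists>C. compactin T C \<and> supp_on G \<phi> \<subseteq> C}"

text \<open>\<open>\<Sum>\<^bsub>x\<in>G/J\<^esub> m (\<Psi> x) (\<phi> (x\<^sup>-\<^sup>1 g))\<close>, where \<open>m\<close> is composition of operators or application of
  an operator to a vector. The sum is over the cosets with nonzero summand, which are finite in
  number whenever \<open>\<phi>\<close> has compact support; in all uses below the summand does not depend on the
  chosen representative.\<close>

definition hecke_conv ::
    "('g, 'b) monoid_scheme \<Rightarrow> 'g set \<Rightarrow> ('a \<Rightarrow> 'c \<Rightarrow> 'd::comm_monoid_add) \<Rightarrow>
      ('g \<Rightarrow> 'a) \<Rightarrow> ('g \<Rightarrow> 'c) \<Rightarrow> 'g \<Rightarrow> 'd"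
  where "hecke_conv G J m \<Psi> \<phi> g =
    (let s = (\<lambda>c. let x = (SOME x. x \<in> c) in m (\<Psi> x) (\<phi> (inv\<^bsub>G\<^esub> x \<otimes>\<^bsub>G\<^esub> g)))
     in if g \<in> carrier G then \<Sum>c \<in> {c \<in> lcosets\<^bsub>G\<^esub> J. s c \<noteq> 0}. s c else 0)"

text \<open>Transpose of an endomorphism \<open>A\<close> of the dual \<open>W'\<close> of a finite-dimensional space \<open>W\<close>,
  as an endomorphism of \<open>W\<close>.\<close>

definition transpose_end ::
    "'w::complex_vector set \<Rightarrow> ('w \<Rightarrow> complex) set \<Rightarrow>
      (('w \<Rightarrow> complex) \<Rightarrow> ('w \<Rightarrow> complex)) \<Rightarrow> 'w \<Rightarrow> 'w"
  where "transpose_end W W' A w =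
    (if w \<in> W then (THE u. u \<in> W \<and> (\<forall>l\<in>W'. l u = A l w)) else 0)"

definition hecke_tilde ::
    "('g, 'b) monoid_scheme \<Rightarrow> 'w::complex_vector set \<Rightarrow> ('w \<Rightarrow> complex) set \<Rightarrow>
      ('g \<Rightarrow> ('w \<Rightarrow> complex) \<Rightarrow> ('w \<Rightarrow> complex)) \<Rightarrow> 'g \<Rightarrow> 'w \<Rightarrow> 'w"
  where "hecke_tilde G W W' \<phi> g =
    (if g \<in> carrier G then transpose_end W W' (\<phi> (inv\<^bsub>G\<^esub> g)) else 0)"

text \<open>\<open>chi\<close> is the character by which the algebra of functions \<open>H\<close> acts on the one-dimensional
  module \<open>M\<close>; \<open>chi\<close> is unconstrained outside \<open>H\<close>.\<close>

definition character_of_module ::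
    "'h set \<Rightarrow> ('h \<Rightarrow> 'm \<Rightarrow> 'm) \<Rightarrow> 'm::complex_vector set \<Rightarrow> ('h \<Rightarrow> complex) \<Rightarrow> bool"
  where "character_of_module H act M chi \<longleftrightarrow>
    complex_vector.dim M = 1 \<and> (\<forall>\<phi>\<in>H. \<forall>\<alpha>\<in>M. act \<phi> \<alpha> = chi \<phi> *\<^sub>C \<alpha>)"

section \<open>General linear groups\<close>

definition GL :: "nat \<Rightarrow> 'a::field mat monoid"
  where "GL n = \<lparr>carrier = {A \<in> carrier_mat n n. invertible_mat A},
                 monoid.mult = (*), one = 1\<^sub>m n\<rparr>"

text \<open>The block in position \<open>(i, j)\<close>, counted from \<open>0\<close>, of a matrix of \<open>f \<times> f\<close> blocks.\<close>

definition mat_block :: "nat \<Rightarrow> 'a mat \<Rightarrow> nat \<Rightarrow> nat \<Rightarrow> 'a mat"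
  where "mat_block f A i j = mat f f (\<lambda>(a, b). A $$ (i * f + a, j * f + b))"

text \<open>The embedding of \<open>e \<times> e\<close> matrices which replaces an entry \<open>a\<close> by the block \<open>a I\<^sub>f\<close>.\<close>

definition blow_up :: "nat \<Rightarrow> nat \<Rightarrow> 'a::zero mat \<Rightarrow> 'a mat"
  where "blow_up e f A =
    mat (e * f) (e * f) (\<lambda>(r, c). if r mod f = c mod f then A $$ (r div f, c div f) else 0)"

text \<open>A nonconstant nondecreasing labelling \<open>b\<close> of the indices is the same as a proper standard
  (block upper triangular) parabolic subgroup; this is its unipotent radical.\<close>

definition unipotent_radical :: "nat \<Rightarrow> (nat \<Rightarrow> nat) \<Rightarrow> 'a::field mat set"
  where "unipotent_radical n b =
    {u \<in> carrier_mat n n. \<forall>i<n. \<forall>j<n. \<not> b i < b j \<longrightarrow> u $$ (i, j) = 1\<^sub>m n $$ (i, j)}"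

definition cuspidal_rep ::
    "nat \<Rightarrow> 'x::complex_vector set \<Rightarrow> ('k::field mat \<Rightarrow> 'x \<Rightarrow> 'x) \<Rightarrow> bool"
  where "cuspidal_rep n X \<sigma> \<longleftrightarrow>
    (\<forall>b. (\<forall>i<n. \<forall>j<n. i \<le> j \<longrightarrow> b i \<le> b j) \<and> (\<exists>i<n. \<exists>j<n. b i \<noteq> b j) \<longrightarrow>
      (\<forall>x\<in>X. (\<forall>u\<in>unipotent_radical n b. \<sigma> u x = x) \<longrightarrow> x = 0))"

section \<open>Non-archimedean local fields\<close>

text \<open>The field is given with its normalised absolute value \<open>nrm\<close>, a uniformizer \<open>unif\<close>, and a
  model \<open>red\<close> of the reduction map from the ring of integers onto the residue field (the values
  of \<open>red\<close> outside the ring of integers are irrelevant). Non-discreteness follows from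
  \<open>unif_nonzero\<close> and \<open>maximal_ideal\<close>; the normalisation forces the residue field to be finite.\<close>

locale nonarch_local_field =
  fixes nrm :: "'F::field \<Rightarrow> real"
    and unif :: 'F
    and red :: "'F \<Rightarrow> 'k::field"
  assumes nrm_nonneg: "0 \<le> nrm x"
    and nrm_eq_0: "nrm x = 0 \<longleftrightarrow> x = 0"
    and nrm_mult: "nrm (x * y) = nrm x * nrm y"
    and ultrametric: "nrm (x + y) \<le> max (nrm x) (nrm y)"
    and locally_compact:
      "locally_compact_space (Metric_space.mtopology UNIV (\<lambda>x y. nrm (x - y)))"
    and unif_nonzero: "unif \<noteq> 0"
    and maximal_ideal: "{x. nrm x < 1} = {unif * y | y. nrm y \<le> 1}"
    and red_one: "red 1 = 1"
    and red_add: "nrm x \<le> 1 \<Longrightarrow> nrm y \<le> 1 \<Longrightarrow> red (x + y) = red x + red y"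
    and red_mult: "nrm x \<le> 1 \<Longrightarrow> nrm y \<le> 1 \<Longrightarrow> red (x * y) = red x * red y"
    and red_surj: "red ` {x. nrm x \<le> 1} = UNIV"
    and red_kernel: "nrm x \<le> 1 \<Longrightarrow> red x = 0 \<longleftrightarrow> nrm x < 1"
    and normalised: "nrm unif = 1 / real (CARD('k))"

text \<open>The topology of \<open>GL\<^sub>n(F)\<close> induced from the product topology on the matrix entries.\<close>

definition GL_topology :: "('F::field \<Rightarrow> real) \<Rightarrow> nat \<Rightarrow> 'F mat topology"
  where "GL_topology nrm n =
    pullback_topology (carrier (GL n))
      (\<lambda>A. restrict (\<lambda>ij. A $$ ij) ({..<n} \<times> {..<n}))
      (product_topology (\<lambda>_. Metric_space.mtopology UNIV (\<lambda>x y. nrm (x - y)))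
        ({..<n} \<times> {..<n}))"

definition GL_integers :: "('F::field \<Rightarrow> real) \<Rightarrow> nat \<Rightarrow> 'F mat set"
  where "GL_integers nrm n =
    (let M = {A \<in> carrier_mat n n. \<forall>i<n. \<forall>j<n. nrm (A $$ (i, j)) \<le> 1}
     in {A \<in> M. \<exists>B\<in>M. A * B = 1\<^sub>m n \<and> B * A = 1\<^sub>m n})"

definition center_GL_integers :: "('F::field \<Rightarrow> real) \<Rightarrow> nat \<Rightarrow> 'F mat set"
  where "center_GL_integers nrm n = {c \<cdot>\<^sub>m A | c A. c \<noteq> 0 \<and> A \<in> GL_integers nrm n}"

text \<open>\<open>(T, \<tau>)\<close> is an irreducible unitary level zero supercuspidal representation of \<open>GL\<^sub>f(F)\<close>,
  compactly induced from the extension \<open>Lam0\<close> of the inflation of the cuspidal representation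
  \<open>(X0, lam0)\<close> of \<open>GL\<^sub>f(k)\<close>.\<close>

definition level0_supercuspidal ::
    "('F::field \<Rightarrow> real) \<Rightarrow> ('F \<Rightarrow> 'k::field) \<Rightarrow> nat \<Rightarrow>
      'x::complex_vector set \<Rightarrow> ('k mat \<Rightarrow> 'x \<Rightarrow> 'x) \<Rightarrow> ('F mat \<Rightarrow> 'x \<Rightarrow> 'x) \<Rightarrow>
      't::complex_vector set \<Rightarrow> ('F mat \<Rightarrow> 't \<Rightarrow> 't) \<Rightarrow> bool"
  where "level0_supercuspidal nrm red f X0 lam0 Lam0 T \<tau> \<longleftrightarrow>
    irreducible_rep (GL f) X0 lam0 \<and> cuspidal_rep f X0 lam0 \<and>
    representation ((GL f)\<lparr>carrier := center_GL_integers nrm f\<rparr>) X0 Lam0 \<and>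
    (\<forall>g\<in>GL_integers nrm f. \<forall>x\<in>X0. Lam0 g x = lam0 (map_mat red g) x) \<and>
    smooth_rep (GL_topology nrm f) (GL f) T \<tau> \<and>
    irreducible_rep (GL f) T \<tau> \<and> unitary_rep (GL f) T \<tau> \<and>
    isomorphic_reps (GL f) T \<tau>
      (cind_space (GL_topology nrm f) (GL f) (center_GL_integers nrm f) X0 Lam0)
      (right_translation (GL f))"

section \<open>The generalised Steinberg representation\<close>

definition std_parabolic :: "nat \<Rightarrow> nat \<Rightarrow> 'F::field mat set"
  where "std_parabolic e f =
    {p \<in> carrier (GL (e * f)). \<forall>i<e * f. \<forall>j<e * f. j div f < i div f \<longrightarrow> p $$ (i, j) = 0}"

text \<open>Square root of the modulus \<open>\<bar>det (Ad p | Lie N)\<bar>\<close>, where \<open>N\<close> is the unipotent radical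
  of \<^const>\<open>std_parabolic\<close>: the summand of \<open>Lie N\<close> in block position \<open>(i, j)\<close> contributes
  \<open>(\<bar>det p\<^sub>i\<^sub>i\<bar> / \<bar>det p\<^sub>j\<^sub>j\<bar>)\<^sup>f\<close>.\<close>

definition sqrt_modulus :: "('F::field \<Rightarrow> real) \<Rightarrow> nat \<Rightarrow> nat \<Rightarrow> 'F mat \<Rightarrow> real"
  where "sqrt_modulus nrm e f p =
    (\<Prod>j<e. \<Prod>i<j.
      (nrm (det (mat_block f p i i)) / nrm (det (mat_block f p j j))) powr (real f / 2))"

text \<open>The representation of the Levi factor on \<open>\<tau>\<^bsup>a\<^sub>0\<^esup> \<otimes> \<dots> \<otimes> \<tau>\<^bsup>a\<^sub>e\<^sub>-\<^sub>1\<^esup>\<close>, \<open>a\<^sub>i = (1 - e)/2 + i\<close>, inflated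
  to the parabolic subgroup and multiplied by the square root of the modulus.\<close>

definition steinberg_inducing_rep ::
    "('F::field \<Rightarrow> real) \<Rightarrow> nat \<Rightarrow> nat \<Rightarrow> 't::complex_vector set \<Rightarrow> ('F mat \<Rightarrow> 't \<Rightarrow> 't) \<Rightarrow>
      'F mat \<Rightarrow> 't tensor \<Rightarrow> 't tensor"
  where "steinberg_inducing_rep nrm e f T \<tau> p t =
    of_real (sqrt_modulus nrm e f p) *\<^sub>C
    tensor_map e T
      (\<lambda>i v. of_real (nrm (det (mat_block f p i i)) powr ((1 - real e) / 2 + real i)) *\<^sub>C
             \<tau> (mat_block f p i i) v) t"

definition steinberg_ind_space ::
    "('F::field \<Rightarrow> real) \<Rightarrow> nat \<Rightarrow> nat \<Rightarrow> 't::complex_vector set \<Rightarrow> ('F mat \<Rightarrow> 't \<Rightarrow> 't) \<Rightarrow>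
      ('F mat \<Rightarrow> 't tensor) set"
  where "steinberg_ind_space nrm e f T \<tau> =
    ind_space (GL_topology nrm (e * f)) (GL (e * f)) (std_parabolic e f)
      (tensor_power e T) (steinberg_inducing_rep nrm e f T \<tau>)"

text \<open>The irreducible quotient of the induced representation is unique up to isomorphism, so that
  \<open>(V, \<pi>)\<close> is this quotient iff it is irreducible and a quotient.\<close>

definition is_St ::
    "('F::field \<Rightarrow> real) \<Rightarrow> nat \<Rightarrow> nat \<Rightarrow> 't::complex_vector set \<Rightarrow> ('F mat \<Rightarrow> 't \<Rightarrow> 't) \<Rightarrow>
      'v::complex_vector set \<Rightarrow> ('F mat \<Rightarrow> 'v \<Rightarrow> 'v) \<Rightarrow> bool"
  where "is_St nrm e f T \<tau> V \<pi> \<longleftrightarrow>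
    irreducible_rep (GL (e * f)) V \<pi> \<and>
    (\<exists>A \<in> intertwiner (GL (e * f)) (steinberg_ind_space nrm e f T \<tau>)
            (right_translation (GL (e * f))) V \<pi>.
       A ` steinberg_ind_space nrm e f T \<tau> = V)"

section \<open>The simple type and its Hecke modules\<close>

definition order_A :: "('F::field \<Rightarrow> real) \<Rightarrow> nat \<Rightarrow> nat \<Rightarrow> 'F mat set"
  where "order_A nrm e f =
    {A \<in> carrier_mat (e * f) (e * f). \<forall>i<e * f. \<forall>j<e * f.
      nrm (A $$ (i, j)) \<le> 1 \<and> (j div f < i div f \<longrightarrow> nrm (A $$ (i, j)) < 1)}"

definition type_J :: "('F::field \<Rightarrow> real) \<Rightarrow> nat \<Rightarrow> nat \<Rightarrow> 'F mat set"
  where "type_J nrm e f =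
    {A \<in> order_A nrm e f. \<exists>B\<in>order_A nrm e f. A * B = 1\<^sub>m (e * f) \<and> B * A = 1\<^sub>m (e * f)}"

text \<open>The map \<open>J \<rightarrow> J/J\<^sup>1 \<simeq> GL\<^sub>f(k)\<^sup>e\<close> is reduction of the diagonal blocks.\<close>

definition type_rep ::
    "('F::field \<Rightarrow> 'k::field) \<Rightarrow> nat \<Rightarrow> nat \<Rightarrow> 'x::complex_vector set \<Rightarrow>
      ('k mat \<Rightarrow> 'x \<Rightarrow> 'x) \<Rightarrow> 'F mat \<Rightarrow> 'x tensor \<Rightarrow> 'x tensor"
  where "type_rep red e f X0 lam0 j = tensor_map e X0 (\<lambda>i. lam0 (map_mat red (mat_block f j i i)))"

text \<open>The left action \<open>(\<phi> \<cdot> \<alpha>)(h) = \<alpha>(\<phi>~ \<star> h)\<close> of the Hecke algebra on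
  \<open>Hom\<^sub>G(ind\<^sub>J\<^sup>G W, V) \<simeq> Hom\<^sub>J(W, V)\<close>; \<open>I\<close> is the space of \<open>ind\<^sub>J\<^sup>G W\<close> and \<open>W'\<close> the dual of \<open>W\<close>.\<close>

definition hecke_action ::
    "('g, 'b) monoid_scheme \<Rightarrow> 'g set \<Rightarrow> 'w::complex_vector set \<Rightarrow> ('w \<Rightarrow> complex) set \<Rightarrow>
      ('g \<Rightarrow> 'w) set \<Rightarrow> ('g \<Rightarrow> ('w \<Rightarrow> complex) \<Rightarrow> ('w \<Rightarrow> complex)) \<Rightarrow>
      (('g \<Rightarrow> 'w) \<Rightarrow> 'v::complex_vector) \<Rightarrow> (('g \<Rightarrow> 'w) \<Rightarrow> 'v)"
  where "hecke_action G J W W' I \<phi> \<alpha> =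
    (\<lambda>h. if h \<in> I then \<alpha> (hecke_conv G J (\<lambda>A w. A w) (hecke_tilde G W W' \<phi>) h) else 0)"

section \<open>The affine Weyl group\<close>

definition weyl_W0 :: "'F::field \<Rightarrow> nat \<Rightarrow> 'F mat set"
  where "weyl_W0 unif e =
    {A \<in> carrier (GL e).
      (\<forall>i<e. \<exists>!j. j < e \<and> A $$ (i, j) \<noteq> 0) \<and>
      (\<forall>j<e. \<exists>!i. i < e \<and> A $$ (i, j) \<noteq> 0) \<and>
      (\<forall>i<e. \<forall>j<e. A $$ (i, j) \<noteq> 0 \<longrightarrow> (\<exists>k::int. A $$ (i, j) = unif powi k)) \<and>
      (det A = 1 \<or> det A = - 1)}"

definition Pi_matrix :: "'F::field \<Rightarrow> nat \<Rightarrow> nat \<Rightarrow> 'F mat"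
  where "Pi_matrix unif e f =
    blow_up e f (mat e e (\<lambda>(i, j). if j = i + 1 then 1
                                    else if i = e - 1 \<and> j = 0 then unif else 0))"

definition weyl_W :: "'F::field \<Rightarrow> nat \<Rightarrow> nat \<Rightarrow> 'F mat set"
  where "weyl_W unif e f =
    {(Pi_matrix unif e f [^]\<^bsub>GL (e * f)\<^esub> (k::int)) \<otimes>\<^bsub>GL (e * f)\<^esub> blow_up e f w | k w.
      w \<in> weyl_W0 unif e}"

end

theory Submission
  imports Defs
begin

text \<open>
  Write \<open>I\<close> for \<open>ind\<^sub>J\<^sup>G \<lambda>\<close> and let \<open>\<alpha>\<close> span the line \<open>Hom\<^sub>G(I, V)\<close>. It is surjective, because \<open>V\<close> is
  irreducible. The function \<open>\<Psi>\<close> acts on \<open>h \<in> I\<close> by convolution, and \<open>h \<mapsto> (\<Psi> \<star> h)(1)\<close> is a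
  \<open>J\<close>-homomorphism \<open>I \<rightarrow> W\<close>. On the translate by \<open>g\<close> of the function supported on \<open>J\<close> with value
  \<open>w\<close> at \<open>1\<close> its value is \<open>\<Psi>(g) w\<close>. So if it vanishes on the kernel of \<open>\<alpha>\<close>, then
  \<open>\<alpha>(h) \<mapsto> \<langle>(\<Psi> \<star> h)(1), w'\<rangle>\<close> is a smooth linear form on \<open>V\<close>, and it exhibits
  \<open>g \<mapsto> \<langle>\<Psi>(g) w, w'\<rangle>\<close> as a matrix coefficient.

  The vanishing is lemma \<open>eval_conv_vanishes_on_kernel\<close>. Suppose that \<open>\<alpha>(h) = 0\<close> and that
  \<open>u = (\<Psi> \<star> h)(1)\<close> is not zero. Choose a linear form \<open>l\<close> on \<open>W\<close> with \<open>l(u) \<noteq> 0\<close>, and average the rank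
  one map \<open>w \<mapsto> l(w) h\<close> over \<open>J\<close>. This gives a \<open>J\<close>-homomorphism \<open>s\<close> from \<open>W\<close> to the kernel of
  \<open>\<alpha>\<close>, and \<open>w \<mapsto> (\<Psi> \<star> s(w))(1)\<close> is a \<open>J\<close>-endomorphism of \<open>W\<close> whose trace is a positive multiple of
  \<open>l(u)\<close>; hence it is not zero. By Frobenius reciprocity \<open>s\<close> is left convolution by an element of the
  Hecke algebra. As its image lies in the kernel of \<open>\<alpha>\<close>, the character \<open>\<chi>\<close> kills this element. So
  does \<open>\<Psi>\<close>, being an eigenfunction with the same character, and therefore \<open>\<Psi> \<star> s(w) = 0\<close> for all
  \<open>w\<close>: a contradiction.

  The support condition comes from the equivariance of \<open>\<Psi>\<close> under \<open>J \<times> J\<close>. Gaussian elimination with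
  row and column operations in \<open>J\<close> reduces every \<open>g\<close> to a monomial matrix \<open>m\<close> whose entries are
  powers of the uniformizer (\<open>affine_bruhat_decomposition\<close>). If \<open>\<Psi>(m)\<close> is not zero, it intertwines
  \<open>\<lambda>\<close> with its conjugate by \<open>m\<close>. When \<open>m\<close> tears a block apart, the unipotent radical of a proper
  parabolic subgroup of that block is conjugated into the kernel of \<open>\<lambda>\<close> and so fixes the image
  of \<open>\<Psi>(m)\<close>, which is impossible for a cuspidal representation (\<open>intertwining_monomial\<close>). Thus \<open>m\<close>
  permutes the blocks, up to permutations inside the blocks, and these belong to \<open>J\<close>.
\<close>

(* The multiset order would make left cosets ambiguous. *)
no_notation subset_mset (infix "<#" 50)

section \<open>Sums over left cosets\<close>

context group
begin

text \<open>A sum over \<open>G/K\<close> is formed with the representatives that \<^const>\<open>hecke_conv\<close> uses. It has the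
  intended value for right \<open>K\<close>-invariant functions whose support meets finitely many cosets.\<close>

definition coset_sum :: "'a set \<Rightarrow> ('a \<Rightarrow> 'd::comm_monoid_add) \<Rightarrow> 'd"
  where "coset_sum K m =
    (\<Sum>c\<in>{c \<in> lcosets K. m (SOME x. x \<in> c) \<noteq> 0}. m (SOME x. x \<in> c))"

lemma coset_rep:
  assumes K: "subgroup K G" and c: "c \<in> lcosets K"
  shows "(SOME x. x \<in> c) \<in> c" "(SOME x. x \<in> c) \<in> carrier G" "(SOME x. x \<in> c) <# K = c"
proof -
  obtain a where a: "a \<in> carrier G" "c = a <# K"
    using c by (auto simp: LCOSETS_def)
  have "a \<in> c" using lcos_self[OF a(1) K] a by simp
  then show 1: "(SOME x. x \<in> c) \<in> c" by (rule someI)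
  then show 2: "(SOME x. x \<in> c) \<in> carrier G"
    using a subgroup.elemlcos_carrier[OF K is_group a(1)] by blast
  show "(SOME x. x \<in> c) <# K = c"
    using l_repr_independence[OF _ a(1) K] 1 a by metis
qed

lemma mem_lcosets: "x \<in> carrier G \<Longrightarrow> x <# K \<in> lcosets K"
  by (auto simp: LCOSETS_def)

lemma mem_l_cosetE:
  assumes "x \<in> y <# K" obtains k where "k \<in> K" "x = y \<otimes> k"
  using assms by (auto simp: l_coset_def)

lemma coset_sum_eq:
  assumes K: "subgroup K G" and C: "finite C" "C \<subseteq> lcosets K"
    and m: "\<And>x. x \<in> carrier G \<Longrightarrow> m x \<noteq> 0 \<Longrightarrow> x <# K \<in> C"
  shows "coset_sum K m = (\<Sum>c\<in>C. m (SOME x. x \<in> c))"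
  unfolding coset_sum_def
proof (rule sum.mono_neutral_left[OF C(1)])
  show "{c \<in> lcosets K. m (SOME x. x \<in> c) \<noteq> 0} \<subseteq> C"
  proof
    fix c assume c: "c \<in> {c \<in> lcosets K. m (SOME x. x \<in> c) \<noteq> 0}"
    then have c': "c \<in> lcosets K" by simp
    have "(SOME x. x \<in> c) <# K \<in> C"
      using m[OF coset_rep(2)[OF K c']] c by simp
    then show "c \<in> C" using coset_rep(3)[OF K c'] by simp
  qed
  show "\<forall>i\<in>C - {c \<in> lcosets K. m (SOME x. x \<in> c) \<noteq> 0}. m (SOME x. x \<in> i) = 0"
    using C by auto
qed

lemma coset_sum_cong:
  assumes K: "subgroup K G" and "\<And>x. x \<in> carrier G \<Longrightarrow> m x = m' x"
  shows "coset_sum K m = coset_sum K m'"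
proof -
  have "m (SOME x. x \<in> c) = m' (SOME x. x \<in> c)" if "c \<in> lcosets K" for c
    using assms(2) coset_rep[OF K that] by auto
  then show ?thesis unfolding coset_sum_def by (intro sum.cong) auto
qed

lemma coset_value:
  assumes K: "subgroup K G"
    and inv: "\<And>x k. x \<in> carrier G \<Longrightarrow> k \<in> K \<Longrightarrow> m (x \<otimes> k) = m x"
    and x: "x \<in> carrier G"
  shows "m (SOME y. y \<in> x <# K) = m x"
proof -
  have "(SOME y. y \<in> x <# K) \<in> x <# K" using coset_rep[OF K mem_lcosets[OF x]] by blast
  then obtain k where "k \<in> K" "(SOME y. y \<in> x <# K) = x \<otimes> k" by (rule mem_l_cosetE)
  then show ?thesis using inv[OF x] by simp
qed

lemma coset_sum_single:
  assumes K: "subgroup K G"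
    and inv: "\<And>x k. x \<in> carrier G \<Longrightarrow> k \<in> K \<Longrightarrow> m (x \<otimes> k) = m x"
    and g: "g \<in> carrier G"
    and m: "\<And>x. x \<in> carrier G \<Longrightarrow> m x \<noteq> 0 \<Longrightarrow> inv x \<otimes> g \<in> K"
  shows "coset_sum K m = m g"
proof -
  have "coset_sum K m = (\<Sum>c\<in>{g <# K}. m (SOME x. x \<in> c))"
  proof (rule coset_sum_eq[OF K])
    show "{g <# K} \<subseteq> lcosets K" using mem_lcosets[OF g] by blast
    fix x assume x: "x \<in> carrier G" "m x \<noteq> 0"
    from m[OF this] have "g \<in> x <# K"
      using g x(1) by (auto simp: l_coset_def m_assoc[symmetric] intro!: bexI[of _ "inv x \<otimes> g"])
    then show "x <# K \<in> {g <# K}"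
      using l_repr_independence[OF _ x(1) K] by auto
  qed simp
  then show ?thesis using coset_value[OF K inv g] by simp
qed

text \<open>Left translation permutes the cosets, and right invariance absorbs the difference between the
  translate of a representative and the representative of the translated coset.\<close>

lemma coset_sum_shift:
  assumes K: "subgroup K G"
    and inv: "\<And>x k. x \<in> carrier G \<Longrightarrow> k \<in> K \<Longrightarrow> m (x \<otimes> k) = m x"
    and g: "g \<in> carrier G"
  shows "coset_sum K (\<lambda>x. m (g \<otimes> x)) = coset_sum K m"
proof -
  have KG: "K \<subseteq> carrier G" using K by (rule subgroup.subset)
  have shift: "h <# c \<in> lcosets K" "h <# (inv h <# c) = c" "inv h <# (h <# c) = c"
    "m (SOME x. x \<in> h <# c) = m (h \<otimes> (SOME x. x \<in> c))"
    if c: "c \<in> lcosets K" and h: "h \<in> carrier G" for h c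
  proof -
    obtain a where a: "a \<in> carrier G" "c = a <# K" using c by (auto simp: LCOSETS_def)
    have eq: "h' <# (a' <# K) = (h' \<otimes> a') <# K" if "h' \<in> carrier G" "a' \<in> carrier G" for h' a'
      using lcos_m_assoc[OF KG] that by simp
    show "h <# c \<in> lcosets K" using a h eq by (simp add: mem_lcosets)
    show "h <# (inv h <# c) = c" "inv h <# (h <# c) = c"
      using a h by (simp_all add: eq m_assoc[symmetric])
    let ?r = "SOME x. x \<in> c"
    have r: "?r \<in> carrier G" "?r <# K = c" using coset_rep[OF K c] by auto
    have "h <# c = (h \<otimes> ?r) <# K" using eq[OF h r(1)] r(2) by simp
    moreover have "m (SOME x. x \<in> (h \<otimes> ?r) <# K) = m (h \<otimes> ?r)"
      using coset_value[where m = m, OF K inv, of "h \<otimes> ?r"] h r by simp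
    ultimately show "m (SOME x. x \<in> h <# c) = m (h \<otimes> ?r)" by simp
  qed
  let ?S = "\<lambda>m. {c \<in> lcosets K. m (SOME x. x \<in> c) \<noteq> 0}"
  show ?thesis unfolding coset_sum_def
  proof (rule sum.reindex_bij_witness[of _ "\<lambda>c. inv g <# c" "\<lambda>c. g <# c"])
    fix c assume c: "c \<in> ?S (\<lambda>x. m (g \<otimes> x))"
    then have c': "c \<in> lcosets K" by simp
    show "inv g <# (g <# c) = c" using shift(3)[OF c' g] .
    show "g <# c \<in> ?S m" using c shift(1,4)[OF c' g] by simp
    show "m (SOME x. x \<in> g <# c) = m (g \<otimes> (SOME x. x \<in> c))" using shift(4)[OF c' g] .
  next
    fix c assume c: "c \<in> ?S m"
    then have c': "c \<in> lcosets K" by simp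
    have d: "inv g <# c \<in> lcosets K" using shift(1)[OF c' inv_closed[OF g]] .
    show eq: "g <# (inv g <# c) = c" using shift(2)[OF c' g] .
    show "inv g <# c \<in> ?S (\<lambda>x. m (g \<otimes> x))"
      using d c shift(4)[OF d g] eq by simp
  qed
qed

end

lemma hecke_conv_coset_sum:
  assumes "group G"
  shows "hecke_conv G J m \<Psi> \<phi> g =
    (if g \<in> carrier G then group.coset_sum G J (\<lambda>x. m (\<Psi> x) (\<phi> (inv\<^bsub>G\<^esub> x \<otimes>\<^bsub>G\<^esub> g))) else 0)"
  unfolding hecke_conv_def group.coset_sum_def[OF assms] Let_def by simp

text \<open>Extend \<open>u\<close> to a basis and take the coordinate of \<open>u\<close>.\<close>

lemma hom_space_separates:
  assumes W: "complex_vector.subspace W" and u: "u \<in> W" "u \<noteq> 0"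
  shows "\<exists>l\<in>lin_dual W. l u \<noteq> 0"
proof -
  define B where "B = complex_vector.extend_basis {u}"
  have ind: "complex_vector.independent {u}" using u by simp
  have B: "complex_vector.independent B" "complex_vector.span B = UNIV" "u \<in> B"
    using complex_vector.independent_extend_basis[OF ind]
      complex_vector.span_extend_basis[OF ind] complex_vector.extend_basis_superset[OF ind]
    by (auto simp: B_def)
  define l where "l = (\<lambda>v. if v \<in> W then complex_vector.representation B v u else 0)"
  have "l u = 1" using u B by (simp add: l_def complex_vector.representation_basis)
  moreover have "l \<in> lin_dual W"
    unfolding hom_space_def linear_on_def l_def using B W
    by (auto simp: complex_vector.subspace_add complex_vector.subspace_scale
      complex_vector.representation_add complex_vector.representation_scale scaleC_complex_def)
  ultimately show ?thesis by (metis one_neq_zero)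
qed

section \<open>Compact induction from a compact open subgroup\<close>

lemma sum_apply: "(\<Sum>s\<in>S. h s) x = (\<Sum>s\<in>S. h s x)"
  by (induction S rule: infinite_finite_induct) simp_all

text \<open>Continuity of the translations is enough to pass between compact sets and finite unions of
  cosets of \<open>J\<close>; compactness of supports is always handled in the second form.\<close>

locale compact_open_rep = group G for G :: "('g, 'b) monoid_scheme" (structure) +
  fixes Top :: "'g topology" and J :: "'g set"
    and W :: "'w::complex_vector set" and lam :: "'g \<Rightarrow> 'w \<Rightarrow> 'w"
  assumes topspace_Top: "topspace Top = carrier G"
    and left_continuous: "g \<in> carrier G \<Longrightarrow> continuous_map Top Top (\<lambda>x. g \<otimes> x)"
    and right_continuous: "g \<in> carrier G \<Longrightarrow> continuous_map Top Top (\<lambda>x. x \<otimes> g)"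
    and J_subgroup: "subgroup J G"
    and J_open: "openin Top J"
    and J_compact: "compactin Top J"
    and lam_rep: "representation (G\<lparr>carrier := J\<rparr>) W lam"
    and lam_smooth: "\<exists>U. openin Top U \<and> \<one> \<in> U \<and> U \<subseteq> J \<and> (\<forall>j\<in>U. \<forall>w\<in>W. lam j w = w)"
begin

abbreviation "rho \<equiv> right_translation G"
abbreviation "I \<equiv> cind_space Top G J W lam"

lemma J_carrier [simp]: "j \<in> J \<Longrightarrow> j \<in> carrier G"
  using subgroup.subset[OF J_subgroup] by blast

lemma J_one [simp]: "\<one> \<in> J" and J_mult [simp]: "i \<in> J \<Longrightarrow> j \<in> J \<Longrightarrow> i \<otimes> j \<in> J"
  and J_inv [simp]: "j \<in> J \<Longrightarrow> inv j \<in> J"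
  using J_subgroup by (auto simp: subgroup_def)

lemma J_mult_iff [simp]:
  assumes "j \<in> J" "x \<in> carrier G"
  shows "j \<otimes> x \<in> J \<longleftrightarrow> x \<in> J" "x \<otimes> j \<in> J \<longleftrightarrow> x \<in> J"
proof -
  have "x = inv j \<otimes> (j \<otimes> x)" "x = (x \<otimes> j) \<otimes> inv j"
    using assms by (simp_all add: m_assoc[symmetric] del: J_inv) (simp add: m_assoc assms)
  then show "j \<otimes> x \<in> J \<longleftrightarrow> x \<in> J" "x \<otimes> j \<in> J \<longleftrightarrow> x \<in> J"
    using assms by (metis J_inv J_mult)+
qed

lemma W_subspace: "complex_vector.subspace W"
  using lam_rep by (simp add: representation_def)

lemma W_0 [simp]: "0 \<in> W" and W_add [simp]: "u \<in> W \<Longrightarrow> v \<in> W \<Longrightarrow> u + v \<in> W"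
  and W_scale [simp]: "u \<in> W \<Longrightarrow> c *\<^sub>C u \<in> W"
  using W_subspace
  by (auto simp: complex_vector.subspace_0 complex_vector.subspace_add
      complex_vector.subspace_scale)

lemma W_sum: "(\<And>x. x \<in> S \<Longrightarrow> h x \<in> W) \<Longrightarrow> sum h S \<in> W"
  using complex_vector.subspace_sum[OF W_subspace] by blast

lemma lam_W [simp]: "j \<in> J \<Longrightarrow> w \<in> W \<Longrightarrow> lam j w \<in> W"
  and lam_add: "j \<in> J \<Longrightarrow> v \<in> W \<Longrightarrow> w \<in> W \<Longrightarrow> lam j (v + w) = lam j v + lam j w"
  and lam_scale: "j \<in> J \<Longrightarrow> w \<in> W \<Longrightarrow> lam j (c *\<^sub>C w) = c *\<^sub>C lam j w"
  and lam_one [simp]: "w \<in> W \<Longrightarrow> lam \<one> w = w"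
  and lam_mult: "i \<in> J \<Longrightarrow> j \<in> J \<Longrightarrow> w \<in> W \<Longrightarrow> lam (i \<otimes> j) w = lam i (lam j w)"
  using lam_rep by (auto simp: representation_def linear_on_def)

lemma lam_0 [simp]: "j \<in> J \<Longrightarrow> lam j 0 = 0"
  using lam_scale[of j 0 0] by simp

lemma lam_inv [simp]:
  assumes "j \<in> J" "w \<in> W"
  shows "lam (inv j) (lam j w) = w" "lam j (lam (inv j) w) = w"
  by (metis J_carrier J_inv l_inv lam_mult lam_one assms)
     (metis J_carrier J_inv r_inv lam_mult lam_one assms)

lemma lam_sum:
  assumes j: "j \<in> J" and h: "\<And>x. x \<in> S \<Longrightarrow> h x \<in> W"
  shows "lam j (sum h S) = (\<Sum>x\<in>S. lam j (h x))"
proof (cases "finite S")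
  case True
  then show ?thesis using h
    by (induction S rule: finite_induct) (simp_all add: j lam_add W_sum)
qed (simp add: j)

subsection \<open>Compactness and cosets\<close>

lemma open_translate:
  assumes U: "openin Top U" and g: "g \<in> carrier G"
  shows "openin Top (g <# U)" "openin Top (U #> g)"
proof -
  have UG: "U \<subseteq> carrier G" using openin_subset[OF U] topspace_Top by simp
  have "g <# U = {x \<in> topspace Top. inv g \<otimes> x \<in> U}"
    using UG g unfolding l_coset_def topspace_Top
    by (auto simp: m_assoc[symmetric] intro!: bexI[of _ "inv g \<otimes> _"] dest: subsetD[OF UG])
  then show "openin Top (g <# U)"
    using openin_continuous_map_preimage[OF left_continuous[OF inv_closed[OF g]] U] by simp
  have "U #> g = {x \<in> topspace Top. x \<otimes> inv g \<in> U}"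
    using UG g unfolding r_coset_def topspace_Top
    by (auto simp: m_assoc intro!: bexI[of _ "_ \<otimes> inv g"] dest: subsetD[OF UG])
  then show "openin Top (U #> g)"
    using openin_continuous_map_preimage[OF right_continuous[OF inv_closed[OF g]] U] by simp
qed

text \<open>\<open>S\<close> is a union of translates of \<open>U\<close>.\<close>

lemma openI_translate:
  assumes S: "S \<subseteq> carrier G" and U: "openin Top U" "\<one> \<in> U"
    and SU: "\<And>s u. s \<in> S \<Longrightarrow> u \<in> U \<Longrightarrow> s \<otimes> u \<in> S"
  shows "openin Top S"
proof -
  have "S = (\<Union>s\<in>S. s <# U)"
  proof
    show "S \<subseteq> (\<Union>s\<in>S. s <# U)"
    proof
      fix s assume s: "s \<in> S"
      then have "s = s \<otimes> \<one>" using S by auto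
      then have "s \<in> s <# U" using U(2) unfolding l_coset_def by blast
      then show "s \<in> (\<Union>s\<in>S. s <# U)" using s by blast
    qed
    show "(\<Union>s\<in>S. s <# U) \<subseteq> S" using SU by (auto simp: l_coset_def)
  qed
  moreover have "openin Top (\<Union>s\<in>S. s <# U)"
    using open_translate(1)[OF U(1)] S by (intro openin_Union) auto
  ultimately show ?thesis by simp
qed

lemma mem_coset_self:
  assumes "x \<in> carrier G" "\<one> \<in> U"
  shows "x \<in> x <# U" "x \<in> U #> x"
  using assms by (auto simp: l_coset_def r_coset_def intro!: bexI[of _ \<one>])

lemma compact_cover:
  assumes C: "compactin Top C" and U: "openin Top U" "\<one> \<in> U"
  shows "\<exists>F. finite F \<and> F \<subseteq> C \<and> C \<subseteq> (\<Union>x\<in>F. x <# U)"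
    and "\<exists>F. finite F \<and> F \<subseteq> C \<and> C \<subseteq> (\<Union>x\<in>F. U #> x)"
proof -
  have CG: "C \<subseteq> carrier G" using compactin_subset_topspace[OF C] topspace_Top by simp
  have *: "\<exists>F. finite F \<and> F \<subseteq> C \<and> C \<subseteq> (\<Union>x\<in>F. N x)"
    if N: "\<And>x. x \<in> C \<Longrightarrow> openin Top (N x) \<and> x \<in> N x" for N
  proof -
    have "\<exists>\<F>. finite \<F> \<and> \<F> \<subseteq> N ` C \<and> C \<subseteq> \<Union>\<F>"
      using C N unfolding compactin_def by (elim conjE allE[of _ "N ` C"]) blast
    then obtain \<F> where F: "finite \<F>" "\<F> \<subseteq> N ` C" "C \<subseteq> \<Union>\<F>" by blast
    obtain F where "F \<subseteq> C" "finite F" "\<F> = N ` F" using finite_subset_image[OF F(1,2)] by blast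
    then show ?thesis using F by blast
  qed
  show "\<exists>F. finite F \<and> F \<subseteq> C \<and> C \<subseteq> (\<Union>x\<in>F. x <# U)"
    by (rule *) (use CG open_translate(1)[OF U(1)] mem_coset_self(1) U(2) in blast)
  show "\<exists>F. finite F \<and> F \<subseteq> C \<and> C \<subseteq> (\<Union>x\<in>F. U #> x)"
    by (rule *) (use CG open_translate(2)[OF U(1)] mem_coset_self(2) U(2) in blast)
qed

lemma compact_coset:
  assumes g: "g \<in> carrier G"
  shows "compactin Top (g <# J)" "compactin Top (J #> g)"
proof -
  have "g <# J = (\<lambda>x. g \<otimes> x) ` J" "J #> g = (\<lambda>x. x \<otimes> g) ` J"
    by (auto simp: l_coset_def r_coset_def)
  then show "compactin Top (g <# J)" "compactin Top (J #> g)"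
    using image_compactin[OF J_compact left_continuous[OF g]]
      image_compactin[OF J_compact right_continuous[OF g]] by simp_all
qed

lemma compact_UN:
  "finite F \<Longrightarrow> F \<subseteq> carrier G \<Longrightarrow> compactin Top (\<Union>x\<in>F. x <# J)"
  "finite F \<Longrightarrow> F \<subseteq> carrier G \<Longrightarrow> compactin Top (\<Union>x\<in>F. J #> x)"
  by (auto intro!: compactin_Union compact_coset)

lemma mem_r_coset: "x \<in> carrier G \<Longrightarrow> y \<in> carrier G \<Longrightarrow> x \<in> J #> y \<longleftrightarrow> x \<otimes> inv y \<in> J"
  unfolding r_coset_def
  by (auto simp: m_assoc intro!: bexI[of _ "x \<otimes> inv y"])

lemma mem_l_coset: "x \<in> carrier G \<Longrightarrow> y \<in> carrier G \<Longrightarrow> x \<in> y <# J \<longleftrightarrow> inv y \<otimes> x \<in> J"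
  unfolding l_coset_def
  by (auto simp: m_assoc[symmetric] intro!: bexI[of _ "inv y \<otimes> x"])

subsection \<open>Membership in the compactly induced space\<close>

lemma rho_apply: "g \<in> carrier G \<Longrightarrow> rho x h g = h (g \<otimes> x)"
  and rho_outside: "g \<notin> carrier G \<Longrightarrow> rho x h g = 0"
  by (simp_all add: right_translation_def)

lemma rho_add: "rho x (h + k) = rho x h + rho x k"
  and rho_scale: "rho x (c *\<^sub>C h) = c *\<^sub>C rho x h"
  and rho_0: "rho x 0 = 0"
  by (auto simp: right_translation_def fun_eq_iff scaleC_fun_def)

lemma rho_sum: "rho x (sum h S) = (\<Sum>s\<in>S. rho x (h s))"
  by (auto simp: fun_eq_iff right_translation_def sum_apply)

lemma rho_mult: "x \<in> carrier G \<Longrightarrow> y \<in> carrier G \<Longrightarrow> rho (x \<otimes> y) h = rho x (rho y h)"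
  by (auto simp: right_translation_def fun_eq_iff m_assoc)

lemma rho_one:
  assumes "\<And>g. g \<notin> carrier G \<Longrightarrow> h g = 0"
  shows "rho \<one> h = h"
  using assms by (auto simp: right_translation_def fun_eq_iff)

lemma I_W: "h \<in> I \<Longrightarrow> h g \<in> W"
  and I_outside: "h \<in> I \<Longrightarrow> g \<notin> carrier G \<Longrightarrow> h g = 0"
  and I_equivariant: "h \<in> I \<Longrightarrow> j \<in> J \<Longrightarrow> g \<in> carrier G \<Longrightarrow> h (j \<otimes> g) = lam j (h g)"
  and I_smooth: "h \<in> I \<Longrightarrow> openin Top {x \<in> carrier G. rho x h = h}"
proof -
  assume h: "h \<in> I"
  then show "h g \<in> W"
    by (cases "g \<in> carrier G") (auto simp: cind_space_def ind_space_def)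
qed (auto simp: cind_space_def ind_space_def)

text \<open>A compact set meets only finitely many cosets of the open subgroup \<open>J\<close>.\<close>

lemma I_cover:
  assumes h: "h \<in> I"
  shows "\<exists>F. finite F \<and> F \<subseteq> carrier G \<and> (\<forall>x\<in>carrier G. h x \<noteq> 0 \<longrightarrow> (\<exists>y\<in>F. x \<otimes> inv y \<in> J))"
proof -
  obtain C where C: "compactin Top C" "supp_on G h \<subseteq> J <#> C"
    using h by (auto simp: cind_space_def)
  have CG: "C \<subseteq> carrier G" using compactin_subset_topspace[OF C(1)] topspace_Top by simp
  obtain F where F: "finite F" "F \<subseteq> C" "C \<subseteq> (\<Union>x\<in>F. J #> x)"
    using compact_cover(2)[OF C(1) J_open J_one] by blast
  have "\<exists>y\<in>F. x \<otimes> inv y \<in> J" if x: "x \<in> carrier G" "h x \<noteq> 0" for x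
  proof -
    obtain j c where jc: "j \<in> J" "c \<in> C" "x = j \<otimes> c"
      using x C(2) by (force simp: supp_on_def set_mult_def)
    obtain y where y: "y \<in> F" "c \<in> J #> y" using F jc by blast
    have yc: "y \<in> carrier G" "c \<in> carrier G" using y F(2) jc CG by auto
    then have "c \<otimes> inv y \<in> J" using y mem_r_coset by blast
    moreover have "x \<otimes> inv y = j \<otimes> (c \<otimes> inv y)" using jc yc by (simp add: m_assoc)
    ultimately have "x \<otimes> inv y \<in> J" using jc by simp
    then show ?thesis using y by blast
  qed
  then show ?thesis using F CG by blast
qed

lemma stabilizer_openI:
  assumes U: "openin Top U" "\<one> \<in> U" "\<And>u. u \<in> U \<Longrightarrow> rho u h = h"
  shows "openin Top {x \<in> carrier G. rho x h = h}"
proof (rule openI_translate[OF _ U(1,2)])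
  have UG: "U \<subseteq> carrier G" using openin_subset[OF U(1)] topspace_Top by simp
  fix s u assume "s \<in> {x \<in> carrier G. rho x h = h}" "u \<in> U"
  then show "s \<otimes> u \<in> {x \<in> carrier G. rho x h = h}" using U UG by (auto simp: rho_mult)
qed simp

lemma I_memI:
  assumes "\<And>g. g \<in> carrier G \<Longrightarrow> h g \<in> W" "\<And>g. g \<notin> carrier G \<Longrightarrow> h g = 0"
    and "\<And>j g. j \<in> J \<Longrightarrow> g \<in> carrier G \<Longrightarrow> h (j \<otimes> g) = lam j (h g)"
    and U: "openin Top U" "\<one> \<in> U" "\<And>u. u \<in> U \<Longrightarrow> rho u h = h"
    and F: "finite F" "F \<subseteq> carrier G"
      "\<And>x. x \<in> carrier G \<Longrightarrow> h x \<noteq> 0 \<Longrightarrow> \<exists>y\<in>F. x \<otimes> inv y \<in> J"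
  shows "h \<in> I"
proof -
  have "compactin Top F"
    using F topspace_Top by (intro finite_imp_compactin) auto
  moreover have "supp_on G h \<subseteq> J <#> F"
  proof
    fix x assume "x \<in> supp_on G h"
    then have x: "x \<in> carrier G" "h x \<noteq> 0" by (auto simp: supp_on_def)
    obtain y where y: "y \<in> F" "x \<otimes> inv y \<in> J" using F(3)[OF x] by blast
    then have "x = (x \<otimes> inv y) \<otimes> y" using F(2) x by (auto simp: m_assoc)
    then show "x \<in> J <#> F" using y unfolding set_mult_def by blast
  qed
  ultimately show ?thesis
    using assms(1-3) stabilizer_openI[OF U] unfolding cind_space_def ind_space_def by blast
qed

lemma I_0: "0 \<in> I"
  by (rule I_memI[where U = "carrier G" and F = "{}"])
     (use topspace_Top openin_topspace[of Top] in \<open>auto simp: rho_0\<close>)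

lemma I_add:
  assumes h: "h \<in> I" and k: "k \<in> I"
  shows "h + k \<in> I"
proof -
  obtain F where F: "finite F" "F \<subseteq> carrier G"
    "\<And>x. x \<in> carrier G \<Longrightarrow> h x \<noteq> 0 \<Longrightarrow> \<exists>y\<in>F. x \<otimes> inv y \<in> J"
    using I_cover[OF h] by blast
  obtain F' where F': "finite F'" "F' \<subseteq> carrier G"
    "\<And>x. x \<in> carrier G \<Longrightarrow> k x \<noteq> 0 \<Longrightarrow> \<exists>y\<in>F'. x \<otimes> inv y \<in> J"
    using I_cover[OF k] by blast
  let ?U = "\<lambda>h. {x \<in> carrier G. rho x h = h}"
  show ?thesis
  proof (rule I_memI[where U = "?U h \<inter> ?U k" and F = "F \<union> F'"])
    show "openin Top (?U h \<inter> ?U k)" using I_smooth[OF h] I_smooth[OF k] by blast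
    show "\<one> \<in> ?U h \<inter> ?U k" using rho_one I_outside[OF h] I_outside[OF k] by auto
    fix x assume x: "x \<in> carrier G" "(h + k) x \<noteq> 0"
    then have "h x \<noteq> 0 \<or> k x \<noteq> 0" by auto
    then show "\<exists>y\<in>F \<union> F'. x \<otimes> inv y \<in> J" using F(3)[OF x(1)] F'(3)[OF x(1)] by blast
  qed (use F F' in \<open>auto simp: I_W I_outside I_equivariant h k lam_add rho_add\<close>)
qed

lemma I_scale:
  assumes h: "h \<in> I"
  shows "c *\<^sub>C h \<in> I"
proof -
  obtain F where F: "finite F" "F \<subseteq> carrier G"
    "\<And>x. x \<in> carrier G \<Longrightarrow> h x \<noteq> 0 \<Longrightarrow> \<exists>y\<in>F. x \<otimes> inv y \<in> J"
    using I_cover[OF h] by blast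
  show ?thesis
  proof (rule I_memI[where U = "{x \<in> carrier G. rho x h = h}" and F = F])
    show "openin Top {x \<in> carrier G. rho x h = h}" using I_smooth[OF h] .
    show "\<one> \<in> {x \<in> carrier G. rho x h = h}" using rho_one I_outside[OF h] by auto
    fix x assume x: "x \<in> carrier G" "(c *\<^sub>C h) x \<noteq> 0"
    then show "\<exists>y\<in>F. x \<otimes> inv y \<in> J" using F(3)[OF x(1)] by (auto simp: scaleC_fun_def)
  qed (use F in \<open>auto simp: scaleC_fun_def I_W I_outside I_equivariant h lam_scale rho_scale[unfolded scaleC_fun_def]\<close>)
qed

lemma I_subspace: "complex_vector.subspace I"
  using I_0 I_add I_scale by (auto simp: complex_vector.subspace_def)

lemma I_rho:
  assumes h: "h \<in> I" and g: "g \<in> carrier G"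
  shows "rho g h \<in> I"
proof -
  obtain F where F: "finite F" "F \<subseteq> carrier G"
    "\<And>x. x \<in> carrier G \<Longrightarrow> h x \<noteq> 0 \<Longrightarrow> \<exists>y\<in>F. x \<otimes> inv y \<in> J"
    using I_cover[OF h] by blast
  let ?U = "{x \<in> topspace Top. inv g \<otimes> x \<otimes> g \<in> {x \<in> carrier G. rho x h = h}}"
  show ?thesis
  proof (rule I_memI[where U = ?U and F = "(\<lambda>y. y \<otimes> inv g) ` F"])
    have "continuous_map Top Top (\<lambda>x. inv g \<otimes> x \<otimes> g)"
      using continuous_map_compose[OF left_continuous[OF inv_closed[OF g]] right_continuous[OF g]]
      by (simp add: o_def)
    then show "openin Top ?U"
      by (rule openin_continuous_map_preimage) (rule I_smooth[OF h])
    show "\<one> \<in> ?U" using rho_one I_outside[OF h] g topspace_Top by auto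
    fix u assume u: "u \<in> ?U"
    then have uc: "u \<in> carrier G" "rho (inv g \<otimes> u \<otimes> g) h = h" using topspace_Top by auto
    have "rho u (rho g h) = rho (g \<otimes> (inv g \<otimes> u \<otimes> g)) h"
      using uc g by (simp add: rho_mult[symmetric] m_assoc[symmetric])
    then show "rho u (rho g h) = rho g h" using uc g by (simp add: rho_mult)
  next
    fix x assume x: "x \<in> carrier G" "rho g h x \<noteq> 0"
    then have "h (x \<otimes> g) \<noteq> 0" by (simp add: rho_apply)
    then obtain y where y: "y \<in> F" "x \<otimes> g \<otimes> inv y \<in> J" using F(3)[of "x \<otimes> g"] x g by auto
    then have "y \<in> carrier G" using F by auto
    then show "\<exists>y\<in>(\<lambda>y. y \<otimes> inv g) ` F. x \<otimes> inv y \<in> J"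
      using y x g by (intro bexI[of _ "y \<otimes> inv g"]) (auto simp: inv_mult_group m_assoc)
  qed (use F g in \<open>auto simp: rho_apply rho_outside I_W[OF h] I_equivariant[OF h] m_assoc\<close>)
qed

lemma I_sum: "(\<And>x. x \<in> S \<Longrightarrow> h x \<in> I) \<Longrightarrow> sum h S \<in> I"
  using complex_vector.subspace_sum[OF I_subspace] by blast

text \<open>The image of \<open>w\<close> in \<open>ind\<^sub>J\<^sup>G \<lambda>\<close> under Frobenius reciprocity.\<close>

definition delta :: "'w \<Rightarrow> 'g \<Rightarrow> 'w"
  where "delta w = (\<lambda>g. if g \<in> J then lam g w else 0)"

lemma delta_I:
  assumes w: "w \<in> W"
  shows "delta w \<in> I"
proof -
  obtain U where U: "openin Top U" "\<one> \<in> U" "U \<subseteq> J" "\<And>j w. j \<in> U \<Longrightarrow> w \<in> W \<Longrightarrow> lam j w = w"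
    using lam_smooth by blast
  show ?thesis
  proof (rule I_memI[where U = U and F = "{\<one>}"])
    fix u assume u: "u \<in> U"
    then have uJ: "u \<in> J" using U by blast
    show "rho u (delta w) = delta w"
      using u uJ w by (auto simp: fun_eq_iff right_translation_def delta_def lam_mult U(4))
  qed (use U w in \<open>auto simp: delta_def lam_mult split: if_splits\<close>)
qed

text \<open>The function supported on one coset with a given value is a translate of \<^const>\<open>delta\<close>, so
  the translates of these functions span the compactly induced space.\<close>

lemma I_decompose:
  assumes h: "h \<in> I"
  shows "\<exists>R. finite R \<and> R \<subseteq> carrier G \<and> h = (\<Sum>y\<in>R. rho (inv y) (delta (h y)))"
proof -
  obtain F where F: "finite F" "F \<subseteq> carrier G"
    "\<And>x. x \<in> carrier G \<Longrightarrow> h x \<noteq> 0 \<Longrightarrow> \<exists>y\<in>F. x \<otimes> inv y \<in> J"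
    using I_cover[OF h] by blast
  define r where "r x = (SOME y. y \<in> F \<and> x \<otimes> inv y \<in> J)" for x
  have r: "r x \<in> F \<and> x \<otimes> inv (r x) \<in> J" if "\<exists>y\<in>F. x \<otimes> inv y \<in> J" for x
    unfolding r_def using someI_ex[of "\<lambda>y. y \<in> F \<and> x \<otimes> inv y \<in> J"] that by blast
  \<comment> \<open>\<open>r\<close> picks one element of \<open>F\<close> in each right coset that meets \<open>F\<close>.\<close>
  have r_eq: "r x = r x'" if "x \<in> carrier G" "x' \<in> carrier G" "x \<otimes> inv x' \<in> J" for x x'
  proof -
    have "x \<otimes> inv y \<in> J \<longleftrightarrow> x' \<otimes> inv y \<in> J" if "y \<in> F" for y
    proof -
      have y: "y \<in> carrier G" using F that by auto
      have "x \<otimes> inv y = (x \<otimes> inv x') \<otimes> (x' \<otimes> inv y)"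
        using \<open>x \<in> carrier G\<close> \<open>x' \<in> carrier G\<close> y by (simp add: m_assoc[symmetric] inv_solve_right')
           (simp add: m_assoc)
      then show ?thesis using \<open>x \<otimes> inv x' \<in> J\<close> \<open>x' \<in> carrier G\<close> y by simp
    qed
    then have "(\<lambda>y. y \<in> F \<and> x \<otimes> inv y \<in> J) = (\<lambda>y. y \<in> F \<and> x' \<otimes> inv y \<in> J)" by blast
    then show ?thesis unfolding r_def by simp
  qed
  have rF: "r y \<in> F \<and> y \<otimes> inv (r y) \<in> J" if "y \<in> F" for y
    using that F by (intro r bexI[of _ y]) auto
  define R where "R = r ` F"
  have RF: "R \<subseteq> F" using rF by (auto simp: R_def)
  have rR: "r y = y" if "y \<in> R" for y
  proof -
    from that have "y \<in> r ` F" by (simp add: R_def)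
    then obtain z where z: "z \<in> F" "y = r z" by blast
    have zc: "z \<in> carrier G" "r z \<in> carrier G" using z rF F by auto
    show ?thesis using r_eq[OF zc] rF[OF z(1)] z by simp
  qed
  have "h x = (\<Sum>y\<in>R. rho (inv y) (delta (h y))) x" for x
  proof (cases "x \<in> carrier G")
    case False
    then show ?thesis using I_outside[OF h] by (simp add: sum_apply rho_outside)
  next
    case True
    have eq: "(\<Sum>y\<in>R. rho (inv y) (delta (h y))) x = (\<Sum>y\<in>R. if x \<otimes> inv y \<in> J then h x else 0)"
      unfolding sum_apply
    proof (rule sum.cong[OF refl])
      fix y assume "y \<in> R"
      then have y: "y \<in> carrier G" using RF F by auto
      show "rho (inv y) (delta (h y)) x = (if x \<otimes> inv y \<in> J then h x else 0)"
      proof (cases "x \<otimes> inv y \<in> J")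
        case J: True
        have "h x = h ((x \<otimes> inv y) \<otimes> y)" using True y by (simp add: m_assoc)
        also have "\<dots> = lam (x \<otimes> inv y) (h y)" using I_equivariant[OF h J y] .
        finally show ?thesis using True J by (simp add: rho_apply delta_def)
      qed (use True in \<open>simp add: rho_apply delta_def\<close>)
    qed
    show ?thesis
    proof (cases "h x = 0")
      case False
      obtain y0 where y0: "y0 \<in> F" "x \<otimes> inv y0 \<in> J" using F(3)[OF True False] by blast
      have rx: "r x \<in> F" "x \<otimes> inv (r x) \<in> J" using r y0 by blast+
      have "r x = r y0" using r_eq[OF True _ y0(2)] y0 F by auto
      then have rxR: "r x \<in> R" using y0 by (auto simp: R_def)
      have "x \<otimes> inv y \<in> J \<longleftrightarrow> y = r x" if "y \<in> R" for y
        using that rx r_eq[OF True, of y] rR[OF that] RF F by auto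
      then have "(\<Sum>y\<in>R. if x \<otimes> inv y \<in> J then h x else 0) = (\<Sum>y\<in>R. if y = r x then h x else 0)"
        by (intro sum.cong) auto
      then show ?thesis using rxR eq finite_subset[OF RF F(1)] by simp
    next
      case True
      then have "(\<Sum>y\<in>R. if x \<otimes> inv y \<in> J then h x else 0) = 0"
        by (intro sum.neutral) simp
      then show ?thesis using True eq by simp
    qed
  qed
  then have "h = (\<Sum>y\<in>R. rho (inv y) (delta (h y)))" by (rule ext)
  then show ?thesis using RF F(2) finite_subset[OF RF F(1)] by blast
qed

text \<open>Every linear form on \<open>W\<close> is smooth, since \<open>\<lambda>\<close> is trivial on an open subgroup.\<close>

lemma W'_eq: "contra_space (subtopology Top J) (G\<lparr>carrier := J\<rparr>) W lam = lin_dual W"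
proof -
  obtain U where U: "openin Top U" "\<one> \<in> U" "U \<subseteq> J" "\<And>j w. j \<in> U \<Longrightarrow> w \<in> W \<Longrightarrow> lam j w = w"
    using lam_smooth by blast
  have "openin (subtopology Top J) {g \<in> J. \<forall>v\<in>W. l (lam g v) = l v}" for l :: "'w \<Rightarrow> complex"
  proof -
    have "openin Top {g \<in> J. \<forall>v\<in>W. l (lam g v) = l v}"
    proof (rule openI_translate[OF _ U(1,2)])
      fix s u assume "s \<in> {g \<in> J. \<forall>v\<in>W. l (lam g v) = l v}" "u \<in> U"
      moreover from this have "u \<in> J" using U by blast
      ultimately show "s \<otimes> u \<in> {g \<in> J. \<forall>v\<in>W. l (lam g v) = l v}"
        by (simp add: lam_mult U(4))
    qed auto
    then show ?thesis by (simp add: openin_open_subtopology[OF J_open] subset_iff)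
  qed
  then show ?thesis by (auto simp: contra_space_def)
qed

subsection \<open>The functional attached to a function in the completed Hecke algebra\<close>

lemma hecke_barD:
  assumes "\<Psi> \<in> hecke_bar G J W lam"
  shows "w \<in> W \<Longrightarrow> \<Psi> g w \<in> W"
    and "v \<in> W \<Longrightarrow> w \<in> W \<Longrightarrow> \<Psi> g (v + w) = \<Psi> g v + \<Psi> g w"
    and "w \<in> W \<Longrightarrow> \<Psi> g (c *\<^sub>C w) = c *\<^sub>C \<Psi> g w"
    and "w \<notin> W \<Longrightarrow> \<Psi> g w = 0"
    and "i \<in> J \<Longrightarrow> g \<in> carrier G \<Longrightarrow> w \<in> W \<Longrightarrow> \<Psi> (i \<otimes> g) w = lam i (\<Psi> g w)"
    and "i \<in> J \<Longrightarrow> g \<in> carrier G \<Longrightarrow> w \<in> W \<Longrightarrow> \<Psi> (g \<otimes> i) w = \<Psi> g (lam i w)"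
    and "\<Psi> g 0 = 0"
proof -
  have *: "\<Psi> g \<in> hom_space W W"
    using assms by (cases "g \<in> carrier G") (auto simp: hecke_bar_def hom_space_def linear_on_def)
  show W: "w \<in> W \<Longrightarrow> \<Psi> g w \<in> W" for w using * by (auto simp: hom_space_def linear_on_def)
  show "v \<in> W \<Longrightarrow> w \<in> W \<Longrightarrow> \<Psi> g (v + w) = \<Psi> g v + \<Psi> g w"
    and "w \<notin> W \<Longrightarrow> \<Psi> g w = 0"
    using * by (auto simp: hom_space_def linear_on_def)
  show s: "w \<in> W \<Longrightarrow> \<Psi> g (c *\<^sub>C w) = c *\<^sub>C \<Psi> g w" for c w
    using * by (auto simp: hom_space_def linear_on_def)
  show "\<Psi> g 0 = 0" using s[of 0 0] by simp
  assume i: "i \<in> J" and g: "g \<in> carrier G" and w: "w \<in> W"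
  have j: "\<Psi> (j1 \<otimes> g \<otimes> j2) w = lam j1 (\<Psi> g (lam j2 w))" if "j1 \<in> J" "j2 \<in> J" for j1 j2
    using assms that g w by (auto simp: hecke_bar_def)
  show "\<Psi> (i \<otimes> g) w = lam i (\<Psi> g w)" using j[OF i J_one] i g w by simp
  show "\<Psi> (g \<otimes> i) w = \<Psi> g (lam i w)" using j[OF J_one i] i g w W by simp
qed

text \<open>The value at \<open>1\<close> of the convolution \<open>\<Psi> \<star> h\<close>.\<close>

definition eval_conv :: "('g \<Rightarrow> 'w \<Rightarrow> 'w) \<Rightarrow> ('g \<Rightarrow> 'w) \<Rightarrow> 'w"
  where "eval_conv \<Psi> h = coset_sum J (\<lambda>x. \<Psi> x (h (inv x)))"

context
  fixes \<Psi> assumes Psi: "\<Psi> \<in> hecke_bar G J W lam"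
begin

lemmas Psi_simps = hecke_barD[OF Psi]

text \<open>The summands of the convolution are constant on cosets: the right equivariance of \<open>\<Psi>\<close> cancels
  the left equivariance of \<open>h\<close>.\<close>

lemma eval_summand_invariant:
  assumes h: "h \<in> I" and x: "x \<in> carrier G" and k: "k \<in> J" and g: "g \<in> carrier G"
  shows "\<Psi> (x \<otimes> k) (h (inv (x \<otimes> k) \<otimes> g)) = \<Psi> x (h (inv x \<otimes> g))"
proof -
  have "h (inv (x \<otimes> k) \<otimes> g) = lam (inv k) (h (inv x \<otimes> g))"
    using I_equivariant[OF h, of "inv k" "inv x \<otimes> g"] x k g by (simp add: inv_mult_group m_assoc)
  then show ?thesis using x k g I_W[OF h] Psi_simps(6)[of k x] by simp
qed

lemma I_finite_cosets:
  assumes h: "h \<in> I"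
  shows "\<exists>C. finite C \<and> C \<subseteq> lcosets J \<and> (\<forall>x\<in>carrier G. h (inv x) \<noteq> 0 \<longrightarrow> x <# J \<in> C)"
proof -
  obtain F where F: "finite F" "F \<subseteq> carrier G"
    "\<And>x. x \<in> carrier G \<Longrightarrow> h x \<noteq> 0 \<Longrightarrow> \<exists>y\<in>F. x \<otimes> inv y \<in> J"
    using I_cover[OF h] by blast
  have "x <# J \<in> (\<lambda>y. inv y <# J) ` F" if x: "x \<in> carrier G" "h (inv x) \<noteq> 0" for x
  proof -
    obtain y where y: "y \<in> F" "inv x \<otimes> inv y \<in> J" using F(3)[OF _ x(2)] x by auto
    have "inv y \<in> x <# J" using y x F by (subst mem_l_coset) auto
    then show ?thesis using l_repr_independence[OF _ x(1) J_subgroup] y by blast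
  qed
  then show ?thesis using F by (intro exI[of _ "(\<lambda>y. inv y <# J) ` F"]) (auto intro!: mem_lcosets)
qed

lemma eval_conv_eq:
  assumes C: "finite C" "C \<subseteq> lcosets J" "\<And>x. x \<in> carrier G \<Longrightarrow> h (inv x) \<noteq> 0 \<Longrightarrow> x <# J \<in> C"
  shows "eval_conv \<Psi> h = (\<Sum>c\<in>C. \<Psi> (SOME x. x \<in> c) (h (inv (SOME x. x \<in> c))))"
  unfolding eval_conv_def
  by (rule coset_sum_eq[OF J_subgroup C(1,2)]) (use C(3) Psi_simps(7) in fastforce)

lemma eval_conv_W: "h \<in> I \<Longrightarrow> eval_conv \<Psi> h \<in> W"
  unfolding eval_conv_def coset_sum_def by (rule W_sum) (auto simp: Psi_simps I_W)

lemma eval_conv_add: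
  assumes h: "h \<in> I" and k: "k \<in> I"
  shows "eval_conv \<Psi> (h + k) = eval_conv \<Psi> h + eval_conv \<Psi> k"
proof -
  obtain C where C: "finite C" "C \<subseteq> lcosets J"
    "\<And>x. x \<in> carrier G \<Longrightarrow> h (inv x) \<noteq> 0 \<Longrightarrow> x <# J \<in> C"
    using I_finite_cosets[OF h] by blast
  obtain D where D: "finite D" "D \<subseteq> lcosets J"
    "\<And>x. x \<in> carrier G \<Longrightarrow> k (inv x) \<noteq> 0 \<Longrightarrow> x <# J \<in> D"
    using I_finite_cosets[OF k] by blast
  have eq: "eval_conv \<Psi> f = (\<Sum>c\<in>C \<union> D. \<Psi> (SOME x. x \<in> c) (f (inv (SOME x. x \<in> c))))"
    if "\<And>x. f x \<noteq> 0 \<Longrightarrow> h x \<noteq> 0 \<or> k x \<noteq> 0" for f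
  proof (rule eval_conv_eq)
    fix x assume "x \<in> carrier G" "f (inv x) \<noteq> 0"
    then show "x <# J \<in> C \<union> D" using that[of "inv x"] C(3) D(3) by blast
  qed (use C D in auto)
  have "(h + k) x \<noteq> 0 \<Longrightarrow> h x \<noteq> 0 \<or> k x \<noteq> 0" for x by auto
  then have "eval_conv \<Psi> (h + k)
      = (\<Sum>c\<in>C \<union> D. \<Psi> (SOME x. x \<in> c) ((h + k) (inv (SOME x. x \<in> c))))"
    by (rule eq)
  also have "\<dots> = eval_conv \<Psi> h + eval_conv \<Psi> k"
    using eq[of h] eq[of k] by (simp add: Psi_simps I_W h k sum.distrib)
  finally show ?thesis .
qed

lemma eval_conv_scale:
  assumes h: "h \<in> I"
  shows "eval_conv \<Psi> (c *\<^sub>C h) = c *\<^sub>C eval_conv \<Psi> h"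
proof -
  obtain C where C: "finite C" "C \<subseteq> lcosets J"
    "\<And>x. x \<in> carrier G \<Longrightarrow> h (inv x) \<noteq> 0 \<Longrightarrow> x <# J \<in> C"
    using I_finite_cosets[OF h] by blast
  have "eval_conv \<Psi> (c *\<^sub>C h)
      = (\<Sum>d\<in>C. \<Psi> (SOME x. x \<in> d) ((c *\<^sub>C h) (inv (SOME x. x \<in> d))))"
    by (rule eval_conv_eq) (use C in \<open>auto simp: scaleC_fun_def\<close>)
  also have "\<dots> = c *\<^sub>C eval_conv \<Psi> h"
    using eval_conv_eq[OF C] 
    by (simp add: scaleC_fun_def Psi_simps I_W h complex_vector.scale_sum_right)
  finally show ?thesis .
qed

lemma eval_conv_0: "eval_conv \<Psi> 0 = 0"
  using eval_conv_scale[OF I_0, of 0] by simp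

lemma eval_conv_sum:
  assumes "\<And>s. s \<in> S \<Longrightarrow> h s \<in> I"
  shows "eval_conv \<Psi> (\<Sum>s\<in>S. a s *\<^sub>C h s) = (\<Sum>s\<in>S. a s *\<^sub>C eval_conv \<Psi> (h s))"
  using assms
proof (induction S rule: infinite_finite_induct)
  case (insert x F)
  have F: "(\<Sum>s\<in>F. a s *\<^sub>C h s) \<in> I" and x: "h x \<in> I"
    using insert.prems by (auto intro!: I_sum I_scale)
  have IH: "eval_conv \<Psi> (\<Sum>s\<in>F. a s *\<^sub>C h s) = (\<Sum>s\<in>F. a s *\<^sub>C eval_conv \<Psi> (h s))"
    using insert.IH insert.prems by blast
  show ?case
    by (simp only: sum.insert[OF insert.hyps] eval_conv_add[OF I_scale[OF x] F]
        eval_conv_scale[OF x] IH)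
qed (simp_all only: sum.infinite sum.empty eval_conv_0 not_False_eq_True)

text \<open>Shift the summation by \<open>j\<close> and use the left equivariance of \<open>\<Psi>\<close>.\<close>

lemma eval_conv_rho_J:
  assumes h: "h \<in> I" and j: "j \<in> J"
  shows "eval_conv \<Psi> (rho j h) = lam j (eval_conv \<Psi> h)"
proof -
  let ?m = "\<lambda>x. \<Psi> x (h (inv x \<otimes> j))"
  obtain C where C: "finite C" "C \<subseteq> lcosets J"
    "\<And>x. x \<in> carrier G \<Longrightarrow> h (inv x) \<noteq> 0 \<Longrightarrow> x <# J \<in> C"
    using I_finite_cosets[OF h] by blast
  have nz: "lam j (\<Psi> x (h (inv x))) \<noteq> 0 \<Longrightarrow> h (inv x) \<noteq> 0" for x
    using j Psi_simps(7) by auto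
  have "eval_conv \<Psi> (rho j h) = coset_sum J ?m"
    unfolding eval_conv_def by (rule coset_sum_cong[OF J_subgroup]) (simp add: rho_apply)
  also have "\<dots> = coset_sum J (\<lambda>x. ?m (j \<otimes> x))"
    by (rule coset_sum_shift[OF J_subgroup, symmetric])
       (use eval_summand_invariant[OF h] j in auto)
  also have "\<dots> = coset_sum J (\<lambda>x. lam j (\<Psi> x (h (inv x))))"
  proof (rule coset_sum_cong[OF J_subgroup])
    fix x assume x: "x \<in> carrier G"
    have "inv (j \<otimes> x) \<otimes> j = inv x" using x j by (simp add: inv_mult_group m_assoc)
    then show "?m (j \<otimes> x) = lam j (\<Psi> x (h (inv x)))" using x j I_W[OF h] by (simp add: Psi_simps)
  qed
  also have "\<dots> = (\<Sum>c\<in>C. lam j (\<Psi> (SOME x. x \<in> c) (h (inv (SOME x. x \<in> c)))))"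
    by (rule coset_sum_eq[OF J_subgroup C(1,2)]) (use C(3) nz in blast)
  also have "\<dots> = lam j (eval_conv \<Psi> h)"
    using eval_conv_eq[OF C] j I_W[OF h] by (simp add: lam_sum Psi_simps)
  finally show ?thesis .
qed

text \<open>Thus \<open>\<Psi>\<close> is recovered from its functional by evaluation on the \<open>G\<close>-orbits of the functions
  \<^const>\<open>delta\<close>.\<close>

lemma eval_conv_delta:
  assumes w: "w \<in> W" and g: "g \<in> carrier G"
  shows "eval_conv \<Psi> (rho g (delta w)) = \<Psi> g w"
proof -
  let ?m = "\<lambda>x. \<Psi> x (delta w (inv x \<otimes> g))"
  have "eval_conv \<Psi> (rho g (delta w)) = coset_sum J ?m"
    unfolding eval_conv_def by (rule coset_sum_cong[OF J_subgroup]) (simp add: rho_apply)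
  also have "\<dots> = ?m g"
  proof (rule coset_sum_single[OF J_subgroup _ g])
    fix x assume "x \<in> carrier G" "?m x \<noteq> 0"
    then show "inv x \<otimes> g \<in> J" using Psi_simps(7) by (auto simp: delta_def split: if_splits)
  qed (use eval_summand_invariant[OF delta_I[OF w]] g in auto)
  finally show ?thesis using g w by (simp add: delta_def)
qed

end

text \<open>The trace of \<open>\<Sum>\<^sub>c u\<^sub>c \<otimes> l\<^sub>c\<close> is \<open>\<Sum>\<^sub>c l\<^sub>c(u\<^sub>c)\<close>, and an operator with nonzero
  trace is nonzero.\<close>

lemma sum_rank_one_nonzero:
  fixes u :: "'c \<Rightarrow> 'a::complex_vector"
  assumes C: "finite C" and V: "complex_vector.subspace V" and u: "\<And>c. c \<in> C \<Longrightarrow> u c \<in> V"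
    and l: "\<And>c. c \<in> C \<Longrightarrow> linear_on V UNIV (l c)"
    and tr: "(\<Sum>c\<in>C. l c (u c)) \<noteq> 0"
  shows "\<exists>w\<in>V. (\<Sum>c\<in>C. l c w *\<^sub>C u c) \<noteq> 0"
proof (rule ccontr)
  assume "\<not> ?thesis"
  then have zero: "(\<Sum>c\<in>C. l c w *\<^sub>C u c) = 0" if "w \<in> V" for w using that by blast
  obtain B where B: "B \<subseteq> u ` C" "complex_vector.independent B" "u ` C \<subseteq> complex_vector.span B"
    using complex_vector.maximal_independent_subset by blast
  have fB: "finite B" using finite_subset[OF B(1)] C by simp
  have BV: "B \<subseteq> V" using B(1) u by blast
  let ?r = "complex_vector.representation B"
  have uS: "u c \<in> complex_vector.span B" if "c \<in> C" for c using B(3) that by blast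
  have l_sum: "l c (\<Sum>b\<in>S. a b *\<^sub>C b) = (\<Sum>b\<in>S. a b * l c b)"
    if "c \<in> C" "finite S" "S \<subseteq> V" for c S a
    using that(2,3)
  proof (induction S rule: finite_induct)
    case empty
    have "l c (0 *\<^sub>C u c) = 0 *\<^sub>C l c (u c)"
      using l[OF that(1)] u[OF that(1)] unfolding linear_on_def by blast
    then show ?case by simp
  next
    case (insert b S)
    have "(\<Sum>b\<in>S. a b *\<^sub>C b) \<in> V" "a b *\<^sub>C b \<in> V" "b \<in> V"
      using insert V by (auto intro!: complex_vector.subspace_sum complex_vector.subspace_scale)
    then show ?case using insert l[OF that(1)] by (simp add: linear_on_def scaleC_complex_def)
  qed
  have "(\<Sum>c\<in>C. l c b * ?r (u c) b) = 0" if "b \<in> B" for b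
  proof -
    have "?r (\<Sum>c\<in>C. l c b *\<^sub>C u c) b = (\<Sum>c\<in>C. ?r (l c b *\<^sub>C u c) b)"
      using complex_vector.representation_sum[OF B(2), of C "\<lambda>c. l c b *\<^sub>C u c"] uS
      by (simp add: complex_vector.span_scale)
    also have "\<dots> = (\<Sum>c\<in>C. l c b * ?r (u c) b)"
      using complex_vector.representation_scale[OF B(2) uS] by (intro sum.cong) auto
    finally show ?thesis using zero[of b] that BV by (auto simp: complex_vector.representation_zero)
  qed
  then have "0 = (\<Sum>b\<in>B. \<Sum>c\<in>C. l c b * ?r (u c) b)" by simp
  also have "\<dots> = (\<Sum>c\<in>C. \<Sum>b\<in>B. ?r (u c) b * l c b)"
    by (subst sum.swap) (simp add: mult.commute)
  also have "\<dots> = (\<Sum>c\<in>C. l c (\<Sum>b\<in>B. ?r (u c) b *\<^sub>C b))"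
    using l_sum fB BV by simp
  also have "\<dots> = (\<Sum>c\<in>C. l c (u c))"
    using complex_vector.sum_representation_eq[OF B(2) uS fB order_refl] by simp
  finally show False using tr by simp
qed

subsection \<open>Transposition between the two Hecke algebras\<close>

abbreviation "W' \<equiv> lin_dual W"
abbreviation "lam' \<equiv> contra_rep (G\<lparr>carrier := J\<rparr>) W lam"

lemma lin_dualD:
  assumes "l \<in> W'"
  shows "v \<in> W \<Longrightarrow> w \<in> W \<Longrightarrow> l (v + w) = l v + l w"
    and "w \<in> W \<Longrightarrow> l (c *\<^sub>C w) = c * l w"
    and "l 0 = 0"
proof -
  show "v \<in> W \<Longrightarrow> w \<in> W \<Longrightarrow> l (v + w) = l v + l w"
    and s: "w \<in> W \<Longrightarrow> l (c *\<^sub>C w) = c * l w" for c w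
    using assms by (auto simp: hom_space_def linear_on_def scaleC_complex_def)
  show "l 0 = 0" using s[of 0 0] by simp
qed

text \<open>Linear forms separate points, which makes the transpose in \<^const>\<open>transpose_end\<close> unique.\<close>

lemma lin_dual_eqI:
  assumes "v \<in> W" "w \<in> W" "\<And>l. l \<in> W' \<Longrightarrow> l v = l w"
  shows "v = w"
proof (rule ccontr)
  assume "v \<noteq> w"
  moreover have "v - w \<in> W" using assms complex_vector.subspace_diff[OF W_subspace] by blast
  ultimately obtain l where l: "l \<in> W'" "l (v - w) \<noteq> 0"
    using hom_space_separates[OF W_subspace, of "v - w"] by auto
  have "l v = l (v - w) + l w" using lin_dualD(1)[OF l(1) \<open>v - w \<in> W\<close> assms(2)] by simp
  then show False using assms(3)[OF l(1)] l(2) by simp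
qed

lemma lam'_apply:
  "j \<in> J \<Longrightarrow> lam' j l v = (if v \<in> W then l (lam (inv j) v) else 0)"
  by (simp add: contra_rep_def m_inv_consistent[OF J_subgroup])

text \<open>The transpose of a function on \<open>G\<close> with values in the endomorphisms of \<open>W\<close>, inverse to
  \<^const>\<open>hecke_tilde\<close>.\<close>

definition hecke_transpose :: "('g \<Rightarrow> 'w \<Rightarrow> 'w) \<Rightarrow> 'g \<Rightarrow> ('w \<Rightarrow> complex) \<Rightarrow> 'w \<Rightarrow> complex"
  where "hecke_transpose \<phi> g l v =
    (if g \<in> carrier G \<and> l \<in> W' \<and> v \<in> W then l (\<phi> (inv g) v) else 0)"

lemma hecke_tilde_transpose:
  assumes phi: "\<phi> \<in> hecke_bar G J W lam"
  shows "hecke_tilde G W W' (hecke_transpose \<phi>) = \<phi>"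
proof (intro ext)
  fix g w
  note D = hecke_barD[OF phi]
  show "hecke_tilde G W W' (hecke_transpose \<phi>) g w = \<phi> g w"
  proof (cases "g \<in> carrier G \<and> w \<in> W")
    case True
    have "(THE u. u \<in> W \<and> (\<forall>l\<in>W'. l u = l (\<phi> g w))) = \<phi> g w"
      by (rule the_equality) (use True D(1) lin_dual_eqI in blast)+
    then show ?thesis using True
      by (simp add: hecke_tilde_def transpose_end_def hecke_transpose_def cong: ball_cong)
  next
    case False
    have "g \<notin> carrier G \<Longrightarrow> \<phi> g = 0" using phi by (simp add: hecke_bar_def)
    then show ?thesis using False D(4)[of w g]
      by (auto simp: hecke_tilde_def transpose_end_def)
  qed
qed

lemma hecke_transpose_bar:
  assumes phi: "\<phi> \<in> hecke_bar G J W lam"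
  shows "hecke_transpose \<phi> \<in> hecke_bar G J W' lam'"
proof -
  note D = hecke_barD[OF phi]
  have hom: "hecke_transpose \<phi> g \<in> hom_space W' W'" if g: "g \<in> carrier G" for g
  proof -
    have dual: "hecke_transpose \<phi> g l \<in> W'" if l: "l \<in> W'" for l
      using g lin_dualD[OF l] D
      by (auto simp: hom_space_def linear_on_def hecke_transpose_def l scaleC_complex_def)
    have add: "l + k \<in> W'" and scale: "c *\<^sub>C l \<in> W'" if "l \<in> W'" "k \<in> W'" for l k c
      using that by (auto simp: hom_space_def linear_on_def scaleC_complex_def scaleC_fun_def
        algebra_simps)
    show ?thesis unfolding hom_space_def[of "lin_dual W" "lin_dual W"] linear_on_def[of "lin_dual W"] mem_Collect_eq
    proof (intro conjI ballI allI impI)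
      fix l assume "l \<in> lin_dual W"
      then show "hecke_transpose \<phi> g l \<in> lin_dual W" by (rule dual)
    next
      fix l k assume "l \<in> lin_dual W" "k \<in> lin_dual W"
      then show "hecke_transpose \<phi> g (l + k) = hecke_transpose \<phi> g l + hecke_transpose \<phi> g k"
        using add by (auto simp: fun_eq_iff hecke_transpose_def)
    next
      fix c l assume "l \<in> lin_dual W"
      then show "hecke_transpose \<phi> g (c *\<^sub>C l) = c *\<^sub>C hecke_transpose \<phi> g l"
        using scale by (auto simp: fun_eq_iff hecke_transpose_def scaleC_fun_def scaleC_complex_def)
    next
      fix l assume "l \<notin> lin_dual W"
      then show "hecke_transpose \<phi> g l = 0" by (auto simp: fun_eq_iff hecke_transpose_def)
    qed
  qed
  have lam'_dual: "lam' j l \<in> W'" if "j \<in> J" "l \<in> W'" for j l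
    using that lin_dualD[OF that(2)]
    by (auto simp: hom_space_def linear_on_def lam'_apply lam_add lam_scale scaleC_complex_def)
  have eq: "hecke_transpose \<phi> (j1 \<otimes> g \<otimes> j2) l = lam' j1 (hecke_transpose \<phi> g (lam' j2 l))"
    if j: "j1 \<in> J" "j2 \<in> J" and g: "g \<in> carrier G" and l: "l \<in> W'" for j1 j2 g l
  proof
    fix v
    have inv: "inv (j1 \<otimes> g \<otimes> j2) = inv j2 \<otimes> (inv g \<otimes> inv j1)"
      using j g by (simp add: inv_mult_group m_assoc)
    show "hecke_transpose \<phi> (j1 \<otimes> g \<otimes> j2) l v = lam' j1 (hecke_transpose \<phi> g (lam' j2 l)) v"
      using j g l lam'_dual[OF j(2) l] D
      by (auto simp: hecke_transpose_def inv lam'_apply)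
  qed
  show ?thesis unfolding hecke_bar_def using hom eq
    by (auto simp: hecke_transpose_def fun_eq_iff)
qed

text \<open>Inversion exchanges finite unions of right cosets of \<open>J\<close> with finite unions of left cosets, so
  transposition preserves compactness of the support.\<close>

lemma hecke_memI:
  assumes phi: "\<phi> \<in> hecke_bar G J W lam"
    and R: "finite R" "R \<subseteq> carrier G" "\<And>x. x \<in> carrier G \<Longrightarrow> \<phi> x \<noteq> 0 \<Longrightarrow> \<exists>t\<in>R. x \<in> J #> t"
  shows "\<phi> \<in> hecke Top G J W lam" "hecke_transpose \<phi> \<in> hecke Top G J W' lam'"
proof -
  have "supp_on G \<phi> \<subseteq> (\<Union>t\<in>R. J #> t)" using R(3) by (auto simp: supp_on_def)
  then show "\<phi> \<in> hecke Top G J W lam"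
    using phi compact_UN(2)[OF R(1,2)] unfolding hecke_def by blast
  have "supp_on G (hecke_transpose \<phi>) \<subseteq> (\<Union>t\<in>(\<lambda>t. inv t) ` R. t <# J)"
  proof
    fix g assume "g \<in> supp_on G (hecke_transpose \<phi>)"
    then have g: "g \<in> carrier G" "hecke_transpose \<phi> g \<noteq> 0" by (auto simp: supp_on_def)
    have "\<phi> (inv g) \<noteq> 0"
    proof
      assume z: "\<phi> (inv g) = 0"
      have "hecke_transpose \<phi> g l v = 0" for l v
        using z lin_dualD(3)[of l] by (simp add: hecke_transpose_def)
      then show False using g(2) by (auto simp: fun_eq_iff)
    qed
    then obtain t where t: "t \<in> R" "inv g \<in> J #> t" using R(3)[of "inv g"] g by auto
    then have tc: "t \<in> carrier G" using R by auto
    have "inv g \<otimes> inv t \<in> J" using t tc g mem_r_coset by simp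
    then have "inv (inv g \<otimes> inv t) \<in> J" by (rule J_inv)
    then have "t \<otimes> g \<in> J" using tc g by (simp add: inv_mult_group)
    then have "g \<in> inv t <# J" using tc g by (simp add: mem_l_coset)
    then show "g \<in> (\<Union>t\<in>(\<lambda>t. inv t) ` R. t <# J)" using t by blast
  qed
  moreover have "compactin Top (\<Union>t\<in>(\<lambda>t. inv t) ` R. t <# J)"
    using R by (intro compact_UN) auto
  ultimately show "hecke_transpose \<phi> \<in> hecke Top G J W' lam'"
    using hecke_transpose_bar[OF phi] unfolding hecke_def by blast
qed

section \<open>Matrix coefficients from Hecke eigenfunctions\<close>

context
  fixes V :: "'v::complex_vector set" and \<pi> :: "'g \<Rightarrow> 'v \<Rightarrow> 'v" and \<alpha> :: "('g \<Rightarrow> 'w) \<Rightarrow> 'v"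
  assumes pi: "representation G V \<pi>" and alpha: "\<alpha> \<in> intertwiner G I rho V \<pi>"
begin

lemma alpha_V: "h \<in> I \<Longrightarrow> \<alpha> h \<in> V"
  and alpha_add: "h \<in> I \<Longrightarrow> k \<in> I \<Longrightarrow> \<alpha> (h + k) = \<alpha> h + \<alpha> k"
  and alpha_scale: "h \<in> I \<Longrightarrow> \<alpha> (c *\<^sub>C h) = c *\<^sub>C \<alpha> h"
  and alpha_rho: "g \<in> carrier G \<Longrightarrow> h \<in> I \<Longrightarrow> \<alpha> (rho g h) = \<pi> g (\<alpha> h)"
  using alpha by (auto simp: intertwiner_def hom_space_def linear_on_def)

lemma pi_V: "g \<in> carrier G \<Longrightarrow> v \<in> V \<Longrightarrow> \<pi> g v \<in> V"
  and pi_mult: "g \<in> carrier G \<Longrightarrow> h \<in> carrier G \<Longrightarrow> v \<in> V \<Longrightarrow> \<pi> (g \<otimes> h) v = \<pi> g (\<pi> h v)"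
  and V_subspace: "complex_vector.subspace V"
  using pi by (auto simp: representation_def linear_on_def)

lemma pi_0: "g \<in> carrier G \<Longrightarrow> \<pi> g 0 = 0"
proof -
  assume g: "g \<in> carrier G"
  have "0 \<in> V" using V_subspace by (rule complex_vector.subspace_0)
  then have "\<pi> g (0 *\<^sub>C 0) = 0 *\<^sub>C \<pi> g 0"
    using pi g by (simp only: representation_def linear_on_def)
  then show ?thesis by simp
qed

lemma alpha_0: "\<alpha> 0 = 0"
  using alpha_scale[OF I_0, of 0] by simp

lemma kernel_subspace: "complex_vector.subspace {h \<in> I. \<alpha> h = 0}"
  unfolding complex_vector.subspace_def
  by (auto simp: I_0 I_add I_scale alpha_0 alpha_add alpha_scale simp del: zero_fun_apply)

lemma kernel_rho: "h \<in> I \<Longrightarrow> \<alpha> h = 0 \<Longrightarrow> g \<in> carrier G \<Longrightarrow> rho g h \<in> {h \<in> I. \<alpha> h = 0}"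
  by (simp add: I_rho alpha_rho pi_0)

text \<open>The kernel of a \<open>G\<close>-homomorphism is a subspace stable under translations, and the translates
  of the functions \<^const>\<open>delta\<close> span.\<close>

lemma delta_generates:
  assumes "\<And>w. w \<in> W \<Longrightarrow> \<alpha> (delta w) = 0" and h: "h \<in> I"
  shows "\<alpha> h = 0"
proof -
  obtain R where R: "finite R" "R \<subseteq> carrier G" "h = (\<Sum>y\<in>R. rho (inv y) (delta (h y)))"
    using I_decompose[OF h] by blast
  have "(\<Sum>y\<in>R. rho (inv y) (delta (h y))) \<in> {h \<in> I. \<alpha> h = 0}"
    by (intro complex_vector.subspace_sum[OF kernel_subspace] kernel_rho delta_I assms I_W[OF h])
      (use R in auto)
  then show ?thesis using R(3) by simp
qed

text \<open>A function \<open>h\<close> in the kernel of \<open>\<alpha>\<close> with \<open>(\<Psi> \<star> h)(1) \<noteq> 0\<close> would give, after averaging over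
  \<open>J\<close>, a nonzero \<open>J\<close>-endomorphism \<open>w \<mapsto> (\<Psi> \<star> s(w))(1)\<close> of \<open>W\<close> with \<open>s(w)\<close> in the kernel. But \<open>s\<close> is
  convolution by an element \<open>\<phi>\<close> of the Hecke algebra; since it maps into the kernel, the
  character vanishes on \<open>\<phi>\<close>, so that \<open>\<Psi> \<star> \<phi> = 0\<close> by the eigenvalue equation.\<close>

lemma eval_conv_vanishes_on_kernel:
  assumes Psi: "\<Psi> \<in> hecke_bar G J W lam"
    and act: "\<And>\<phi>. \<phi> \<in> hecke Top G J W' lam' \<Longrightarrow> hecke_action G J W W' I \<phi> \<alpha> = chi \<phi> *\<^sub>C \<alpha>"
    and chi': "\<And>\<phi>. \<phi> \<in> hecke Top G J W' lam' \<Longrightarrow> chi' (hecke_tilde G W W' \<phi>) = chi \<phi>"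
    and eigen: "\<And>\<phi>. \<phi> \<in> hecke Top G J W lam \<Longrightarrow> hecke_conv G J (\<circ>) \<Psi> \<phi> = chi' \<phi> *\<^sub>C \<Psi>"
    and nonzero: "\<exists>h\<in>I. \<alpha> h \<noteq> 0"
    and h: "h \<in> I" "\<alpha> h = 0"
  shows "eval_conv \<Psi> h = 0"
proof (rule ccontr)
  define u where "u = eval_conv \<Psi> h"
  assume "eval_conv \<Psi> h \<noteq> 0"
  then have u: "u \<in> W" "u \<noteq> 0" using eval_conv_W[OF Psi h(1)] by (auto simp: u_def)
  obtain l where l: "l \<in> W'" "l u \<noteq> 0" using hom_space_separates[OF W_subspace u] by blast
  note l_lin = lin_dualD[OF l(1)]

  \<comment> \<open>An open subgroup, hence of finite index in the compact group \<open>J\<close>, under which the integrand of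
    the average is invariant.\<close>
  define K where "K = {j \<in> J. rho j h = h \<and> (\<forall>w\<in>W. lam j w = w)}"
  obtain U where U: "openin Top U" "\<one> \<in> U" "U \<subseteq> J" "\<And>j w. j \<in> U \<Longrightarrow> w \<in> W \<Longrightarrow> lam j w = w"
    using lam_smooth by blast
  have one: "rho \<one> h = h" using rho_one I_outside[OF h(1)] by blast
  have K_sub: "subgroup K G"
  proof (rule subgroupI)
    fix a assume a: "a \<in> K"
    then have aJ: "a \<in> J" by (simp add: K_def)
    have "rho (inv a) h = rho (inv a) (rho a h)" using a by (simp add: K_def)
    also have "\<dots> = h" using aJ one by (simp add: rho_mult[symmetric])
    finally have 1: "rho (inv a) h = h" .
    have "lam (inv a) w = w" if "w \<in> W" for w
      using lam_inv(1)[OF aJ that] a that by (simp add: K_def)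
    then show "inv a \<in> K" using 1 aJ by (simp add: K_def)
  next
    fix a b assume "a \<in> K" "b \<in> K"
    then show "a \<otimes> b \<in> K" by (simp add: K_def rho_mult lam_mult)
  next
    have "\<one> \<in> K" using one by (simp add: K_def)
    then show "K \<noteq> {}" by blast
  qed (auto simp: K_def)
  have K_J: "K \<subseteq> J" by (auto simp: K_def)
  have K_open: "openin Top K"
  proof (rule openI_translate[where U = "U \<inter> {x \<in> carrier G. rho x h = h}"])
    show "openin Top (U \<inter> {x \<in> carrier G. rho x h = h})" using U(1) I_smooth[OF h(1)] by blast
    fix s v assume s: "s \<in> K" and v: "v \<in> U \<inter> {x \<in> carrier G. rho x h = h}"
    have "v \<in> J" using v U(3) by blast
    then have "v \<in> K" using v U(4) by (simp add: K_def)
    then show "s \<otimes> v \<in> K" using subgroup.m_closed[OF K_sub s] by blast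
  qed (use U one in \<open>auto simp: K_def\<close>)
  obtain F where F: "finite F" "F \<subseteq> J" "J \<subseteq> (\<Union>x\<in>F. x <# K)"
    using compact_cover(1)[OF J_compact K_open subgroup.one_closed[OF K_sub]] by blast
  define C where "C = (\<lambda>x. x <# K) ` F"
  have C: "finite C" "C \<subseteq> lcosets K" using F by (auto simp: C_def intro!: mem_lcosets)
  have C_J: "x <# K \<in> C" if x: "x \<in> J" for x
  proof -
    obtain y where y: "y \<in> F" "x \<in> y <# K" using F x by blast
    have "x <# K = y <# K" using l_repr_independence[OF y(2) _ K_sub] y(1) F(2) by auto
    then show ?thesis using y by (simp add: C_def)
  qed
  define r where "r c = (SOME x. x \<in> c)" for c :: "'g set"
  have r_J: "r c \<in> J" if "c \<in> C" for c
  proof -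
    obtain y where y: "y \<in> F" "c = y <# K" using \<open>c \<in> C\<close> by (auto simp: C_def)
    have "r c \<in> c" unfolding r_def using coset_rep(1)[OF K_sub] C that by blast
    then obtain k where "k \<in> K" "r c = y \<otimes> k" using y mem_l_cosetE by metis
    moreover have "y \<in> J" "k \<in> J" if "k \<in> K" for k using y F(2) K_J that by auto
    ultimately show ?thesis by simp
  qed
  have r_G: "r c \<in> carrier G" if "c \<in> C" for c using r_J[OF that] by simp
  have C_ne: "C \<noteq> {}" using C_J[OF J_one] by blast

  \<comment> \<open>The \<open>J\<close>-homomorphism from \<open>W\<close> to the kernel of \<open>\<alpha>\<close> obtained by averaging the rank one
    map \<open>w \<mapsto> l(w) h\<close> over \<open>J\<close>.\<close>
  define m where "m w c = (if c \<in> J then l (lam (inv c) w) *\<^sub>C rho c h else 0)" for w c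
  define s where "s w = coset_sum K (m w)" for w
  have s_eq: "s w = (\<Sum>c\<in>C. l (lam (inv (r c)) w) *\<^sub>C rho (r c) h)" for w
  proof -
    have "s w = (\<Sum>c\<in>C. m w (r c))"
      unfolding s_def r_def
      by (rule coset_sum_eq[OF K_sub C]) (use C_J in \<open>auto simp: m_def split: if_splits\<close>)
    then show ?thesis using r_J by (simp add: m_def)
  qed
  have m_inv: "m w (x \<otimes> k) = m w x" if "w \<in> W" "x \<in> carrier G" "k \<in> K" for w x k
  proof -
    have kJ: "k \<in> J" using that K_J by blast
    have "inv k \<in> K" using subgroup.m_inv_closed[OF K_sub that(3)] .
    then have ik: "lam (inv k) v = v" if "v \<in> W" for v using that by (simp add: K_def)
    have k: "rho k h = h" using that by (simp add: K_def)
    have "lam (inv (x \<otimes> k)) w = lam (inv x) w" if "x \<in> J"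
      using that kJ ik \<open>w \<in> W\<close> by (simp add: inv_mult_group lam_mult)
    then show ?thesis using kJ k that by (simp add: m_def rho_mult)
  qed
  have s_I: "s w \<in> I" and alpha_s: "\<alpha> (s w) = 0" for w
  proof -
    have "s w \<in> {h \<in> I. \<alpha> h = 0}" unfolding s_eq
      by (intro complex_vector.subspace_sum[OF kernel_subspace]
          complex_vector.subspace_scale[OF kernel_subspace] kernel_rho h r_G)
    then show "s w \<in> I" "\<alpha> (s w) = 0" by auto
  qed
  have s_lam: "s (lam j w) = rho j (s w)" if j: "j \<in> J" and w: "w \<in> W" for j w
  proof -
    have "s (lam j w) = coset_sum K (\<lambda>x. m (lam j w) (j \<otimes> x))"
      unfolding s_def
      by (rule coset_sum_shift[OF K_sub m_inv, symmetric]) (use j w in simp_all)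
    also have "\<dots> = coset_sum K (\<lambda>x. rho j (m w x))"
    proof (rule coset_sum_cong[OF K_sub])
      fix x assume x: "x \<in> carrier G"
      have "lam (inv (j \<otimes> x)) (lam j w) = lam (inv x) w" if "x \<in> J"
        using that j w by (simp add: inv_mult_group lam_mult)
      then show "m (lam j w) (j \<otimes> x) = rho j (m w x)"
        using x j by (simp add: m_def rho_mult rho_scale rho_0 del: zero_fun_apply)
          (simp only: rho_0 not_False_eq_True simp_thms)?
    qed
    also have "\<dots> = (\<Sum>c\<in>C. rho j (m w (r c)))"
      unfolding r_def
      by (rule coset_sum_eq[OF K_sub C])
         (use C_J in \<open>auto simp: m_def rho_0 split: if_splits\<close>)
    also have "\<dots> = rho j (s w)"
      unfolding s_eq rho_sum using r_J by (intro sum.cong) (auto simp: m_def)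
    finally show ?thesis .
  qed
  have s_add: "s (v + w) = s v + s w" if "v \<in> W" "w \<in> W" for v w
    unfolding s_eq sum.distrib[symmetric]
    by (rule sum.cong) (use that r_J l_lin in \<open>simp_all add: lam_add scaleC_add_left\<close>)
  have s_scale: "s (c *\<^sub>C w) = c *\<^sub>C s w" if "w \<in> W" for c w
    unfolding s_eq complex_vector.scale_sum_right
    by (rule sum.cong) (use that r_J l_lin in \<open>simp_all add: lam_scale scaleC_scaleC\<close>)
  have eval_s: "eval_conv \<Psi> (s w) = (\<Sum>c\<in>C. l (lam (inv (r c)) w) *\<^sub>C lam (r c) u)" for w
  proof -
    have "eval_conv \<Psi> (s w) = (\<Sum>c\<in>C. l (lam (inv (r c)) w) *\<^sub>C eval_conv \<Psi> (rho (r c) h))"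
      unfolding s_eq by (rule eval_conv_sum[OF Psi]) (use I_rho h r_G in blast)
    also have "\<dots> = (\<Sum>c\<in>C. l (lam (inv (r c)) w) *\<^sub>C lam (r c) u)"
      by (rule sum.cong) (simp_all add: eval_conv_rho_J[OF Psi h(1)] r_J u_def)
    finally show ?thesis .
  qed
  \<comment> \<open>The trace of this endomorphism is \<open>l u\<close> times the index of \<open>K\<close> in \<open>J\<close>.\<close>
  have "\<exists>w\<in>W. (\<Sum>c\<in>C. l (lam (inv (r c)) w) *\<^sub>C lam (r c) u) \<noteq> 0"
  proof (rule sum_rank_one_nonzero[OF C(1) W_subspace])
    fix c assume c: "c \<in> C"
    show "lam (r c) u \<in> W" using r_J[OF c] u by simp
    show "linear_on W UNIV (\<lambda>w. l (lam (inv (r c)) w))"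
      using r_J[OF c] l_lin by (simp add: linear_on_def lam_add lam_scale scaleC_complex_def)
  next
    have "(\<Sum>c\<in>C. l (lam (inv (r c)) (lam (r c) u))) = (\<Sum>c\<in>C. l u)"
      by (rule sum.cong) (use r_J u in auto)
    then show "(\<Sum>c\<in>C. l (lam (inv (r c)) (lam (r c) u))) \<noteq> 0"
      using l(2) C(1) C_ne by simp
  qed
  then obtain w0 where w0: "w0 \<in> W" "eval_conv \<Psi> (s w0) \<noteq> 0" unfolding eval_s by blast

  \<comment> \<open>The element of the Hecke algebra that corresponds to \<open>s\<close> under Frobenius reciprocity.\<close>
  define \<phi> where "\<phi> x w = (if x \<in> carrier G \<and> w \<in> W then s w x else 0)" for x w
  have phi_bar: "\<phi> \<in> hecke_bar G J W lam"
    unfolding hecke_bar_def mem_Collect_eq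
  proof (intro conjI ballI allI impI)
    fix g assume "g \<in> carrier G"
    then show "\<phi> g \<in> hom_space W W"
      using I_W[OF s_I]
      by (auto simp: hom_space_def linear_on_def \<phi>_def s_add s_scale scaleC_fun_def)
  next
    fix g assume "g \<notin> carrier G"
    then show "\<phi> g = 0" by (auto simp: fun_eq_iff \<phi>_def)
  next
    fix j1 j2 g w assume *: "j1 \<in> J" "j2 \<in> J" "g \<in> carrier G" "w \<in> W"
    have "s w (j1 \<otimes> g \<otimes> j2) = lam j1 (s w (g \<otimes> j2))"
      using * I_equivariant[OF s_I] by (simp add: m_assoc)
    also have "s w (g \<otimes> j2) = s (lam j2 w) g" using * by (simp add: s_lam rho_apply)
    finally show "\<phi> (j1 \<otimes> g \<otimes> j2) w = lam j1 (\<phi> g (lam j2 w))" using * by (simp add: \<phi>_def)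
  qed
  obtain Y where Y: "finite Y" "Y \<subseteq> carrier G"
    "\<And>x. x \<in> carrier G \<Longrightarrow> h x \<noteq> 0 \<Longrightarrow> \<exists>y\<in>Y. x \<otimes> inv y \<in> J"
    using I_cover[OF h(1)] by blast
  define R where "R = (\<lambda>(y, c). y \<otimes> inv (r c)) ` (Y \<times> C)"
  have R: "finite R" "R \<subseteq> carrier G" using Y C r_G by (auto simp: R_def)
  have R_cover: "\<exists>t\<in>R. x \<in> J #> t" if x: "x \<in> carrier G" "\<phi> x \<noteq> 0" for x
  proof -
    obtain w where "\<phi> x w \<noteq> 0" using x(2) by (auto simp: fun_eq_iff)
    then have "(\<Sum>c\<in>C. l (lam (inv (r c)) w) *\<^sub>C rho (r c) h x) \<noteq> 0"
      using s_eq[of w] by (auto simp: \<phi>_def sum_apply scaleC_fun_def split: if_splits)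
    then obtain c where c: "c \<in> C" "l (lam (inv (r c)) w) *\<^sub>C rho (r c) h x \<noteq> 0"
      by (meson sum.neutral)
    then have "h (x \<otimes> r c) \<noteq> 0" using x by (auto simp: rho_apply)
    then obtain y where y: "y \<in> Y" "x \<otimes> r c \<otimes> inv y \<in> J" using Y(3)[of "x \<otimes> r c"] x r_G[OF c(1)] by auto
    have yc: "y \<in> carrier G" using y Y by auto
    have "x \<otimes> inv (y \<otimes> inv (r c)) \<in> J" using y yc x r_G[OF c(1)] by (simp add: inv_mult_group m_assoc)
    then have "x \<in> J #> (y \<otimes> inv (r c))" using yc x r_G[OF c(1)] by (simp add: mem_r_coset)
    moreover have "y \<otimes> inv (r c) \<in> R" using y c by (auto simp: R_def)
    ultimately show ?thesis by blast
  qed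
  note phi = hecke_memI[OF phi_bar R R_cover]

  have chi_0: "chi (hecke_transpose \<phi>) = 0"
  proof -
    obtain w where w: "w \<in> W" "\<alpha> (delta w) \<noteq> 0" using delta_generates nonzero by blast
    have conv: "hecke_conv G J (\<lambda>A w. A w) \<phi> (delta w) = s w"
    proof
      fix g
      show "hecke_conv G J (\<lambda>A w. A w) \<phi> (delta w) g = s w g"
      proof (cases "g \<in> carrier G")
        case True
        have "hecke_conv G J (\<lambda>A w. A w) \<phi> (delta w) g = eval_conv \<phi> (rho g (delta w))"
          unfolding hecke_conv_coset_sum[OF is_group] eval_conv_def
          using True by (simp, intro coset_sum_cong[OF J_subgroup]) (simp add: rho_apply)
        also have "\<dots> = s w g" using eval_conv_delta[OF phi_bar w(1) True] True w by (simp add: \<phi>_def)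
        finally show ?thesis .
      qed (simp add: hecke_conv_coset_sum[OF is_group] I_outside[OF s_I])
    qed
    have "hecke_action G J W W' I (hecke_transpose \<phi>) \<alpha> (delta w) = \<alpha> (s w)"
      using delta_I[OF w(1)] by (simp add: hecke_action_def hecke_tilde_transpose[OF phi_bar] conv)
    then have "chi (hecke_transpose \<phi>) *\<^sub>C \<alpha> (delta w) = 0"
      using act[OF phi(2)] alpha_s by (simp add: scaleC_fun_def)
    then show ?thesis using w by simp
  qed
  have "chi' \<phi> = 0" using chi'[OF phi(2)] chi_0 hecke_tilde_transpose[OF phi_bar] by simp
  then have "hecke_conv G J (\<circ>) \<Psi> \<phi> \<one> w0 = 0" using eigen[OF phi(1)] by (simp add: scaleC_fun_def)
  moreover have "hecke_conv G J (\<circ>) \<Psi> \<phi> \<one> w0 = eval_conv \<Psi> (s w0)"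
  proof -
    define E where "E = (\<lambda>t. inv t <# J) ` R"
    have E: "finite E" "E \<subseteq> lcosets J" using R by (auto simp: E_def intro!: mem_lcosets)
    have E_cover: "x <# J \<in> E" if x: "x \<in> carrier G" "\<phi> (inv x) \<noteq> 0" for x
    proof -
      obtain t where t: "t \<in> R" "inv x \<in> J #> t" using R_cover[of "inv x"] x by auto
      have tc: "t \<in> carrier G" using t R by auto
      have "inv x \<otimes> inv t \<in> J" using t tc x mem_r_coset by simp
      then have "inv t \<in> x <# J" using tc x by (simp add: mem_l_coset)
      then show ?thesis using l_repr_independence[OF _ x(1) J_subgroup] t by (auto simp: E_def)
    qed
    have nz: "\<phi> (inv x) \<noteq> 0" if "\<Psi> x (\<phi> (inv x) w) \<noteq> 0" for x w
      using that hecke_barD(7)[OF Psi] by auto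
    have "hecke_conv G J (\<circ>) \<Psi> \<phi> \<one> = coset_sum J (\<lambda>x. \<Psi> x \<circ> \<phi> (inv x))"
      unfolding hecke_conv_coset_sum[OF is_group]
      by (simp, intro coset_sum_cong[OF J_subgroup]) simp
    also have "\<dots> = (\<Sum>c\<in>E. \<Psi> (SOME x. x \<in> c) \<circ> \<phi> (inv (SOME x. x \<in> c)))"
      by (rule coset_sum_eq[OF J_subgroup E]) (use E_cover nz in \<open>auto simp: fun_eq_iff\<close>)
    finally have "hecke_conv G J (\<circ>) \<Psi> \<phi> \<one> w0
      = (\<Sum>c\<in>E. \<Psi> (SOME x. x \<in> c) (\<phi> (inv (SOME x. x \<in> c)) w0))"
      by (simp add: sum_apply)
    also have "\<dots> = coset_sum J (\<lambda>x. \<Psi> x (\<phi> (inv x) w0))"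
      by (rule coset_sum_eq[OF J_subgroup E, symmetric]) (use E_cover nz in blast)
    also have "\<dots> = eval_conv \<Psi> (s w0)"
      unfolding eval_conv_def
      by (rule coset_sum_cong[OF J_subgroup]) (simp add: \<phi>_def w0)
    finally show ?thesis .
  qed
  ultimately show False using w0 by simp
qed

end

text \<open>The functional \<open>h \<mapsto> \<langle>(\<Psi> \<star> h)(1), w'\<rangle>\<close> descends along the surjection \<open>\<alpha>\<close>. It is smooth because
  \<open>h \<mapsto> (\<Psi> \<star> h)(1)\<close> is a \<open>J\<close>-homomorphism to \<open>W\<close>.\<close>

theorem eigenfunction_matrix_coefficient:
  fixes V :: "'v::complex_vector set" and \<pi> :: "'g \<Rightarrow> 'v \<Rightarrow> 'v"
  assumes irred: "irreducible_rep G V \<pi>"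
    and chi: "character_of_module (hecke Top G J W' lam') (hecke_action G J W W' I)
                (intertwiner G I rho V \<pi>) chi"
    and chi': "\<And>\<phi>. \<phi> \<in> hecke Top G J W' lam' \<Longrightarrow> chi' (hecke_tilde G W W' \<phi>) = chi \<phi>"
    and Psi: "\<Psi> \<in> hecke_bar G J W lam"
    and eigen: "\<And>\<phi>. \<phi> \<in> hecke Top G J W lam \<Longrightarrow> hecke_conv G J (\<circ>) \<Psi> \<phi> = chi' \<phi> *\<^sub>C \<Psi>"
    and w: "w \<in> W" and w': "w' \<in> W'"
  shows "matrix_coefficient Top G V \<pi> (\<lambda>g. w' (\<Psi> g w))"
proof -
  have pi: "representation G V \<pi>" using irred by (simp add: irreducible_rep_def)
  let ?M = "intertwiner G I rho V \<pi>"
  have "\<not> ?M \<subseteq> {0}"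
  proof
    assume "?M \<subseteq> {0}"
    then have "?M \<subseteq> complex_vector.span {}" by simp
    from complex_vector.dim_le_card[OF this] have "complex_vector.dim ?M = 0" by simp
    then show False using chi by (simp add: character_of_module_def)
  qed
  then obtain \<alpha> where alpha: "\<alpha> \<in> ?M" "\<alpha> \<noteq> 0" by blast
  note a = alpha_V[OF pi alpha(1)] alpha_add[OF pi alpha(1)] alpha_scale[OF pi alpha(1)]
    alpha_rho[OF pi alpha(1)]
  have nonzero: "\<exists>h\<in>I. \<alpha> h \<noteq> 0"
  proof -
    obtain h where "\<alpha> h \<noteq> 0" using alpha(2) by (auto simp: fun_eq_iff)
    moreover have "\<alpha> h = 0" if "h \<notin> I" using alpha(1) that by (simp add: intertwiner_def hom_space_def)
    ultimately show ?thesis by blast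
  qed
  have "\<alpha> ` I = {0} \<or> \<alpha> ` I = V"
  proof -
    have "complex_vector.subspace (\<alpha> ` I)"
      unfolding complex_vector.subspace_def
    proof (intro conjI ballI allI)
      show "0 \<in> \<alpha> ` I" using I_0 alpha_0[OF pi alpha(1)] by (metis imageI)
      fix x assume "x \<in> \<alpha> ` I"
      then obtain h where h: "h \<in> I" "x = \<alpha> h" by blast
      show "c *\<^sub>C x \<in> \<alpha> ` I" for c
        using h a(3)[OF h(1), of c] I_scale[OF h(1), of c] by (metis imageI)
      fix y assume "y \<in> \<alpha> ` I"
      then obtain k where k: "k \<in> I" "y = \<alpha> k" by blast
      show "x + y \<in> \<alpha> ` I" using h k a(2)[OF h(1) k(1)] I_add[OF h(1) k(1)] by (metis imageI)
    qed
    moreover have "\<alpha> ` I \<subseteq> V" using a(1) by blast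
    moreover have "\<forall>g\<in>carrier G. \<forall>u\<in>\<alpha> ` I. \<pi> g u \<in> \<alpha> ` I"
    proof (intro ballI)
      fix g u assume g: "g \<in> carrier G" and "u \<in> \<alpha> ` I"
      then obtain h where h: "h \<in> I" "u = \<alpha> h" by blast
      then show "\<pi> g u \<in> \<alpha> ` I" using a(4)[OF g h(1)] I_rho[OF h(1) g] by (metis imageI)
    qed
    ultimately show ?thesis using irred by (simp add: irreducible_rep_def)
  qed
  then have surj: "\<alpha> ` I = V" using nonzero by blast

  have act: "hecke_action G J W W' I \<phi> \<alpha> = chi \<phi> *\<^sub>C \<alpha>" if "\<phi> \<in> hecke Top G J W' lam'" for \<phi>
    using chi that alpha(1) by (simp add: character_of_module_def)
  note kernel = eval_conv_vanishes_on_kernel[OF pi alpha(1) Psi act chi' eigen nonzero]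
  define l where "l v = (if v \<in> V then w' (eval_conv \<Psi> (SOME h. h \<in> I \<and> \<alpha> h = v)) else 0)" for v
  have l_alpha: "l (\<alpha> h) = w' (eval_conv \<Psi> h)" if h: "h \<in> I" for h
  proof -
    define k where "k = (SOME k. k \<in> I \<and> \<alpha> k = \<alpha> h)"
    have "k \<in> I \<and> \<alpha> k = \<alpha> h" unfolding k_def by (rule someI[of _ h]) (use h in simp)
    then have k: "k \<in> I" "\<alpha> k = \<alpha> h" by auto
    have nk: "(-1) *\<^sub>C k \<in> I" using I_scale[OF k(1)] .
    have "\<alpha> (h + (-1) *\<^sub>C k) = 0"
      using a(2)[OF h nk] a(3)[OF k(1), of "-1"] k(2) by simp
    then have "eval_conv \<Psi> (h + (-1) *\<^sub>C k) = 0" using kernel[OF _ _ _ I_add[OF h nk]] by blast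
    then have "eval_conv \<Psi> h = eval_conv \<Psi> k"
      using eval_conv_add[OF Psi h nk] eval_conv_scale[OF Psi k(1), of "-1"] by simp
    then show ?thesis using a(1)[OF h] by (simp add: l_def k_def)
  qed
  note w'_lin = lin_dualD[OF w']
  have "l \<in> lin_dual V"
    unfolding hom_space_def linear_on_def mem_Collect_eq
  proof (intro conjI ballI allI impI)
    fix x assume "x \<in> V"
    then obtain h where h: "h \<in> I" "x = \<alpha> h" using surj by blast
    show "l (c *\<^sub>C x) = c *\<^sub>C l x" for c
      using l_alpha[OF h(1)] l_alpha[OF I_scale[OF h(1)], of c] a(3)[OF h(1), of c] h
        eval_conv_scale[OF Psi h(1)] w'_lin eval_conv_W[OF Psi h(1)]
      by (simp add: scaleC_complex_def)
    fix y assume "y \<in> V"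
    then obtain k where k: "k \<in> I" "y = \<alpha> k" using surj by blast
    show "l (x + y) = l x + l y"
      using l_alpha[OF h(1)] l_alpha[OF k(1)] l_alpha[OF I_add[OF h(1) k(1)]]
        a(2)[OF h(1) k(1)] h k eval_conv_add[OF Psi h(1) k(1)] w'_lin
        eval_conv_W[OF Psi h(1)] eval_conv_W[OF Psi k(1)] by simp
  qed (auto simp: l_def)
  moreover have "openin Top {g \<in> carrier G. \<forall>v\<in>V. l (\<pi> g v) = l v}"
  proof -
    obtain U where U: "openin Top U" "\<one> \<in> U" "U \<subseteq> J" "\<And>j w. j \<in> U \<Longrightarrow> w \<in> W \<Longrightarrow> lam j w = w"
      using lam_smooth by blast
    have lU: "l (\<pi> u v) = l v" if u: "u \<in> U" and v: "v \<in> V" for u v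
    proof -
      have uJ: "u \<in> J" using U u by blast
      obtain h where h: "h \<in> I" "v = \<alpha> h" using surj v by blast
      have "l (\<pi> u v) = w' (eval_conv \<Psi> (rho u h))"
        using l_alpha[OF I_rho[OF h(1)]] a(4)[OF _ h(1)] uJ h(2) by simp
      also have "\<dots> = w' (eval_conv \<Psi> h)"
        using eval_conv_rho_J[OF Psi h(1) uJ] U(4)[OF u eval_conv_W[OF Psi h(1)]] by simp
      finally show ?thesis using l_alpha[OF h(1)] h(2) by simp
    qed
    show ?thesis
    proof (rule openI_translate[OF _ U(1,2)])
      fix s u assume s: "s \<in> {g \<in> carrier G. \<forall>v\<in>V. l (\<pi> g v) = l v}" and u: "u \<in> U"
      have uG: "u \<in> carrier G" using U u by auto
      show "s \<otimes> u \<in> {g \<in> carrier G. \<forall>v\<in>V. l (\<pi> g v) = l v}"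
        using s uG lU[OF u] pi_mult[OF pi alpha(1)] pi_V[OF pi alpha(1)] by auto
    qed auto
  qed
  ultimately have "l \<in> contra_space Top G V \<pi>" by (simp add: contra_space_def)
  moreover have "\<alpha> (delta w) \<in> V" using a(1) delta_I[OF w] .
  moreover have "w' (\<Psi> g w) = l (\<pi> g (\<alpha> (delta w)))" if g: "g \<in> carrier G" for g
    using l_alpha[OF I_rho[OF delta_I[OF w] g]] a(4)[OF g delta_I[OF w]]
      eval_conv_delta[OF Psi w g] by simp
  ultimately show ?thesis unfolding matrix_coefficient_def by blast
qed

end

section \<open>The group of invertible matrices\<close>

lemma mult_mat_entry:
  fixes A B :: "'a::semiring_0 mat"
  assumes "A \<in> carrier_mat n m" "B \<in> carrier_mat m k" "i < n" "j < k"
  shows "(A * B) $$ (i, j) = (\<Sum>l<m. A $$ (i, l) * B $$ (l, j))"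
  using assms by (simp add: scalar_prod_def atLeast0LessThan)

lemma GL_simps [simp]: "A \<otimes>\<^bsub>GL n\<^esub> B = A * B" "\<one>\<^bsub>GL n\<^esub> = 1\<^sub>m n"
  by (simp_all add: GL_def)

lemma GL_carrier_mat: "A \<in> carrier (GL n) \<Longrightarrow> A \<in> carrier_mat n n"
  by (simp add: GL_def)

lemma GL_iff:
  "A \<in> carrier (GL n) \<longleftrightarrow>
    A \<in> carrier_mat n n \<and> (\<exists>B\<in>carrier_mat n n. A * B = 1\<^sub>m n \<and> B * A = 1\<^sub>m n)"
proof
  assume A: "A \<in> carrier (GL n)"
  then have An: "A \<in> carrier_mat n n" by (simp add: GL_def)
  obtain B where B: "A * B = 1\<^sub>m n" "B * A = 1\<^sub>m (dim_row B)"
    using A An by (auto simp: GL_def invertible_mat_def inverts_mat_def)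
  have "dim_col B = n" using arg_cong[OF B(1), of dim_col] by simp
  moreover have "dim_row B = n" using arg_cong[OF B(2), of dim_col] An by simp
  ultimately show "A \<in> carrier_mat n n \<and> (\<exists>B\<in>carrier_mat n n. A * B = 1\<^sub>m n \<and> B * A = 1\<^sub>m n)"
    using An B by auto
next
  assume "A \<in> carrier_mat n n \<and> (\<exists>B\<in>carrier_mat n n. A * B = 1\<^sub>m n \<and> B * A = 1\<^sub>m n)"
  then show "A \<in> carrier (GL n)"
    by (auto simp: GL_def invertible_mat_def inverts_mat_def)
qed

lemma GL_I:
  assumes "A \<in> carrier_mat n n" "B \<in> carrier_mat n n" "A * B = 1\<^sub>m n"
  shows "A \<in> carrier (GL n)" "B \<in> carrier (GL n)"
  using mat_mult_left_right_inverse[OF assms] assms by (auto simp: GL_iff)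

lemma mult_inverse_mats:
  fixes A B A' B' :: "'a::semiring_1 mat"
  assumes "A \<in> carrier_mat n n" "B \<in> carrier_mat n n" "A' \<in> carrier_mat n n" "B' \<in> carrier_mat n n"
    and "A * A' = 1\<^sub>m n" "B * B' = 1\<^sub>m n"
  shows "A * B * (B' * A') = 1\<^sub>m n"
proof -
  have "A * B * (B' * A') = A * (B * (B' * A'))" using assms by (intro assoc_mult_mat) auto
  also have "B * (B' * A') = B * B' * A'" using assms by (intro assoc_mult_mat[symmetric]) auto
  finally show ?thesis using assms by simp
qed

lemma GL_group: "group (GL n)"
proof (rule groupI)
  fix A B :: "'a mat" assume A: "A \<in> carrier (GL n)" and B: "B \<in> carrier (GL n)"
  obtain A' where A': "A' \<in> carrier_mat n n" "A * A' = 1\<^sub>m n" using A GL_iff by blast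
  obtain B' where B': "B' \<in> carrier_mat n n" "B * B' = 1\<^sub>m n" using B GL_iff by blast
  note c = GL_carrier_mat[OF A] GL_carrier_mat[OF B]
  have "A * B * (B' * A') = 1\<^sub>m n" using c A' B' by (intro mult_inverse_mats)
  then show "A \<otimes>\<^bsub>GL n\<^esub> B \<in> carrier (GL n)" using GL_I(1)[of "A * B" n "B' * A'"] c A' B' by simp
next
  fix A :: "'a mat" assume A: "A \<in> carrier (GL n)"
  obtain A' where A': "A' \<in> carrier_mat n n" "A * A' = 1\<^sub>m n" "A' * A = 1\<^sub>m n" using A GL_iff by blast
  then show "\<exists>y\<in>carrier (GL n). y \<otimes>\<^bsub>GL n\<^esub> A = \<one>\<^bsub>GL n\<^esub>"
    using GL_I(2)[of A n A'] GL_carrier_mat[OF A] by auto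
next
  fix A B C :: "'a mat"
  assume "A \<in> carrier (GL n)" "B \<in> carrier (GL n)" "C \<in> carrier (GL n)"
  then show "A \<otimes>\<^bsub>GL n\<^esub> B \<otimes>\<^bsub>GL n\<^esub> C = A \<otimes>\<^bsub>GL n\<^esub> (B \<otimes>\<^bsub>GL n\<^esub> C)"
    using assoc_mult_mat[of A n n B n C n] by (simp add: GL_carrier_mat)
qed (auto simp: GL_I[of "1\<^sub>m n" n "1\<^sub>m n"] dest: GL_carrier_mat)

lemma GL_inv_eq:
  assumes "A \<in> carrier_mat n n" "B \<in> carrier_mat n n" "A * B = 1\<^sub>m n"
  shows "inv\<^bsub>GL n\<^esub> A = B"
proof -
  interpret group "GL n" by (rule GL_group)
  show ?thesis using inv_equality[of B A] GL_I[OF assms] mat_mult_left_right_inverse[OF assms]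
    by simp
qed

text \<open>The condition makes every summand in the entries of \<open>N\<^sup>2\<close> vanish. The elimination matrices and
  the unipotent elements used against cuspidality are all of this form.\<close>

lemma square_zero_mat:
  fixes N :: "'a::field mat"
  assumes N: "N \<in> carrier_mat n n"
    and nil: "\<And>i j k. i < n \<Longrightarrow> j < n \<Longrightarrow> k < n \<Longrightarrow> N $$ (i, j) = 0 \<or> N $$ (j, k) = 0"
  shows "(1\<^sub>m n + N) * (1\<^sub>m n - N) = 1\<^sub>m n"
proof -
  have "N * N = 0\<^sub>m n n"
  proof (rule eq_matI)
    fix i j assume ij: "i < dim_row (0\<^sub>m n n)" "j < dim_col (0\<^sub>m n n)"
    then have "(N * N) $$ (i, j) = (\<Sum>l<n. N $$ (i, l) * N $$ (l, j))"
      using mult_mat_entry[OF N N] by simp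
    also have "\<dots> = 0" using nil ij by (intro sum.neutral) auto
    finally show "(N * N) $$ (i, j) = 0\<^sub>m n n $$ (i, j)" using ij by simp
  qed (use N in auto)
  have "(1\<^sub>m n + N) * (1\<^sub>m n - N) = 1\<^sub>m n * (1\<^sub>m n - N) + N * (1\<^sub>m n - N)"
    using N by (intro add_mult_distrib_mat) auto
  also have "N * (1\<^sub>m n - N) = N * 1\<^sub>m n - N * N"
    using N by (intro mult_minus_distrib_mat) auto
  finally show ?thesis using N \<open>N * N = 0\<^sub>m n n\<close> by auto
qed

section \<open>Arithmetic of a non-archimedean local field\<close>

context nonarch_local_field
begin

lemma nrm_0 [simp]: "nrm 0 = 0" by (simp add: nrm_eq_0)

lemma nrm_pos: "x \<noteq> 0 \<Longrightarrow> nrm x > 0"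
  using nrm_nonneg[of x] nrm_eq_0[of x] by linarith

lemma nrm_1 [simp]: "nrm 1 = 1"
  using nrm_mult[of 1 1] nrm_pos[of 1] by simp

lemma nrm_minus [simp]: "nrm (- x) = nrm x"
proof -
  have "nrm (-1) * nrm (-1) = 1" using nrm_mult[of "-1" "-1"] by simp
  then have "nrm (-1) = 1" using nrm_nonneg[of "-1"]
    by (metis abs_of_nonneg abs_square_eq_1 power2_eq_square)
  then show ?thesis using nrm_mult[of "-1" x] by simp
qed

lemma nrm_diff: "nrm (x - y) \<le> max (nrm x) (nrm y)"
  using ultrametric[of x "- y"] by simp

lemma nrm_sum_le:
  assumes "c \<ge> 0" "\<And>x. x \<in> S \<Longrightarrow> nrm (h x) \<le> c"
  shows "nrm (sum h S) \<le> c"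
  using assms(2)
proof (induction S rule: infinite_finite_induct)
  case (insert x F)
  then show ?case using ultrametric[of "h x" "sum h F"] by fastforce
qed (use assms(1) in simp_all)

lemma nrm_sum_less:
  assumes "c > 0" "\<And>x. x \<in> S \<Longrightarrow> nrm (h x) < c"
  shows "nrm (sum h S) < c"
  using assms(2)
proof (induction S rule: infinite_finite_induct)
  case (insert x F)
  then show ?case using ultrametric[of "h x" "sum h F"] by fastforce
qed (use assms(1) in simp_all)

lemma nrm_prod: "nrm (prod h S) = (\<Prod>x\<in>S. nrm (h x))"
  by (induction S rule: infinite_finite_induct) (simp_all add: nrm_mult)

lemma nrm_inverse: "nrm (inverse x) = inverse (nrm x)"
proof (cases "x = 0")
  case False
  then have "nrm x * nrm (inverse x) = 1" using nrm_mult[of x "inverse x"] by simp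
  then show ?thesis by (metis inverse_unique)
qed simp

lemma nrm_divide: "nrm (x / y) = nrm x / nrm y"
  by (simp add: divide_inverse nrm_mult nrm_inverse)

lemma nrm_power: "nrm (x ^ k) = nrm x ^ k"
  by (induction k) (simp_all add: nrm_mult)

lemma nrm_mult_le_1: "nrm x \<le> 1 \<Longrightarrow> nrm y \<le> 1 \<Longrightarrow> nrm (x * y) \<le> 1"
  using nrm_nonneg[of x] nrm_nonneg[of y] by (simp add: nrm_mult mult_le_one)

lemma nrm_mult_less_1:
  assumes "nrm x \<le> 1" "nrm y \<le> 1" "nrm x < 1 \<or> nrm y < 1"
  shows "nrm (x * y) < 1"
proof -
  have "nrm x * nrm y \<le> nrm x" "nrm x * nrm y \<le> nrm y"
    using assms nrm_nonneg[of x] nrm_nonneg[of y] by (simp_all add: mult_left_le mult_left_le_one_le)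
  then show ?thesis using assms(3) by (auto simp: nrm_mult)
qed

lemma nrm_unif: "0 < nrm unif" "nrm unif < 1"
proof -
  show "0 < nrm unif" using nrm_pos[OF unif_nonzero] .
  have "unif \<in> {unif * y | y. nrm y \<le> 1}" by (auto intro!: exI[of _ 1])
  then show "nrm unif < 1" using maximal_ideal by blast
qed

lemma nrm_less_1: "nrm x < 1 \<longleftrightarrow> nrm x \<le> nrm unif"
proof
  assume "nrm x < 1"
  then obtain y where "x = unif * y" "nrm y \<le> 1" using maximal_ideal by blast
  then show "nrm x \<le> nrm unif" using nrm_unif by (simp add: nrm_mult mult_left_le)
qed (use nrm_unif in simp)

text \<open>An element of absolute value at most \<open>1\<close> can be divided by the uniformizer only finitely often,
  as the powers of \<open>\<bar>\<varpi>\<bar> < 1\<close> tend to \<open>0\<close>; the others are inverses of such elements.\<close>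

lemma unit_decomposition:
  assumes "x \<noteq> 0"
  shows "\<exists>k u. nrm u = 1 \<and> x = unif powi k * u"
proof -
  have pos: "\<exists>k u. nrm u = 1 \<and> x = unif powi k * u" if x: "x \<noteq> 0" "nrm x \<le> 1" for x
  proof -
    obtain m where m: "nrm unif ^ m < nrm x" using real_arch_pow_inv[OF nrm_pos[OF x(1)] nrm_unif(2)] by blast
    show ?thesis using x m
    proof (induction m arbitrary: x)
      case 0
      then show ?case by simp
    next
      case (Suc m)
      show ?case
      proof (cases "nrm x < 1")
        case True
        then obtain y where y: "x = unif * y" "nrm y \<le> 1" using maximal_ideal by blast
        have "nrm unif * nrm unif ^ m < nrm unif * nrm y" using Suc.prems(3) y by (simp add: nrm_mult)
        then have "nrm unif ^ m < nrm y" using nrm_unif by simp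
        moreover have "y \<noteq> 0" using Suc.prems y by auto
        ultimately obtain k u where ku: "nrm u = 1" "y = unif powi k * u" using Suc.IH y by blast
        then have "x = unif powi (k + 1) * u"
          using y unif_nonzero by (simp add: power_int_add)
        then show ?thesis using ku by blast
      next
        case False
        then have "nrm x = 1" using Suc.prems by simp
        then show ?thesis by (intro exI[of _ 0] exI[of _ x]) simp
      qed
    qed
  qed
  show ?thesis
  proof (cases "nrm x \<le> 1")
    case False
    have "inverse x \<noteq> 0" using assms by simp
    moreover have "nrm (inverse x) \<le> 1"
      using False by (simp add: nrm_inverse inverse_le_1_iff)
    ultimately obtain k u where ku: "nrm u = 1" "inverse x = unif powi k * u" using pos by blast
    have "x = inverse (unif powi k * u)" using ku(2) by (metis inverse_inverse_eq)
    then have "x = unif powi (- k) * inverse u" by (simp add: power_int_minus)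
    then show ?thesis using ku by (intro exI[of _ "-k"] exI[of _ "inverse u"]) (simp add: nrm_inverse)
  qed (use assms pos in blast)
qed

lemma red_0 [simp]: "red 0 = 0" using red_kernel[of 0] by simp

lemma red_sum:
  assumes "\<And>x. x \<in> S \<Longrightarrow> nrm (h x) \<le> 1"
  shows "red (sum h S) = (\<Sum>x\<in>S. red (h x))"
  using assms
proof (induction S rule: infinite_finite_induct)
  case (insert x F)
  have "nrm (sum h F) \<le> 1" using insert.prems by (intro nrm_sum_le) auto
  then show ?case using insert by (simp add: red_add)
qed simp_all

lemma red_prod:
  assumes "\<And>x. x \<in> S \<Longrightarrow> nrm (h x) \<le> 1"
  shows "red (prod h S) = (\<Prod>x\<in>S. red (h x))"
  using assms
proof (induction S rule: infinite_finite_induct)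
  case (insert x F)
  have "nrm (prod h F) \<le> 1" using insert.prems nrm_nonneg by (auto simp: nrm_prod intro!: prod_le_1)
  then show ?case using insert by (simp add: red_mult)
qed (simp_all add: red_one)

lemma red_minus: "nrm x \<le> 1 \<Longrightarrow> red (- x) = - red x"
  using red_add[of x "- x"] by (simp add: eq_neg_iff_add_eq_0 add.commute)

lemma red_cong:
  assumes "nrm x \<le> 1" "nrm (x - y) < 1"
  shows "red x = red y"
proof -
  have y: "nrm y \<le> 1" using nrm_diff[of x "x - y"] assms by simp
  have "red (x - y) = 0" using assms red_kernel[of "x - y"] by simp
  moreover have "red x = red (x - y) + red y" using red_add[of "x - y" y] assms y by simp
  ultimately show ?thesis by simp
qed

text \<open>The determinant is an integral polynomial in the entries, and reduction is a ring homomorphism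
  on the ring of integers.\<close>

lemma det_integral:
  assumes A: "A \<in> carrier_mat n n" and int: "\<And>i j. i < n \<Longrightarrow> j < n \<Longrightarrow> nrm (A $$ (i, j)) \<le> 1"
  shows "nrm (det A) \<le> 1" and "red (det A) = det (map_mat red A)"
proof -
  let ?t = "\<lambda>p. signof p * (\<Prod>i = 0..<n. A $$ (i, p i))"
  have ent: "nrm (A $$ (i, p i)) \<le> 1" if "p permutes {0..<n}" "i \<in> {0..<n}" for p i
    using that permutes_in_image[OF that(1), of i] by (intro int) auto
  have pr: "nrm (\<Prod>i = 0..<n. A $$ (i, p i)) \<le> 1" if "p permutes {0..<n}" for p
    unfolding nrm_prod using ent[OF that] nrm_nonneg by (intro prod_le_1) auto
  have t: "nrm (?t p) \<le> 1" if "p permutes {0..<n}" for p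
    using pr[OF that] by (simp add: sign_def)
  show "nrm (det A) \<le> 1" unfolding det_def'[OF A] by (rule nrm_sum_le) (use t in auto)
  have rt: "red (?t p) = signof p * (\<Prod>i = 0..<n. (map_mat red A) $$ (i, p i))"
    if p: "p permutes {0..<n}" for p
  proof -
    have "red (\<Prod>i = 0..<n. A $$ (i, p i)) = (\<Prod>i = 0..<n. (map_mat red A) $$ (i, p i))"
      using ent[OF p] A permutes_in_image[OF p] by (subst red_prod) (auto intro!: prod.cong)
    then show ?thesis using pr[OF p] by (simp add: sign_def red_minus)
  qed
  have "map_mat red A \<in> carrier_mat n n" using A by simp
  then show "red (det A) = det (map_mat red A)"
    unfolding det_def'[OF A] det_def'[OF \<open>map_mat red A \<in> _\<close>]
    by (subst red_sum) (use t rt in \<open>auto intro!: sum.cong\<close>)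
qed

end

section \<open>The parahoric subgroup\<close>

locale parahoric = nonarch_local_field nrm unif red
  for nrm :: "'F::field \<Rightarrow> real" and unif :: 'F and red :: "'F \<Rightarrow> 'k::field" +
  fixes e f :: nat
begin

abbreviation "n \<equiv> e * f"
abbreviation "ord \<equiv> order_A nrm e f"
abbreviation "J \<equiv> type_J nrm e f"

lemma order_A_mat: "A \<in> ord \<Longrightarrow> A \<in> carrier_mat n n"
  and order_A_le: "A \<in> ord \<Longrightarrow> i < n \<Longrightarrow> j < n \<Longrightarrow> nrm (A $$ (i, j)) \<le> 1"
  and order_A_less: "A \<in> ord \<Longrightarrow> i < n \<Longrightarrow> j < n \<Longrightarrow> j div f < i div f \<Longrightarrow> nrm (A $$ (i, j)) < 1"
  by (auto simp: order_A_def)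

lemma order_A_one: "1\<^sub>m n \<in> ord"
  by (auto simp: order_A_def)

lemma order_A_mult:
  assumes A: "A \<in> ord" and B: "B \<in> ord"
  shows "A * B \<in> ord"
proof -
  have "nrm ((A * B) $$ (i, j)) \<le> 1 \<and> (j div f < i div f \<longrightarrow> nrm ((A * B) $$ (i, j)) < 1)"
    if ij: "i < n" "j < n" for i j
  proof -
    note eq = mult_mat_entry[OF order_A_mat[OF A] order_A_mat[OF B] ij]
    have "nrm (A $$ (i, l) * B $$ (l, j)) < 1" if "l < n" "j div f < i div f" for l
    proof (rule nrm_mult_less_1)
      have "l div f < i div f \<or> j div f < l div f" using that(2) by linarith
      then show "nrm (A $$ (i, l)) < 1 \<or> nrm (B $$ (l, j)) < 1"
        using that ij order_A_less[OF A, of i l] order_A_less[OF B, of l j] by blast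
    qed (use that ij order_A_le[OF A] order_A_le[OF B] in auto)
    then show ?thesis unfolding eq
      using order_A_le[OF A] order_A_le[OF B] ij
      by (auto intro!: nrm_sum_le nrm_sum_less nrm_mult_le_1)
  qed
  then show ?thesis using order_A_mat[OF A] order_A_mat[OF B] by (auto simp: order_A_def)
qed

lemma J_ord: "A \<in> J \<Longrightarrow> A \<in> ord" and J_mat: "A \<in> J \<Longrightarrow> A \<in> carrier_mat n n"
  by (auto simp: type_J_def order_A_mat)

lemma J_I:
  assumes "A \<in> ord" "B \<in> ord" "A * B = 1\<^sub>m n"
  shows "A \<in> J" "B \<in> J"
  using assms mat_mult_left_right_inverse[OF order_A_mat[OF assms(1)] order_A_mat[OF assms(2)]]
  by (auto simp: type_J_def)

lemma J_E:
  assumes "A \<in> J" obtains B where "B \<in> J" "A * B = 1\<^sub>m n" "B * A = 1\<^sub>m n" "inv\<^bsub>GL n\<^esub> A = B"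
proof -
  obtain B where B: "A \<in> ord" "B \<in> ord" "A * B = 1\<^sub>m n" "B * A = 1\<^sub>m n"
    using assms by (auto simp: type_J_def)
  then show ?thesis using that J_I[of A B] GL_inv_eq[OF order_A_mat order_A_mat] by blast
qed

lemma J_subgroup: "subgroup J (GL n)"
proof -
  interpret group "GL n" by (rule GL_group)
  show ?thesis
  proof (rule subgroupI)
    show "J \<subseteq> carrier (GL n)"
    proof
      fix A assume A: "A \<in> J"
      then obtain B where "B \<in> J" "A * B = 1\<^sub>m n" by (rule J_E)
      then show "A \<in> carrier (GL n)" using GL_I(1) J_mat A by blast
    qed
    have "1\<^sub>m n \<in> J" using J_I[OF order_A_one order_A_one] by simp
    then show "J \<noteq> {}" by blast
    fix A assume A: "A \<in> J"
    then obtain B where B: "B \<in> J" "A * B = 1\<^sub>m n" "inv\<^bsub>GL n\<^esub> A = B" by (rule J_E)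
    then show "inv\<^bsub>GL n\<^esub> A \<in> J" by simp
    fix C assume C: "C \<in> J"
    then obtain D where D: "D \<in> J" "C * D = 1\<^sub>m n" by (rule J_E)
    have "A * C * (D * B) = 1\<^sub>m n" using J_mat A B C D by (intro mult_inverse_mats)
    then show "A \<otimes>\<^bsub>GL n\<^esub> C \<in> J"
      using J_I(1)[of "A * C" "D * B"] A B C D by (simp add: order_A_mult J_ord)
  qed
qed

lemma J_mult: "A \<in> J \<Longrightarrow> B \<in> J \<Longrightarrow> A * B \<in> J"
  using subgroup.m_closed[OF J_subgroup] by simp

lemma J_carrier: "A \<in> J \<Longrightarrow> A \<in> carrier (GL n)"
  using subgroup.subset[OF J_subgroup] by blast

text \<open>The determinant of \<open>D\<close> reduces to \<open>1\<close>, so it is a unit, and dividing the adjugate by it gives an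
  integral inverse \<open>Y\<close>. The relation \<open>Y = 1 - (D - 1) Y\<close> shows that the entries of \<open>Y\<close> below the block
  diagonal lie in the maximal ideal.\<close>

lemma near_one_J:
  assumes D: "D \<in> carrier_mat n n"
    and near: "\<And>i j. i < n \<Longrightarrow> j < n \<Longrightarrow> nrm (D $$ (i, j) - 1\<^sub>m n $$ (i, j)) < 1"
  shows "D \<in> J"
proof -
  have int: "nrm (D $$ (i, j)) \<le> 1" if "i < n" "j < n" for i j
    using ultrametric[of "D $$ (i, j) - 1\<^sub>m n $$ (i, j)" "1\<^sub>m n $$ (i, j)"] near[OF that] that
    by (auto split: if_splits)
  have "map_mat red D = 1\<^sub>m n"
  proof
    fix i j assume ij: "i < dim_row (1\<^sub>m n)" "j < dim_col (1\<^sub>m n)"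
    then have "red (D $$ (i, j)) = red (1\<^sub>m n $$ (i, j))" using int near by (intro red_cong) auto
    then show "map_mat red D $$ (i, j) = 1\<^sub>m n $$ (i, j)" using ij D by (auto simp: red_one)
  qed (use D in auto)
  then have "red (det D) = 1" using det_integral(2)[OF D int] by simp
  then have unit: "nrm (det D) = 1"
    using det_integral(1)[OF D int] red_kernel[of "det D"] by fastforce
  then have d0: "det D \<noteq> 0" by auto
  define Y where "Y = inverse (det D) \<cdot>\<^sub>m adj_mat D"
  have Y: "Y \<in> carrier_mat n n" using adj_mat(1)[OF D] by (simp add: Y_def)
  have "D * Y = inverse (det D) \<cdot>\<^sub>m (D * adj_mat D)"
    unfolding Y_def using mult_smult_distrib[OF D adj_mat(1)[OF D]] by simp
  also have "\<dots> = 1\<^sub>m n" using adj_mat(2)[OF D] d0 by auto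
  finally have DY: "D * Y = 1\<^sub>m n" .
  have Y_int: "nrm (Y $$ (i, j)) \<le> 1" if ij: "i < n" "j < n" for i j
  proof -
    have "mat_delete D j i \<in> carrier_mat (n - 1) (n - 1)" using D by (rule mat_delete_carrier)
    moreover have "nrm (mat_delete D j i $$ (a, b)) \<le> 1" if "a < n - 1" "b < n - 1" for a b
      using that D by (auto simp: mat_delete_def intro!: int)
    ultimately have 1: "nrm (det (mat_delete D j i)) \<le> 1" by (rule det_integral(1))
    have "nrm ((- 1) ^ (j + i)) = 1" by (simp add: nrm_power)
    then have "nrm (cofactor D j i) \<le> 1" using 1 by (simp add: cofactor_def nrm_mult)
    then show ?thesis using ij D unit by (simp add: Y_def adj_mat_def nrm_mult nrm_inverse)
  qed
  have Y_less: "nrm (Y $$ (i, j)) < 1" if ij: "i < n" "j < n" "j div f < i div f" for i j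
  proof -
    have neq: "i \<noteq> j" using ij(3) by auto
    define E where "E l = D $$ (i, l) - 1\<^sub>m n $$ (i, l)" for l
    have E: "nrm (E l) < 1" if "l < n" for l using near[OF ij(1) that] by (simp only: E_def)
    have "1\<^sub>m n $$ (i, j) = (\<Sum>l<n. D $$ (i, l) * Y $$ (l, j))"
      using mult_mat_entry[OF D Y ij(1,2)] DY by simp
    also have "\<dots> = (\<Sum>l<n. E l * Y $$ (l, j) + 1\<^sub>m n $$ (i, l) * Y $$ (l, j))"
      unfolding E_def by (rule sum.cong) (simp_all only: left_diff_distrib diff_add_cancel)
    also have "\<dots> = (\<Sum>l<n. E l * Y $$ (l, j)) + (\<Sum>l<n. 1\<^sub>m n $$ (i, l) * Y $$ (l, j))"
      by (rule sum.distrib)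
    also have "(\<Sum>l<n. 1\<^sub>m n $$ (i, l) * Y $$ (l, j)) = (\<Sum>l<n. if l = i then Y $$ (l, j) else 0)"
      using ij by (intro sum.cong) auto
    also have "\<dots> = Y $$ (i, j)" using ij by simp
    finally have "(\<Sum>l<n. E l * Y $$ (l, j)) + Y $$ (i, j) = 0"
      using ij neq by simp
    then have "Y $$ (i, j) = - (\<Sum>l<n. E l * Y $$ (l, j))"
      by (simp add: eq_neg_iff_add_eq_0 add.commute)
    moreover have "nrm (\<Sum>l<n. E l * Y $$ (l, j)) < 1"
      using E Y_int ij by (intro nrm_sum_less nrm_mult_less_1) (auto intro: less_imp_le)
    ultimately show ?thesis by simp
  qed
  have D_less: "nrm (D $$ (i, j)) < 1" if ij: "i < n" "j < n" "j div f < i div f" for i j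
    using near[OF ij(1,2)] ij by (auto split: if_splits)
  have "D \<in> ord" "Y \<in> ord" using D Y int Y_int D_less Y_less by (auto simp: order_A_def)
  then show ?thesis using J_I(1) DY by blast
qed

text \<open>Since the radius is the same at all points of \<open>J\<close>, this shows that \<open>J\<close> is both open and closed.\<close>

lemma near_J:
  assumes A: "A \<in> J" and B: "B \<in> carrier_mat n n"
    and near: "\<And>i j. i < n \<Longrightarrow> j < n \<Longrightarrow> nrm (B $$ (i, j) - A $$ (i, j)) < 1"
  shows "B \<in> J"
proof -
  obtain C where C: "C \<in> J" "A * C = 1\<^sub>m n" "C * A = 1\<^sub>m n" using A by (rule J_E)
  note m = J_mat[OF A] J_mat[OF C(1)] B
  have "C * B \<in> J"
  proof (rule near_one_J)
    fix i j assume ij: "i < n" "j < n"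
    have "(C * B) $$ (i, j) - (C * A) $$ (i, j) = (\<Sum>l<n. C $$ (i, l) * (B $$ (l, j) - A $$ (l, j)))"
      unfolding mult_mat_entry[OF m(2,3) ij] mult_mat_entry[OF m(2,1) ij]
      by (simp add: sum_subtractf[symmetric] algebra_simps)
    also have "nrm \<dots> < 1"
      using near order_A_le[OF J_ord[OF C(1)]] ij
      by (intro nrm_sum_less nrm_mult_less_1) (auto intro: less_imp_le)
    finally show "nrm ((C * B) $$ (i, j) - 1\<^sub>m n $$ (i, j)) < 1" using C by simp
  qed (use m in simp)
  then have "A * (C * B) \<in> J" using J_mult A by blast
  moreover have "A * (C * B) = B" using m C by (simp add: assoc_mult_mat[of _ n n _ n _ n, symmetric])
  ultimately show ?thesis by simp
qed

end

section \<open>The topology of the general linear group\<close>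

context nonarch_local_field
begin

sublocale metric: Metric_space UNIV "\<lambda>x y. nrm (x - y)"
proof
  fix x y z :: 'F
  show "0 \<le> nrm (x - y)" by (rule nrm_nonneg)
  show "nrm (x - y) = nrm (y - x)" using nrm_minus[of "x - y"] by simp
  show "nrm (x - y) = 0 \<longleftrightarrow> x = y" by (simp add: nrm_eq_0)
  show "nrm (x - z) \<le> nrm (x - y) + nrm (y - z)"
    using ultrametric[of "x - y" "y - z"] nrm_nonneg[of "x - y"] nrm_nonneg[of "y - z"] by simp
qed

lemma topspace_GL_topology: "topspace (GL_topology nrm n) = carrier (GL n)"
  by (auto simp: GL_topology_def topspace_pullback_topology)

text \<open>For finitely many entries the product topology is the topology of the maximum metric.\<close>

lemma openin_GL_topology:
  "openin (GL_topology nrm n) U \<longleftrightarrow> U \<subseteq> carrier (GL n) \<and>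
    (\<forall>A\<in>U. \<exists>\<epsilon>>0. \<forall>B\<in>carrier (GL n).
      (\<forall>i<n. \<forall>j<n. nrm (B $$ (i, j) - A $$ (i, j)) < \<epsilon>) \<longrightarrow> B \<in> U)"
  (is "?L \<longleftrightarrow> ?R")
proof -
  let ?I = "{..<n} \<times> {..<n}"
  let ?P = "product_topology (\<lambda>_. metric.mtopology) ?I"
  let ?e = "\<lambda>A::'F mat. restrict (\<lambda>ij. A $$ ij) ?I"
  have L: "?L \<longleftrightarrow> (\<exists>X. openin ?P X \<and> U = ?e -` X \<inter> carrier (GL n))"
    by (simp add: GL_topology_def openin_pullback_topology)
  show ?thesis
  proof
    assume ?L
    then obtain X where X: "openin ?P X" "U = ?e -` X \<inter> carrier (GL n)" using L by blast
    have "\<exists>\<epsilon>>0. \<forall>B\<in>carrier (GL n).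
        (\<forall>i<n. \<forall>j<n. nrm (B $$ (i, j) - A $$ (i, j)) < \<epsilon>) \<longrightarrow> B \<in> U" if A: "A \<in> U" for A
    proof -
      have "?e A \<in> X" using A X by blast
      with X(1)[unfolded openin_product_topology_alt]
      have "\<exists>Y. finite {ij \<in> ?I. Y ij \<noteq> topspace metric.mtopology} \<and>
          (\<forall>ij\<in>?I. openin metric.mtopology (Y ij)) \<and> ?e A \<in> PiE ?I Y \<and> PiE ?I Y \<subseteq> X"
        by (rule bspec)
      then obtain Y where Y': "\<forall>ij\<in>?I. openin metric.mtopology (Y ij)"
        "?e A \<in> PiE ?I Y" "PiE ?I Y \<subseteq> X" by (elim exE conjE)
      note Y = bspec[OF Y'(1)] Y'(2,3)
      have "\<exists>\<epsilon>>0. \<forall>x. nrm (x - A $$ ij) < \<epsilon> \<longrightarrow> x \<in> Y ij" if ij: "ij \<in> ?I" for ij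
      proof -
        have "A $$ ij \<in> Y ij" using Y(2) ij by (auto simp: PiE_iff)
        then obtain r where r: "r > 0" "metric.mball (A $$ ij) r \<subseteq> Y ij"
          using Y(1)[OF ij] unfolding metric.openin_mtopology by blast
        have "x \<in> Y ij" if "nrm (x - A $$ ij) < r" for x
          using r(2) that metric.commute[of x "A $$ ij"] by (auto simp: metric.mball_def)
        then show ?thesis using r(1) by blast
      qed
      then obtain \<epsilon> where \<epsilon>: "\<And>ij. ij \<in> ?I \<Longrightarrow> \<epsilon> ij > 0"
        "\<And>ij x. ij \<in> ?I \<Longrightarrow> nrm (x - A $$ ij) < \<epsilon> ij \<Longrightarrow> x \<in> Y ij" by metis
      define d where "d = Min (insert 1 (\<epsilon> ` ?I))"
      have d: "d > 0" unfolding d_def using \<epsilon>(1) by (subst Min_gr_iff) auto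
      have d_le: "d \<le> \<epsilon> ij" if "ij \<in> ?I" for ij unfolding d_def using that by (intro Min_le) auto
      have "B \<in> U" if B: "B \<in> carrier (GL n)"
        and near: "\<forall>i<n. \<forall>j<n. nrm (B $$ (i, j) - A $$ (i, j)) < d" for B
      proof -
        have "B $$ ij \<in> Y ij" if ij: "ij \<in> ?I" for ij
        proof -
          have "nrm (B $$ ij - A $$ ij) < d" using near ij by (cases ij) auto
          then show ?thesis using \<epsilon>(2)[OF ij] d_le[OF ij] by simp
        qed
        then have "?e B \<in> PiE ?I Y" by (auto simp: PiE_iff)
        then show ?thesis using Y(3) X(2) B by blast
      qed
      then show ?thesis using d by blast
    qed
    then show ?R using X(2) by blast
  next
    assume R: ?R
    then obtain \<epsilon> where \<epsilon>: "\<And>A. A \<in> U \<Longrightarrow> \<epsilon> A > 0"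
      "\<And>A B. A \<in> U \<Longrightarrow> B \<in> carrier (GL n) \<Longrightarrow>
        (\<And>i j. i < n \<Longrightarrow> j < n \<Longrightarrow> nrm (B $$ (i, j) - A $$ (i, j)) < \<epsilon> A) \<Longrightarrow> B \<in> U"
      by metis
    define X where "X = (\<Union>A\<in>U. PiE ?I (\<lambda>ij. metric.mball (A $$ ij) (\<epsilon> A)))"
    have "openin ?P X" unfolding X_def
      by (intro openin_Union) (auto simp: openin_PiE)
    moreover have "U = ?e -` X \<inter> carrier (GL n)"
    proof
      show "U \<subseteq> ?e -` X \<inter> carrier (GL n)"
      proof
        fix A assume A: "A \<in> U"
        have "?e A \<in> PiE ?I (\<lambda>ij. metric.mball (A $$ ij) (\<epsilon> A))"
          using \<epsilon>(1)[OF A] by (auto simp: PiE_iff)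
        then show "A \<in> ?e -` X \<inter> carrier (GL n)" using A R by (auto simp: X_def)
      qed
      show "?e -` X \<inter> carrier (GL n) \<subseteq> U"
      proof
        fix B assume B: "B \<in> ?e -` X \<inter> carrier (GL n)"
        then obtain A where A: "A \<in> U" "?e B \<in> PiE ?I (\<lambda>ij. metric.mball (A $$ ij) (\<epsilon> A))"
          by (auto simp: X_def)
        have "nrm (B $$ (i, j) - A $$ (i, j)) < \<epsilon> A" if "i < n" "j < n" for i j
        proof -
          have "(i, j) \<in> ?I" using that by simp
          then have "B $$ (i, j) \<in> metric.mball (A $$ (i, j)) (\<epsilon> A)"
            using PiE_mem[OF A(2), of "(i, j)"] by simp
          then show ?thesis using metric.commute[of "B $$ (i, j)" "A $$ (i, j)"] by simp
        qed
        then show "B \<in> U" using \<epsilon>(2)[OF A(1)] B by blast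
      qed
    qed
    ultimately show ?L using L by blast
  qed
qed

lemma translation_continuous:
  assumes g: "g \<in> carrier (GL n)"
  shows "continuous_map (GL_topology nrm n) (GL_topology nrm n) (\<lambda>A. g * A)"
    and "continuous_map (GL_topology nrm n) (GL_topology nrm n) (\<lambda>A. A * g)"
proof -
  interpret GL: group "GL n :: 'F mat monoid" by (rule GL_group)
  note gm = GL_carrier_mat[OF g]
  define M where "M = 1 + (\<Sum>i<n. \<Sum>j<n. nrm (g $$ (i, j)))"
  have M: "M > 0" unfolding M_def using nrm_nonneg by (intro add_pos_nonneg sum_nonneg) auto
  have gM: "nrm (g $$ (i, j)) < M" if "i < n" "j < n" for i j
  proof -
    have "nrm (g $$ (i, j)) \<le> (\<Sum>j<n. nrm (g $$ (i, j)))"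
      using that nrm_nonneg by (intro member_le_sum) auto
    also have "\<dots> \<le> (\<Sum>i<n. \<Sum>j<n. nrm (g $$ (i, j)))"
      using that nrm_nonneg by (intro member_le_sum[of i _ "\<lambda>i. \<Sum>j<n. nrm (g $$ (i, j))"] sum_nonneg) auto
    finally show ?thesis by (simp add: M_def)
  qed
  have small: "nrm (x * y) < \<epsilon>" if "nrm x < M" "nrm y < \<epsilon> / M" for x y \<epsilon>
  proof -
    have "nrm x * nrm y < M * (\<epsilon> / M)"
      using that nrm_nonneg by (intro mult_strict_mono' ) auto
    then show ?thesis using M by (simp add: nrm_mult)
  qed
  have left: "nrm ((g * B) $$ (i, j) - (g * A) $$ (i, j)) < \<epsilon>"
    and right: "nrm ((B * g) $$ (i, j) - (A * g) $$ (i, j)) < \<epsilon>"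
    if A: "A \<in> carrier (GL n)" and B: "B \<in> carrier (GL n)" and ij: "i < n" "j < n" and \<epsilon>: "\<epsilon> > 0"
      and near: "\<forall>i<n. \<forall>j<n. nrm (B $$ (i, j) - A $$ (i, j)) < \<epsilon> / M" for A B i j \<epsilon>
  proof -
    note m = GL_carrier_mat[OF A] GL_carrier_mat[OF B]
    have "(g * B) $$ (i, j) - (g * A) $$ (i, j) = (\<Sum>l<n. g $$ (i, l) * (B $$ (l, j) - A $$ (l, j)))"
      unfolding mult_mat_entry[OF gm m(1) ij] mult_mat_entry[OF gm m(2) ij]
      by (simp add: sum_subtractf[symmetric] algebra_simps)
    also have "nrm \<dots> < \<epsilon>" using near ij \<epsilon> by (intro nrm_sum_less small gM) auto
    finally show "nrm ((g * B) $$ (i, j) - (g * A) $$ (i, j)) < \<epsilon>" .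
    have "(B * g) $$ (i, j) - (A * g) $$ (i, j) = (\<Sum>l<n. g $$ (l, j) * (B $$ (i, l) - A $$ (i, l)))"
      unfolding mult_mat_entry[OF m(1) gm ij] mult_mat_entry[OF m(2) gm ij]
      by (simp add: sum_subtractf[symmetric] algebra_simps)
    also have "nrm \<dots> < \<epsilon>" using near ij \<epsilon> by (intro nrm_sum_less small gM) auto
    finally show "nrm ((B * g) $$ (i, j) - (A * g) $$ (i, j)) < \<epsilon>" .
  qed
  have cl: "g * A \<in> carrier (GL n)" "A * g \<in> carrier (GL n)" if "A \<in> carrier (GL n)" for A
    using GL.m_closed[OF g that] GL.m_closed[OF that g] by simp_all
  have *: "continuous_map (GL_topology nrm n) (GL_topology nrm n) h"
    if h: "\<And>A. A \<in> carrier (GL n) \<Longrightarrow> h A \<in> carrier (GL n)"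
      and near: "\<And>A B i j \<epsilon>. A \<in> carrier (GL n) \<Longrightarrow> B \<in> carrier (GL n) \<Longrightarrow> i < n \<Longrightarrow> j < n \<Longrightarrow> \<epsilon> > 0 \<Longrightarrow>
        \<forall>i<n. \<forall>j<n. nrm (B $$ (i, j) - A $$ (i, j)) < \<epsilon> / M \<Longrightarrow>
        nrm (h B $$ (i, j) - h A $$ (i, j)) < \<epsilon>" for h
    unfolding continuous_map_def topspace_GL_topology
  proof (intro conjI allI impI)
    fix U assume U: "openin (GL_topology nrm n) U"
    show "openin (GL_topology nrm n) {A \<in> carrier (GL n). h A \<in> U}"
      unfolding openin_GL_topology
    proof (intro conjI ballI)
      fix A assume A: "A \<in> {A \<in> carrier (GL n). h A \<in> U}"
      then obtain \<epsilon> where \<epsilon>: "\<epsilon> > 0" "\<forall>B\<in>carrier (GL n).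
          (\<forall>i<n. \<forall>j<n. nrm (B $$ (i, j) - h A $$ (i, j)) < \<epsilon>) \<longrightarrow> B \<in> U"
        using U unfolding openin_GL_topology by blast
      show "\<exists>\<epsilon>>0. \<forall>B\<in>carrier (GL n). (\<forall>i<n. \<forall>j<n. nrm (B $$ (i, j) - A $$ (i, j)) < \<epsilon>) \<longrightarrow>
          B \<in> {A \<in> carrier (GL n). h A \<in> U}"
        using \<epsilon> near[OF _ _ _ _ \<epsilon>(1)] h A M by (intro exI[of _ "\<epsilon> / M"]) auto
    qed auto
  qed (use h in auto)
  show "continuous_map (GL_topology nrm n) (GL_topology nrm n) (\<lambda>A. g * A)"
    by (rule *) (use cl left in auto)
  show "continuous_map (GL_topology nrm n) (GL_topology nrm n) (\<lambda>A. A * g)"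
    by (rule *) (use cl right in auto)
qed

end

context parahoric
begin

lemma J_open: "openin (GL_topology nrm (n)) (J)"
  unfolding openin_GL_topology
proof (intro conjI ballI)
  show "J \<subseteq> carrier (GL (n))" using J_carrier by blast
  fix A assume A: "A \<in> J"
  show "\<exists>\<epsilon>>0. \<forall>B\<in>carrier (GL (n)).
      (\<forall>i<n. \<forall>j<n. nrm (B $$ (i, j) - A $$ (i, j)) < \<epsilon>) \<longrightarrow> B \<in> J"
  proof (intro exI[of _ 1] conjI ballI impI)
    fix B assume B: "B \<in> carrier (GL (n))"
      and near: "\<forall>i<n. \<forall>j<n. nrm (B $$ (i, j) - A $$ (i, j)) < 1"
    show "B \<in> J"
      by (rule near_J[OF A GL_carrier_mat[OF B]]) (use near in blast)
  qed simp
qed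

end

context nonarch_local_field
begin

section \<open>Compactness of the parahoric subgroup\<close>

lemma metric_continuous_map_scale:
  "continuous_map metric.mtopology metric.mtopology (\<lambda>x. a * x)"
proof (cases "a = 0")
  case False
  show ?thesis
    unfolding continuous_map_def
  proof (intro conjI allI impI)
    fix U assume U: "openin metric.mtopology U"
    show "openin metric.mtopology {x \<in> topspace metric.mtopology. a * x \<in> U}"
      unfolding metric.openin_mtopology
    proof (intro conjI allI impI)
      fix x assume x: "x \<in> {x \<in> topspace metric.mtopology. a * x \<in> U}"
      then obtain r where r: "r > 0" "metric.mball (a * x) r \<subseteq> U"
        using U unfolding metric.openin_mtopology by blast
      have "metric.mball x (r / nrm a) \<subseteq> {x \<in> topspace metric.mtopology. a * x \<in> U}"
      proof
        fix y assume "y \<in> metric.mball x (r / nrm a)"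
        then have "nrm a * nrm (x - y) < r" using nrm_pos[OF False] by (simp add: field_simps)
        then have "nrm (a * x - a * y) < r" by (simp add: nrm_mult[symmetric] right_diff_distrib)
        then show "y \<in> {x \<in> topspace metric.mtopology. a * x \<in> U}" using r by auto
      qed
      then show "\<exists>r>0. metric.mball x r \<subseteq> {x \<in> topspace metric.mtopology. a * x \<in> U}"
        using r nrm_pos[OF False] by (intro exI[of _ "r / nrm a"]) simp
    qed simp
  qed simp
qed simp

text \<open>Local compactness provides a compact ball around \<open>0\<close>, and division by a power of the uniformizer
  carries it onto the ring of integers.\<close>

lemma compact_integers: "compactin metric.mtopology {x. nrm x \<le> 1}"
proof -
  obtain U K where UK: "openin metric.mtopology U" "compactin metric.mtopology K" "0 \<in> U" "U \<subseteq> K"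
    using locally_compact unfolding locally_compact_space_def by (metis UNIV_I metric.topspace_mtopology)
  obtain r where r: "r > 0" "metric.mball 0 r \<subseteq> U"
    using UK unfolding metric.openin_mtopology by blast
  obtain m where m: "nrm unif ^ m < r"
    using real_arch_pow_inv[OF r(1) nrm_unif(2)] by blast
  let ?a = "unif ^ m"
  have a: "nrm ?a < r" "nrm ?a > 0" using m nrm_unif by (simp_all add: nrm_power)
  have "closedin metric.mtopology (metric.mcball 0 (nrm ?a))" by simp
  moreover have "metric.mcball 0 (nrm ?a) \<subseteq> K"
    using a r UK by (auto simp: subset_iff)
  ultimately have "compactin metric.mtopology (metric.mcball 0 (nrm ?a))"
    using UK(2) closed_compactin by blast
  then have "compactin metric.mtopology ((\<lambda>x. inverse ?a * x) ` metric.mcball 0 (nrm ?a))"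
    by (rule image_compactin) (rule metric_continuous_map_scale)
  moreover have "(\<lambda>x. inverse ?a * x) ` metric.mcball 0 (nrm ?a) = {x. nrm x \<le> 1}"
  proof
    show "(\<lambda>x. inverse ?a * x) ` metric.mcball 0 (nrm ?a) \<subseteq> {x. nrm x \<le> 1}"
    proof
      fix y assume "y \<in> (\<lambda>x. inverse ?a * x) ` metric.mcball 0 (nrm ?a)"
      then obtain x where x: "y = inverse ?a * x" "x \<in> metric.mcball 0 (nrm ?a)" by (rule imageE)
      have "nrm y = nrm x / nrm ?a" unfolding x(1) by (simp add: nrm_mult nrm_inverse divide_inverse mult.commute)
      then show "y \<in> {x. nrm x \<le> 1}" using x(2) a(2) by simp
    qed
    show "{x. nrm x \<le> 1} \<subseteq> (\<lambda>x. inverse ?a * x) ` metric.mcball 0 (nrm ?a)"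
    proof
      fix y assume y: "y \<in> {x. nrm x \<le> 1}"
      have "y = inverse ?a * (?a * y)" using unif_nonzero by simp
      moreover have "?a * y \<in> metric.mcball 0 (nrm ?a)"
        using y a(2) by (simp add: nrm_mult mult_left_le)
      ultimately show "y \<in> (\<lambda>x. inverse ?a * x) ` metric.mcball 0 (nrm ?a)" by blast
    qed
  qed
  ultimately show ?thesis by simp
qed

end

context parahoric
begin

text \<open>The order is a product of compact sets, one for each entry, and \<open>J\<close> is closed in it because of
  the uniform radius in \<open>near_J\<close>.\<close>

lemma J_compact: "compactin (GL_topology nrm (n)) (J)"
proof -
  define I where "I = {..<n} \<times> {..<n}"
  define S where "S ij = {x. nrm x \<le> 1 \<and> (snd ij div f < fst ij div f \<longrightarrow> nrm x < 1)}" for ij :: "nat \<times> nat"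
  let ?P = "product_topology (\<lambda>_. metric.mtopology) I"
  define mk where "mk h = mat (n) (n) h" for h :: "nat \<times> nat \<Rightarrow> 'F"
  define C where "C = {h \<in> PiE I S. mk h \<in> J}"
  have finI: "finite I" by (simp add: I_def)
  have close: "openin ?P (PiE I (\<lambda>ij. metric.mball (h ij) 1))" for h :: "nat \<times> nat \<Rightarrow> 'F"
    using finI by (simp add: openin_PiE)
  have "compactin metric.mtopology (S ij)" for ij
  proof -
    have "S ij = {x. nrm x \<le> 1} \<or> S ij = metric.mcball 0 (nrm unif)"
      using nrm_unif by (auto simp: S_def nrm_less_1)
    moreover have "compactin metric.mtopology (metric.mcball 0 (nrm unif))"
      by (rule closed_compactin[OF compact_integers]) (use nrm_unif in auto)
    ultimately show ?thesis using compact_integers by auto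
  qed
  then have PiE: "compactin ?P (PiE I S)" by (simp add: compactin_PiE)
  have mk_mat: "mk h \<in> carrier_mat (n) (n)" and mk_at: "i < n \<Longrightarrow> j < n \<Longrightarrow> mk h $$ (i, j) = h (i, j)"
    for h i j by (simp_all add: mk_def)
  have near: "mk k \<in> J"
    if "mk h \<in> J" and k: "\<And>ij. ij \<in> I \<Longrightarrow> nrm (h ij - k ij) < 1" for h k
  proof (rule near_J[OF that(1) mk_mat])
    fix i j assume "i < n" "j < n"
    then show "nrm (mk k $$ (i, j) - mk h $$ (i, j)) < 1"
      using k[of "(i, j)"] metric.commute[of "h (i, j)" "k (i, j)"] by (simp add: mk_at I_def)
  qed
  have "compactin ?P C"
  proof -
    \<comment> \<open>The complement of \<open>J\<close> is open in the order: it is a union of unit balls as well.\<close>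
    define X where "X = (\<Union>h\<in>PiE I S - C. PiE I (\<lambda>ij. metric.mball (h ij) 1))"
    have X: "openin ?P X" unfolding X_def using close by (intro openin_Union) auto
    have "C = PiE I S \<inter> (topspace ?P - X)"
    proof (intro equalityI subsetI)
      fix h assume h: "h \<in> C"
      then have hP: "h \<in> PiE I S" "mk h \<in> J" by (auto simp: C_def)
      have "h \<notin> X"
      proof
        assume "h \<in> X"
        then obtain k where k: "k \<in> PiE I S - C" "h \<in> PiE I (\<lambda>ij. metric.mball (k ij) 1)"
          by (auto simp: X_def)
        have "nrm (h ij - k ij) < 1" if "ij \<in> I" for ij
          using PiE_mem[OF k(2) that] metric.commute[of "h ij" "k ij"] by simp
        then have "mk k \<in> J" using near[OF hP(2)] by blast
        then show False using k(1) by (simp add: C_def)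
      qed
      moreover have "h \<in> topspace ?P" using hP by (auto simp: PiE_iff)
      ultimately show "h \<in> PiE I S \<inter> (topspace ?P - X)" using hP by blast
    next
      fix h assume h: "h \<in> PiE I S \<inter> (topspace ?P - X)"
      have "h \<in> PiE I (\<lambda>ij. metric.mball (h ij) 1)" using h by (auto simp: PiE_iff)
      then show "h \<in> C" using h by (auto simp: X_def)
    qed
    moreover have "compactin ?P (PiE I S \<inter> (topspace ?P - X))"
      by (rule compact_Int_closedin[OF PiE]) (use X in blast)
    ultimately show ?thesis by simp
  qed
  moreover have "continuous_map (subtopology ?P C) (GL_topology nrm (n)) mk"
    unfolding continuous_map_def topspace_GL_topology
  proof (intro conjI allI impI)
    show "mk \<in> topspace (subtopology ?P C) \<rightarrow> carrier (GL (n))"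
      using J_carrier by (auto simp: C_def)
    fix U assume U: "openin (GL_topology nrm (n)) U"
    let ?B = "{h \<in> topspace (subtopology ?P C). mk h \<in> U}"
    have "\<exists>X. openin ?P X \<and> h \<in> X \<and> X \<inter> C \<subseteq> ?B" if h: "h \<in> ?B" for h
    proof -
      obtain \<epsilon> where \<epsilon>: "\<epsilon> > 0" "\<And>B. B \<in> carrier (GL (n)) \<Longrightarrow>
          (\<forall>i<n. \<forall>j<n. nrm (B $$ (i, j) - mk h $$ (i, j)) < \<epsilon>) \<Longrightarrow> B \<in> U"
        using U h unfolding openin_GL_topology by blast
      let ?X = "PiE I (\<lambda>ij. metric.mball (h ij) \<epsilon>)"
      have "openin ?P ?X" using finI by (simp add: openin_PiE)
      moreover have "h \<in> ?X" using h \<epsilon>(1) by (auto simp: PiE_iff C_def)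
      moreover have "?X \<inter> C \<subseteq> ?B"
      proof
        fix k assume k: "k \<in> ?X \<inter> C"
        then have kX: "k \<in> ?X" and kC: "k \<in> C" by auto
        have "nrm (mk k $$ (i, j) - mk h $$ (i, j)) < \<epsilon>" if "i < n" "j < n" for i j
          using PiE_mem[OF kX, of "(i, j)"] metric.commute[of "h (i, j)" "k (i, j)"] that
          by (simp add: mk_at I_def)
        moreover have "mk k \<in> carrier (GL (n))" using kC J_carrier by (auto simp: C_def)
        ultimately have "mk k \<in> U" using \<epsilon>(2) by blast
        moreover have "k \<in> topspace ?P" using kC by (auto simp: C_def PiE_iff)
        ultimately show "k \<in> ?B" using kC by simp
      qed
      ultimately show ?thesis by (intro exI[of _ ?X] conjI)
    qed
    then obtain X where X: "\<And>h. h \<in> ?B \<Longrightarrow> openin ?P (X h) \<and> h \<in> X h \<and> X h \<inter> C \<subseteq> ?B"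
      using choice[of "\<lambda>h X. h \<in> ?B \<longrightarrow> openin ?P X \<and> h \<in> X \<and> X \<inter> C \<subseteq> ?B"] by blast
    have "?B = (\<Union>h\<in>?B. X h) \<inter> C"
    proof
      show "?B \<subseteq> (\<Union>h\<in>?B. X h) \<inter> C" using X by auto
      show "(\<Union>h\<in>?B. X h) \<inter> C \<subseteq> ?B" using X by blast
    qed
    moreover have "openin ?P (\<Union>h\<in>?B. X h)" using X by (intro openin_Union) blast
    ultimately show "openin (subtopology ?P C) ?B" unfolding openin_subtopology
      by (intro exI[of _ "\<Union>h\<in>?B. X h"] conjI)
  qed
  ultimately have "compactin (GL_topology nrm (n)) (mk ` C)"
    by (intro image_compactin[of "subtopology ?P C"]) (simp_all add: compactin_subtopology)
  moreover have "mk ` C = J"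
  proof
    show "J \<subseteq> mk ` C"
    proof
      fix A assume A: "A \<in> J"
      let ?h = "restrict (\<lambda>ij. A $$ ij) I"
      have "mk ?h = A" using J_mat[OF A] by (auto simp: mk_def I_def)
      moreover have "?h \<in> PiE I S"
        using order_A_le[OF J_ord[OF A]] order_A_less[OF J_ord[OF A]] by (auto simp: I_def S_def)
      ultimately have "?h \<in> C" using A by (simp add: C_def)
      then show "A \<in> mk ` C" using \<open>mk ?h = A\<close> by (metis imageI)
    qed
  qed (auto simp: C_def)
  ultimately show ?thesis by simp
qed

end

section \<open>Reduction to monomial matrices\<close>

definition (in nonarch_local_field) monomial_mat ::
    "nat \<Rightarrow> (nat \<Rightarrow> nat) \<Rightarrow> (nat \<Rightarrow> int) \<Rightarrow> 'F mat"
  where "monomial_mat m s c = mat m m (\<lambda>(i, j). if j = s i then unif powi c i else 0)"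

context parahoric
begin

lemma elementary_J:
  assumes N: "N \<in> carrier_mat n n"
    and le: "\<And>i j. i < n \<Longrightarrow> j < n \<Longrightarrow> nrm (N $$ (i, j)) \<le> 1"
    and less: "\<And>i j. i < n \<Longrightarrow> j < n \<Longrightarrow> j div f < i div f \<Longrightarrow> nrm (N $$ (i, j)) < 1"
    and nil: "\<And>i j k. i < n \<Longrightarrow> j < n \<Longrightarrow> k < n \<Longrightarrow> N $$ (i, j) = 0 \<or> N $$ (j, k) = 0"
  shows "1\<^sub>m n + N \<in> J"
proof (rule J_I(1))
  have diag: "N $$ (i, i) = 0" if "i < n" for i using nil[OF that that that] by simp
  have plus: "nrm (x + y) \<le> 1" if "nrm x \<le> 1" "nrm y \<le> 1" for x y
    using ultrametric[of x y] that by simp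
  have minus: "nrm (x - y) \<le> 1" if "nrm x \<le> 1" "nrm y \<le> 1" for x y
    using nrm_diff[of x y] that by simp
  show "1\<^sub>m n + N \<in> order_A nrm e f" "1\<^sub>m n - N \<in> order_A nrm e f"
    unfolding order_A_def using N le less by (auto simp: diag intro: plus minus)
  show "(1\<^sub>m n + N) * (1\<^sub>m n - N) = 1\<^sub>m n" using N nil by (rule square_zero_mat)
qed

definition pivot :: "'F mat \<Rightarrow> nat \<Rightarrow> nat \<Rightarrow> bool"
  where "pivot g i j \<longleftrightarrow> i < n \<and> j < n \<and> g $$ (i, j) \<noteq> 0 \<and>
    (\<forall>k<n. k \<noteq> i \<longrightarrow> g $$ (k, j) = 0) \<and> (\<forall>l<n. l \<noteq> j \<longrightarrow> g $$ (i, l) = 0)"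

definition pivot_rows :: "'F mat \<Rightarrow> nat set"
  where "pivot_rows g = {i. \<exists>j. pivot g i j}"

text \<open>One step of Gaussian elimination, with row and column operations from \<open>J\<close>. A row that already
  contains a pivot vanishes in the column of the new pivot, so it is not disturbed.\<close>

lemma clear_row_and_column:
  assumes g: "g \<in> carrier (GL n)" and undone: "pivot_rows g \<noteq> {..<n}"
  shows "\<exists>L\<in>J. \<exists>R\<in>J. pivot_rows g \<subset> pivot_rows (L * g * R)"
proof -
  note gm = GL_carrier_mat[OF g]
  have "pivot_rows g \<subseteq> {..<n}" by (auto simp: pivot_rows_def pivot_def)
  then obtain i0 where i0: "i0 < n" "i0 \<notin> pivot_rows g" using undone by blast
  have "\<exists>j<n. g $$ (i0, j) \<noteq> 0"
  proof (rule ccontr)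
    assume z: "\<not> ?thesis"
    obtain B where B: "B \<in> carrier_mat n n" "g * B = 1\<^sub>m n" using g GL_iff by blast
    have "(g * B) $$ (i0, i0) = 0"
      unfolding mult_mat_entry[OF gm B(1) i0(1) i0(1)] using z by (intro sum.neutral) auto
    then show False using B i0 by simp
  qed
  then obtain j0 where j0: "j0 < n" "g $$ (i0, j0) \<noteq> 0" by blast

  \<comment> \<open>The pivot is an entry of maximal absolute value among the rows still to be cleared; the last
    such row and then the first such column make the quotients below admissible.\<close>
  define S where "S = ({..<n} - pivot_rows g) \<times> {..<n}"
  define M where "M = Max ((\<lambda>ij. nrm (g $$ ij)) ` S)"
  have S: "finite S" "(i0, j0) \<in> S" using i0 j0 by (auto simp: S_def)
  have M_max: "nrm (g $$ (k, l)) \<le> M" if "(k, l) \<in> S" for k l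
    unfolding M_def using S that by (intro Max_ge) auto
  have M_pos: "M > 0" using M_max[OF S(2)] nrm_pos[OF j0(2)] by simp
  define Is where "Is = {i. \<exists>j. (i, j) \<in> S \<and> nrm (g $$ (i, j)) = M}"
  have Is: "finite Is" by (rule finite_subset[of _ "{..<n}"]) (auto simp: Is_def S_def)
  have "M \<in> (\<lambda>ij. nrm (g $$ ij)) ` S" unfolding M_def using S by (intro Max_in) auto
  then have "Is \<noteq> {}" by (auto simp: Is_def)
  define i where "i = Max Is"
  have "i \<in> Is" unfolding i_def using Is \<open>Is \<noteq> {}\<close> by (rule Max_in)
  have i_last: "nrm (g $$ (k, l)) < M" if "(k, l) \<in> S" "i < k" for k l
  proof -
    have "k \<notin> Is" using Max_ge[OF Is, of k] that by (auto simp: i_def)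
    then show ?thesis using M_max[OF that(1)] that(1) by (auto simp: Is_def)
  qed
  define Js where "Js = {j. (i, j) \<in> S \<and> nrm (g $$ (i, j)) = M}"
  have Js: "finite Js" by (rule finite_subset[of _ "{..<n}"]) (auto simp: Js_def S_def)
  have "Js \<noteq> {}" using \<open>i \<in> Is\<close> by (auto simp: Js_def Is_def)
  define j where "j = Min Js"
  have "j \<in> Js" unfolding j_def using Js \<open>Js \<noteq> {}\<close> by (rule Min_in)
  then have ij: "i < n" "j < n" "i \<notin> pivot_rows g" "nrm (g $$ (i, j)) = M" "g $$ (i, j) \<noteq> 0"
    using M_pos by (auto simp: Js_def S_def)
  have j_first: "nrm (g $$ (i, l)) < M" if "l < j" for l
  proof -
    have "l \<notin> Js" using Min_le[OF Js, of l] that by (auto simp: j_def)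
    moreover have "(i, l) \<in> S" using that ij by (auto simp: S_def)
    ultimately show ?thesis using M_max[of i l] by (auto simp: Js_def)
  qed
  have other: "k \<noteq> i \<and> l \<noteq> j \<and> g $$ (k, j) = 0 \<and> g $$ (i, l) = 0" if "pivot g k l" for k l
  proof -
    have "k \<noteq> i" using that ij by (auto simp: pivot_rows_def)
    then have "g $$ (i, l) = 0" using that ij by (simp add: pivot_def)
    then show ?thesis using that ij \<open>k \<noteq> i\<close> by (auto simp: pivot_def)
  qed
  define p where "p = g $$ (i, j)"
  have p: "p \<noteq> 0" "nrm p = M" using ij by (simp_all add: p_def)
  have colj: "nrm (g $$ (k, j)) \<le> M \<and> (i < k \<longrightarrow> nrm (g $$ (k, j)) < M)" if "k < n" for k
  proof (cases "k \<in> pivot_rows g")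
    case True
    then have "g $$ (k, j) = 0" using other by (auto simp: pivot_rows_def)
    then show ?thesis using M_pos by simp
  next
    case False
    then have "(k, j) \<in> S" using that ij by (simp add: S_def)
    then show ?thesis using M_max i_last by blast
  qed
  have rowi: "nrm (g $$ (i, l)) \<le> M" if "l < n" for l
    using M_max[of i l] that ij by (simp add: S_def)

  define N where "N = mat n n (\<lambda>(k, l). if l = i \<and> k \<noteq> i then - (g $$ (k, j) / p) else 0)"
  define N' where "N' = mat n n (\<lambda>(k, l). if k = j \<and> l \<noteq> j then - (g $$ (i, l) / p) else 0)"
  have Nm: "N \<in> carrier_mat n n" "N' \<in> carrier_mat n n" by (simp_all add: N_def N'_def)
  have L: "1\<^sub>m n + N \<in> J"
  proof (rule elementary_J[OF Nm(1)])
    fix k l assume kl: "k < n" "l < n"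
    show "nrm (N $$ (k, l)) \<le> 1"
      using kl colj[of k] M_pos p by (auto simp: N_def nrm_divide)
    assume "l div f < k div f"
    then have "l < k" by (metis div_le_mono not_less)
    then show "nrm (N $$ (k, l)) < 1"
      using kl colj[of k] M_pos p by (auto simp: N_def nrm_divide)
  qed (auto simp: N_def)
  have R: "1\<^sub>m n + N' \<in> J"
  proof (rule elementary_J[OF Nm(2)])
    fix k l assume kl: "k < n" "l < n"
    show "nrm (N' $$ (k, l)) \<le> 1"
      using kl rowi[of l] M_pos p by (auto simp: N'_def nrm_divide)
    assume "l div f < k div f"
    then have "l < k" by (metis div_le_mono not_less)
    then show "nrm (N' $$ (k, l)) < 1"
      using kl j_first[of l] M_pos p by (auto simp: N'_def nrm_divide)
  qed (auto simp: N'_def)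
  define h where "h = (1\<^sub>m n + N) * g"
  define g' where "g' = h * (1\<^sub>m n + N')"
  have hm: "h \<in> carrier_mat n n" unfolding h_def using Nm gm by (intro mult_carrier_mat[of _ n n]) auto
  have h_at: "h $$ (k, l) = (if k = i then g $$ (i, l) else g $$ (k, l) - g $$ (k, j) * g $$ (i, l) / p)"
    if kl: "k < n" "l < n" for k l
  proof -
    have "h = 1\<^sub>m n * g + N * g" unfolding h_def using Nm gm by (intro add_mult_distrib_mat) auto
    then have "h $$ (k, l) = g $$ (k, l) + (N * g) $$ (k, l)" using kl Nm gm by simp
    also have "(N * g) $$ (k, l) = (\<Sum>m<n. N $$ (k, m) * g $$ (m, l))"
      using mult_mat_entry[OF Nm(1) gm kl] .
    also have "\<dots> = (\<Sum>m<n. if m = i then (if k \<noteq> i then - (g $$ (k, j) / p) * g $$ (i, l) else 0) else 0)"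
      by (rule sum.cong) (use kl in \<open>auto simp: N_def\<close>)
    finally show ?thesis using ij kl by simp
  qed
  have g'_at: "g' $$ (k, l) = (if k = i then if l = j then p else 0
      else g $$ (k, l) - g $$ (k, j) * g $$ (i, l) / p)" if kl: "k < n" "l < n" for k l
  proof -
    have "g' = h * 1\<^sub>m n + h * N'" unfolding g'_def using Nm hm by (intro mult_add_distrib_mat) auto
    then have "g' $$ (k, l) = h $$ (k, l) + (h * N') $$ (k, l)" using kl Nm hm by simp
    also have "(h * N') $$ (k, l) = (\<Sum>m<n. h $$ (k, m) * N' $$ (m, l))"
      using mult_mat_entry[OF hm Nm(2) kl] .
    also have "\<dots> = (\<Sum>m<n. if m = j then (if l \<noteq> j then - (h $$ (k, j) * g $$ (i, l) / p) else 0) else 0)"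
      by (rule sum.cong) (use kl in \<open>auto simp: N'_def\<close>)
    finally have "g' $$ (k, l) = h $$ (k, l) - (if l \<noteq> j then h $$ (k, j) * g $$ (i, l) / p else 0)"
      using ij kl by simp
    then show ?thesis using kl ij p by (auto simp: h_at p_def[symmetric])
  qed
  have "pivot g' i j"
    unfolding pivot_def using ij p by (auto simp: g'_at p_def[symmetric])
  moreover have "pivot g' k l" if kl: "pivot g k l" for k l
    using kl other[OF kl] ij unfolding pivot_def by (auto simp: g'_at)
  ultimately have "pivot_rows g \<subset> pivot_rows g'" using ij(3) by (auto simp: pivot_rows_def)
  then show ?thesis using L R unfolding g'_def h_def by blast
qed

lemma reduce_to_pivots:
  assumes "g \<in> carrier (GL n)"
  shows "\<exists>L\<in>J. \<exists>R\<in>J. pivot_rows (L * g * R) = {..<n}"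
  using assms
proof (induction "n - card (pivot_rows g)" arbitrary: g rule: less_induct)
  case less
  interpret GL: group "GL n :: 'F mat monoid" by (rule GL_group)
  note gm = GL_carrier_mat[OF less.prems]
  have sub: "pivot_rows g \<subseteq> {..<n}" for g by (auto simp: pivot_rows_def pivot_def)
  show ?case
  proof (cases "pivot_rows g = {..<n}")
    case True
    have "1\<^sub>m n \<in> J" using subgroup.one_closed[OF J_subgroup] by simp
    moreover have "1\<^sub>m n * g * 1\<^sub>m n = g" using gm by simp
    ultimately show ?thesis using True by (metis)
  next
    case False
    then obtain L R where LR: "L \<in> J" "R \<in> J" "pivot_rows g \<subset> pivot_rows (L * g * R)"
      using clear_row_and_column[OF less.prems] by blast
    let ?g = "L * g * R"
    have g': "?g \<in> carrier (GL n)"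
      using GL.m_closed[OF GL.m_closed[OF J_carrier[OF LR(1)] less.prems] J_carrier[OF LR(2)]] by simp
    have "card (pivot_rows g) < card (pivot_rows ?g)"
      using LR(3) finite_subset[OF sub] by (intro psubset_card_mono) auto
    moreover have "card (pivot_rows ?g) \<le> n" using card_mono[OF _ sub, of ?g] by simp
    ultimately have "n - card (pivot_rows ?g) < n - card (pivot_rows g)" by simp
    then obtain L' R' where LR': "L' \<in> J" "R' \<in> J" "pivot_rows (L' * ?g * R') = {..<n}"
      using less.hyps[OF _ g'] by blast
    note m = J_mat[OF LR(1)] J_mat[OF LR(2)] J_mat[OF LR'(1)] J_mat[OF LR'(2)] gm
    have "L' * ?g * R' = (L' * L) * g * (R * R')"
      using m by (simp add: assoc_mult_mat[of _ n n _ n _ n])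
    then show ?thesis using LR' J_mult[OF LR'(1) LR(1)] J_mult[OF LR(2) LR'(2)] by metis
  qed
qed

lemma diagonal_J:
  assumes u: "\<And>i. i < n \<Longrightarrow> nrm (u i) = 1"
  shows "mat n n (\<lambda>(i, j). if i = j then u i else 0) \<in> J"
proof (rule J_I(1))
  let ?D = "\<lambda>u. mat n n (\<lambda>(i, j). if i = j then u i else 0)"
  show "?D u \<in> order_A nrm e f" "?D (\<lambda>i. inverse (u i)) \<in> order_A nrm e f"
    using u by (auto simp: order_A_def nrm_inverse)
  show "?D u * ?D (\<lambda>i. inverse (u i)) = 1\<^sub>m n"
  proof (rule eq_matI)
    fix i j assume ij: "i < dim_row (1\<^sub>m n)" "j < dim_col (1\<^sub>m n)"
    have u0: "u i \<noteq> 0" using u[of i] ij by auto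
    have "(?D u * ?D (\<lambda>i. inverse (u i))) $$ (i, j)
        = (\<Sum>l<n. ?D u $$ (i, l) * ?D (\<lambda>i. inverse (u i)) $$ (l, j))"
      using ij by (intro mult_mat_entry[of _ n n _ n]) auto
    also have "\<dots> = (\<Sum>l<n. if l = i then (if i = j then 1 else 0) else 0)"
      using ij u0 by (intro sum.cong) auto
    finally show "(?D u * ?D (\<lambda>i. inverse (u i))) $$ (i, j) = 1\<^sub>m n $$ (i, j)" using ij by simp
  qed auto
qed

text \<open>Gaussian elimination leaves a monomial matrix; a diagonal matrix of units, which belongs to
  \<open>J\<close>, turns its entries into powers of the uniformizer.\<close>

theorem affine_bruhat_decomposition:
  assumes g: "g \<in> carrier (GL n)"
  shows "\<exists>j1\<in>J. \<exists>j2\<in>J. \<exists>s c. bij_betw s {..<n} {..<n} \<and> j1 * g * j2 = monomial_mat n s c"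
proof -
  obtain L R where LR: "L \<in> J" "R \<in> J" "pivot_rows (L * g * R) = {..<n}"
    using reduce_to_pivots[OF g] by blast
  define h where "h = L * g * R"
  note gm = GL_carrier_mat[OF g] J_mat[OF LR(1)] J_mat[OF LR(2)]
  have hm: "h \<in> carrier_mat n n" using gm by (simp add: h_def)
  have "\<forall>i\<in>{..<n}. \<exists>j. pivot h i j" using LR(3) by (auto simp: h_def pivot_rows_def)
  then obtain s where s: "\<And>i. i < n \<Longrightarrow> pivot h i (s i)" by (metis lessThan_iff)
  have s_less: "s i < n" and h_nz: "h $$ (i, s i) \<noteq> 0"
    and h_0: "j < n \<Longrightarrow> j \<noteq> s i \<Longrightarrow> h $$ (i, j) = 0" if "i < n" for i j
    using s[OF that] by (auto simp: pivot_def)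
  have "inj_on s {..<n}"
  proof (rule inj_onI)
    fix i k assume ik: "i \<in> {..<n}" "k \<in> {..<n}" "s i = s k"
    then have "\<not> k \<noteq> i" using s[of i] h_nz[of k] unfolding pivot_def by (metis lessThan_iff)
    then show "i = k" by simp
  qed
  moreover have "s ` {..<n} \<subseteq> {..<n}" using s_less by auto
  ultimately have bij: "bij_betw s {..<n} {..<n}"
    using endo_inj_surj[of "{..<n}" s] by (auto simp: bij_betw_def)
  have "\<forall>i\<in>{..<n}. \<exists>k u. nrm u = 1 \<and> h $$ (i, s i) = unif powi k * u"
    using unit_decomposition h_nz by blast
  then obtain c u where "\<forall>i\<in>{..<n}. nrm (u i) = 1 \<and> h $$ (i, s i) = unif powi c i * u i"
    unfolding bchoice_iff by (elim exE)
  then have cu: "nrm (u i) = 1" "h $$ (i, s i) = unif powi c i * u i" if "i < n" for i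
    using that by simp_all
  let ?D = "mat n n (\<lambda>(i, j). if i = j then inverse (u i) else 0)"
  have D: "?D \<in> J" using cu by (intro diagonal_J) (simp add: nrm_inverse)
  have "?D * h = monomial_mat n s c"
  proof (rule eq_matI)
    fix i j assume "i < dim_row (monomial_mat n s c)" "j < dim_col (monomial_mat n s c)"
    then have ij: "i < n" "j < n" by (auto simp: monomial_mat_def)
    have u0: "u i \<noteq> 0" using cu(1)[OF ij(1)] by auto
    have "(?D * h) $$ (i, j) = (\<Sum>l<n. ?D $$ (i, l) * h $$ (l, j))"
      using ij hm by (intro mult_mat_entry[of _ n n _ n]) auto
    also have "\<dots> = (\<Sum>l<n. if l = i then inverse (u i) * h $$ (i, j) else 0)"
      using ij by (intro sum.cong) auto
    also have "\<dots> = monomial_mat n s c $$ (i, j)"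
      using ij u0 cu(2)[OF ij(1)] h_0[OF ij] by (simp add: monomial_mat_def)
    finally show "(?D * h) $$ (i, j) = monomial_mat n s c $$ (i, j)" .
  qed (use hm in \<open>auto simp: monomial_mat_def\<close>)
  moreover have "?D * h = (?D * L) * g * R"
    unfolding h_def using gm J_mat[OF D] by (simp add: assoc_mult_mat[of _ n n _ n _ n])
  ultimately have "(?D * L) * g * R = monomial_mat n s c" by simp
  then show ?thesis using bij J_mult[OF D LR(1)] LR(2) by (intro bexI exI conjI)
qed

end

section \<open>Cuspidality for unordered labellings\<close>

lemma unipotent_radical_GL:
  assumes b: "\<And>i. i < n \<Longrightarrow> b i \<le> 1" and u: "u \<in> unipotent_radical n b"
  shows "u \<in> carrier (GL n)"
proof -
  have um: "u \<in> carrier_mat n n" using u by (simp add: unipotent_radical_def)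
  let ?N = "u - 1\<^sub>m n"
  have N: "?N \<in> carrier_mat n n" using um by (intro minus_carrier_mat) simp
  have zero: "?N $$ (i, j) = 0" if "i < n" "j < n" "\<not> b i < b j" for i j
    using u that um by (simp add: unipotent_radical_def)
  have "(1\<^sub>m n + ?N) * (1\<^sub>m n - ?N) = 1\<^sub>m n"
  proof (rule square_zero_mat[OF N])
    fix i j k assume "i < n" "j < n" "k < n"
    then show "?N $$ (i, j) = 0 \<or> ?N $$ (j, k) = 0"
      using zero b[of k] by (metis less_le_trans less_one not_less_zero)
  qed
  moreover have "1\<^sub>m n + ?N = u" using um by auto
  moreover have "1\<^sub>m n - ?N \<in> carrier_mat n n" using N by (rule minus_carrier_mat)
  ultimately show ?thesis using GL_I(1)[OF um] by simp
qed

definition perm_mat :: "nat \<Rightarrow> (nat \<Rightarrow> nat) \<Rightarrow> 'a::field mat"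
  where "perm_mat n s = mat n n (\<lambda>(i, j). if j = s i then 1 else 0)"

lemma perm_mat_carrier [simp]: "perm_mat n s \<in> carrier_mat n n"
  by (simp add: perm_mat_def)

lemma perm_mat_mult:
  assumes A: "A \<in> carrier_mat n n" and s: "\<And>i. i < n \<Longrightarrow> s i < n" and ij: "i < n" "j < n"
  shows "(perm_mat n s * A) $$ (i, j) = A $$ (s i, j)"
proof -
  have "(perm_mat n s * A) $$ (i, j) = (\<Sum>l<n. if l = s i then A $$ (l, j) else 0)"
    using mult_mat_entry[OF perm_mat_carrier A ij, of s] ij
    by (simp add: perm_mat_def if_distrib[of "\<lambda>x. x * _"] cong: if_cong)
  then show ?thesis using s ij by simp
qed

lemma mult_perm_mat:
  assumes A: "A \<in> carrier_mat n n" and t: "\<And>i. i < n \<Longrightarrow> t i < n"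
    and inverse: "\<And>i. i < n \<Longrightarrow> t (s i) = i" "\<And>i. i < n \<Longrightarrow> s (t i) = i" and ij: "i < n" "j < n"
  shows "(A * perm_mat n s) $$ (i, j) = A $$ (i, t j)"
proof -
  have "j = s l \<longleftrightarrow> l = t j" if "l < n" for l using inverse that ij by metis
  then have "(\<Sum>l<n. A $$ (i, l) * perm_mat n s $$ (l, j)) = (\<Sum>l<n. if l = t j then A $$ (i, l) else 0)"
    using ij by (intro sum.cong) (auto simp: perm_mat_def)
  then show ?thesis using mult_mat_entry[OF A perm_mat_carrier ij, of s] t ij by simp
qed

lemma perm_mat_inverse:
  assumes st: "\<And>i. i < n \<Longrightarrow> s i < n" "\<And>i. i < n \<Longrightarrow> t (s i) = i"
  shows "perm_mat n s * perm_mat n t = (1\<^sub>m n :: 'a::field mat)"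
proof (rule eq_matI)
  fix i j assume "i < dim_row (1\<^sub>m n :: 'a mat)" "j < dim_col (1\<^sub>m n :: 'a mat)"
  then have ij: "i < n" "j < n" by auto
  have "(perm_mat n s * perm_mat n t) $$ (i, j) = (perm_mat n t :: 'a mat) $$ (s i, j)"
    by (rule perm_mat_mult[OF perm_mat_carrier st(1) ij])
  also have "\<dots> = 1\<^sub>m n $$ (i, j)" using st[OF ij(1)] ij by (auto simp: perm_mat_def)
  finally show "(perm_mat n s * perm_mat n t) $$ (i, j) = (1\<^sub>m n :: 'a mat) $$ (i, j)" .
qed (auto simp: perm_mat_def)

lemma sorting_permutation:
  fixes b :: "nat \<Rightarrow> nat"
  shows "\<exists>p q. (\<forall>i<n. p i < n \<and> q i < n \<and> q (p i) = i \<and> p (q i) = i) \<and>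
    (\<forall>i j. i \<le> j \<longrightarrow> j < n \<longrightarrow> b (p i) \<le> b (p j))"
proof -
  define xs where "xs = sort_key b [0..<n]"
  have xs: "length xs = n" "distinct xs" "set xs = {..<n}" "sorted (map b xs)"
    unfolding xs_def by (simp_all add: atLeast0LessThan)
  have "bij_betw ((!) xs) {..<length xs} (set xs)" using xs(2) by (rule bij_betw_nth) simp_all
  then have bij: "bij_betw (\<lambda>i. xs ! i) {..<n} {..<n}" using xs(1,3) by simp
  let ?q = "inv_into {..<n} (\<lambda>i. xs ! i)"
  have mono: "b (xs ! i) \<le> b (xs ! j)" if "i \<le> j" "j < n" for i j
    using sorted_nth_mono[OF xs(4), of i j] that xs(1) by simp
  have A: "\<forall>i<n. xs ! i < n \<and> ?q i < n \<and> ?q (xs ! i) = i \<and> xs ! (?q i) = i"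
    using bij_betwE[OF bij] bij_betwE[OF bij_betw_inv_into[OF bij]]
      bij_betw_inv_into_left[OF bij] bij_betw_inv_into_right[OF bij] by simp
  have M: "\<forall>i j. i \<le> j \<longrightarrow> j < n \<longrightarrow> b (xs ! i) \<le> b (xs ! j)" using mono by simp
  show ?thesis by (rule exI[of _ "\<lambda>i. xs ! i"], rule exI[of _ ?q], rule conjI[OF A M])
qed

text \<open>Cuspidality is formulated with standard parabolic subgroups; conjugation by a permutation
  matrix extends it to unipotent radicals of arbitrary two-step labellings.\<close>

lemma cuspidal_labelling:
  fixes \<sigma> :: "'k::field mat \<Rightarrow> 'x::complex_vector \<Rightarrow> 'x"
  assumes cusp: "cuspidal_rep n X \<sigma>" and rep: "representation (GL n) X \<sigma>"
    and b: "\<And>i. i < n \<Longrightarrow> b i \<le> 1" and ne: "\<exists>i<n. \<exists>j<n. b i \<noteq> b j"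
    and x: "x \<in> X" and fixed: "\<And>u. u \<in> unipotent_radical n b \<Longrightarrow> \<sigma> u x = x"
  shows "x = 0"
proof -
  obtain p q where pq': "\<forall>i<n. p i < n \<and> q i < n \<and> q (p i) = i \<and> p (q i) = i"
    and mono: "\<forall>i j. i \<le> j \<longrightarrow> j < n \<longrightarrow> b (p i) \<le> b (p j)"
    using sorting_permutation[of n b] by (elim exE conjE)
  have p: "p i < n" and q: "q i < n" and qp: "q (p i) = i" and pq: "p (q i) = i" if "i < n" for i
    using pq' that by simp_all
  define P Q where "P = (perm_mat n q :: 'k mat)" and "Q = (perm_mat n p :: 'k mat)"
  have c: "P \<in> carrier_mat n n" "Q \<in> carrier_mat n n" by (simp_all add: P_def Q_def)
  have PQ: "P * Q = 1\<^sub>m n" "Q * P = 1\<^sub>m n"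
    unfolding P_def Q_def by (rule perm_mat_inverse; use p q pq qp in blast)+
  have GL: "P \<in> carrier (GL n)" "Q \<in> carrier (GL n)" using GL_I[OF c PQ(1)] .
  have mult: "\<sigma> (g * h) v = \<sigma> g (\<sigma> h v)" if "g \<in> carrier (GL n)" "h \<in> carrier (GL n)" "v \<in> X" for g h v
    using rep that by (simp add: representation_def)
  have inX: "\<sigma> g v \<in> X" if "g \<in> carrier (GL n)" "v \<in> X" for g v
    using rep that by (simp add: representation_def linear_on_def)
  have one: "\<sigma> (1\<^sub>m n) v = v" if "v \<in> X" for v using rep that by (simp add: representation_def)
  have "\<sigma> u (\<sigma> Q x) = \<sigma> Q x" if u: "u \<in> unipotent_radical n (b \<circ> p)" for u
  proof -
    have uGL: "u \<in> carrier (GL n)" using u b p by (intro unipotent_radical_GL[of n "b \<circ> p"]) auto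
    note um = GL_carrier_mat[OF uGL]
    define v where "v = P * u * Q"
    have Pu: "P * u \<in> carrier_mat n n" using c um by (intro mult_carrier_mat[of _ n n])
    have v_at: "v $$ (i, j) = u $$ (q i, q j)" if "i < n" "j < n" for i j
      unfolding v_def Q_def
    proof -
      have "(P * u * perm_mat n p) $$ (i, j) = (P * u) $$ (i, q j)"
        by (rule mult_perm_mat[OF Pu]) (use q qp pq that in auto)
      also have "\<dots> = u $$ (q i, q j)"
        unfolding P_def by (rule perm_mat_mult[OF um]) (use q that in auto)
      finally show "(P * u * perm_mat n p) $$ (i, j) = u $$ (q i, q j)" .
    qed
    have vm: "v \<in> carrier_mat n n" unfolding v_def by (rule mult_carrier_mat[OF Pu c(2)])
    have "v \<in> unipotent_radical n b"
      unfolding unipotent_radical_def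
    proof (intro CollectI conjI allI impI vm)
      fix i j assume ij: "i < n" "j < n" "\<not> b i < b j"
      then have "u $$ (q i, q j) = 1\<^sub>m n $$ (q i, q j)"
        using u q pq by (simp add: unipotent_radical_def)
      also have "\<dots> = 1\<^sub>m n $$ (i, j)" using q pq ij by (auto, metis)
      finally show "v $$ (i, j) = 1\<^sub>m n $$ (i, j)" using v_at ij by simp
    qed
    then have fx: "\<sigma> v x = x" and vGL: "v \<in> carrier (GL n)"
      using fixed[of v] unipotent_radical_GL[of n b v] b by simp_all
    have uQ: "u * Q \<in> carrier_mat n n" using um c by (intro mult_carrier_mat[of _ n n])
    have "v = P * (u * Q)" unfolding v_def using c um by (intro assoc_mult_mat)
    then have "Q * v = Q * P * (u * Q)" using assoc_mult_mat[OF c(2,1) uQ] by simp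
    also have "\<dots> = u * Q"
      unfolding PQ using uQ by (rule left_mult_one_mat)
    finally have "\<sigma> u (\<sigma> Q x) = \<sigma> (Q * v) x" using mult uGL GL x by simp
    also have "\<dots> = \<sigma> Q x" using mult GL vGL x fx by simp
    finally show ?thesis .
  qed
  moreover have "\<forall>i<n. \<forall>j<n. i \<le> j \<longrightarrow> (b \<circ> p) i \<le> (b \<circ> p) j" using mono by simp
  moreover have "\<exists>i<n. \<exists>j<n. (b \<circ> p) i \<noteq> (b \<circ> p) j"
  proof -
    obtain i j where "i < n" "j < n" "b i \<noteq> b j" using ne by blast
    then show ?thesis using q pq by (intro exI[of _ "q i"] conjI exI[of _ "q j"]) auto
  qed
  ultimately have "\<sigma> Q x = 0"
    using cusp inX[OF GL(2) x] unfolding cuspidal_rep_def by blast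
  then have "\<sigma> P (\<sigma> Q x) = \<sigma> P (0 *\<^sub>C \<sigma> Q x)" by simp
  also have "\<dots> = 0 *\<^sub>C \<sigma> P (\<sigma> Q x)"
    using rep GL inX[OF GL(2) x] unfolding representation_def linear_on_def by blast
  finally have "\<sigma> P (\<sigma> Q x) = 0" by simp
  then show ?thesis using mult[OF GL x] PQ one[OF x] by simp
qed

section \<open>Tensor powers\<close>

lemma tensor_power_subspace: "complex_vector.subspace (tensor_power e X)"
  by (simp add: tensor_power_def)

lemma tensor_power_induct [consumes 1, case_names pure subspace]:
  assumes t: "t \<in> tensor_power e X"
    and "\<And>x. (\<And>i. i < e \<Longrightarrow> x i \<in> X) \<Longrightarrow> P (pure_tensor e X x)"
    and "complex_vector.subspace (Collect P)"
  shows "P t"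
  using t unfolding tensor_power_def
  by (rule complex_vector.span_induct[of _ _ P]) (use assms in auto)

lemma pure_tensor_in: "(\<And>i. i < e \<Longrightarrow> x i \<in> X) \<Longrightarrow> pure_tensor e X x \<in> tensor_power e X"
  unfolding tensor_power_def by (rule complex_vector.span_base) blast

lemma pure_tensor_cong: "(\<And>i. i < e \<Longrightarrow> x i = y i) \<Longrightarrow> pure_tensor e X x = pure_tensor e X y"
  unfolding pure_tensor_def fun_eq_iff by (auto intro!: prod.cong)

lemma tensor_power_cong:
  assumes "t \<in> tensor_power e X" "\<And>i. i < e \<Longrightarrow> l i = l' i"
  shows "t l = t l'"
  using assms(1)
proof (induction rule: tensor_power_induct)
  case (pure x)
  then show ?case using assms(2) by (auto simp: pure_tensor_def intro!: prod.cong)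
qed (auto simp: complex_vector.subspace_def scaleC_fun_def)

lemma tensor_power_outside:
  assumes "t \<in> tensor_power e X" "i < e" "l i \<notin> lin_dual X"
  shows "t l = 0"
  using assms(1)
proof (induction rule: tensor_power_induct)
  case (pure x)
  then show ?case using assms(2,3) by (auto simp: pure_tensor_def)
qed (auto simp: complex_vector.subspace_def scaleC_fun_def)

text \<open>Contracting all slots but one leaves a vector of \<open>X\<close>.\<close>

lemma tensor_power_slice:
  assumes X: "complex_vector.subspace X" and t: "t \<in> tensor_power e X"
    and B: "B < e" and l: "\<And>i. i < e \<Longrightarrow> l i \<in> lin_dual X"
  shows "\<exists>x\<in>X. \<forall>m\<in>lin_dual X. t (l(B := m)) = m x"
  using t
proof (induction rule: tensor_power_induct)
  case (pure x)
  let ?c = "\<Prod>i\<in>{..<e} - {B}. l i (x i)"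
  have "pure_tensor e X x (l(B := m)) = m (?c *\<^sub>C x B)" if m: "m \<in> lin_dual X" for m
  proof -
    have upd: "\<forall>i<e. (l(B := m)) i \<in> lin_dual X" using m l by simp
    have "pure_tensor e X x (l(B := m)) = (\<Prod>i<e. (l(B := m)) i (x i))"
      unfolding pure_tensor_def by (rule if_P[OF upd])
    also have "\<dots> = m (x B) * (\<Prod>i\<in>{..<e} - {B}. (l(B := m)) i (x i))"
      using B by (subst prod.remove[of _ B]) auto
    also have "(\<Prod>i\<in>{..<e} - {B}. (l(B := m)) i (x i)) = ?c" by (rule prod.cong) auto
    also have "m (x B) * ?c = m (?c *\<^sub>C x B)"
      using m pure[OF B] by (simp add: hom_space_def linear_on_def scaleC_complex_def)
    finally show ?thesis .
  qed
  moreover have "?c *\<^sub>C x B \<in> X" using complex_vector.subspace_scale[OF X pure[OF B]] .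
  ultimately show ?case by blast
next
  case subspace
  show ?case unfolding complex_vector.subspace_def mem_Collect_eq
  proof (intro conjI allI ballI)
    have "m 0 = 0" if "m \<in> lin_dual X" for m
    proof -
      have "m (0 *\<^sub>C 0) = 0 *\<^sub>C m 0"
        using that complex_vector.subspace_0[OF X] unfolding hom_space_def linear_on_def by blast
      then show ?thesis by simp
    qed
    then show "\<exists>x\<in>X. \<forall>m\<in>lin_dual X. 0 (l(B := m)) = m x"
      using complex_vector.subspace_0[OF X] by (intro bexI[of _ 0]) auto
  next
    fix s t assume "s \<in> {t. \<exists>x\<in>X. \<forall>m\<in>lin_dual X. t (l(B := m)) = m x}"
      "t \<in> {t. \<exists>x\<in>X. \<forall>m\<in>lin_dual X. t (l(B := m)) = m x}"
    then obtain x y where xy: "x \<in> X" "\<forall>m\<in>lin_dual X. s (l(B := m)) = m x"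
      "y \<in> X" "\<forall>m\<in>lin_dual X. t (l(B := m)) = m y" by blast
    have "(s + t) (l(B := m)) = m (x + y)" if m: "m \<in> lin_dual X" for m
      using m xy by (simp add: hom_space_def linear_on_def)
    then show "\<exists>x\<in>X. \<forall>m\<in>lin_dual X. (s + t) (l(B := m)) = m x"
      using complex_vector.subspace_add[OF X xy(1,3)] by blast
  next
    fix c t assume "t \<in> {t. \<exists>x\<in>X. \<forall>m\<in>lin_dual X. t (l(B := m)) = m x}"
    then obtain x where x: "x \<in> X" "\<forall>m\<in>lin_dual X. t (l(B := m)) = m x" by blast
    have "(c *\<^sub>C t) (l(B := m)) = m (c *\<^sub>C x)" if m: "m \<in> lin_dual X" for m
      using m x by (simp add: hom_space_def linear_on_def scaleC_fun_def)
    then show "\<exists>x\<in>X. \<forall>m\<in>lin_dual X. (c *\<^sub>C t) (l(B := m)) = m x"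
      using complex_vector.subspace_scale[OF X x(1)] by blast
  qed
qed

text \<open>Contraction of the slots other than \<open>B\<close> commutes with operators acting in slot \<open>B\<close>. So an
  invariant tensor contracts to invariant vectors of \<open>X\<close>, which are all zero, and a tensor is
  determined by its contractions.\<close>

lemma tensor_slot_invariants:
  assumes X: "complex_vector.subspace X" and t: "t \<in> tensor_power e X" and B: "B < e"
    and lin: "\<And>a. a \<in> S \<Longrightarrow> linear_on X X (F a B)"
    and other: "\<And>a i x. a \<in> S \<Longrightarrow> i < e \<Longrightarrow> i \<noteq> B \<Longrightarrow> x \<in> X \<Longrightarrow> F a i x = x"
    and fixed: "\<And>a. a \<in> S \<Longrightarrow> tensor_map e X (F a) t = t"
    and zero: "\<And>x. x \<in> X \<Longrightarrow> (\<And>a. a \<in> S \<Longrightarrow> F a B x = x) \<Longrightarrow> x = 0"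
  shows "t = 0"
proof
  fix l :: "nat \<Rightarrow> 'a \<Rightarrow> complex"
  show "t l = 0 l"
  proof (cases "\<forall>i<e. l i \<in> lin_dual X")
    case True
    then have l: "\<And>i. i < e \<Longrightarrow> l i \<in> lin_dual X" by blast
    obtain x where x: "x \<in> X" "\<And>m. m \<in> lin_dual X \<Longrightarrow> t (l(B := m)) = m x"
      using tensor_power_slice[OF X t B, of l] l by blast
    have "x = 0"
    proof (rule zero[OF x(1)])
      fix a assume a: "a \<in> S"
      have Fx: "F a B x \<in> X" using lin[OF a] x(1) by (simp add: linear_on_def)
      have eq: "m (F a B x) = m x" if m: "m \<in> lin_dual X" for m
      proof -
        define m' where "m' = (\<lambda>y. if y \<in> X then m (F a B y) else 0)"
        have m': "m' \<in> lin_dual X"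
          using m lin[OF a] X by (auto simp: hom_space_def linear_on_def m'_def
              complex_vector.subspace_add complex_vector.subspace_scale)
        have upd: "\<forall>i<e. (l(B := m)) i \<in> lin_dual X" using m l by simp
        have "t (l(B := m)) = tensor_map e X (F a) t (l(B := m))" using fixed[OF a] by simp
        also have "\<dots> = t (\<lambda>i y. if y \<in> X then (l(B := m)) i (F a i y) else 0)"
          unfolding tensor_map_def by (rule if_P[OF upd])
        also have "\<dots> = t (l(B := m'))"
        proof (rule tensor_power_cong[OF t])
          fix i assume i: "i < e"
          show "(\<lambda>y. if y \<in> X then (l(B := m)) i (F a i y) else 0) = (l(B := m')) i"
          proof (cases "i = B")
            case False
            have "l i y = 0" if "y \<notin> X" for y using l[OF i] that by (simp add: hom_space_def)
            then show ?thesis using False other[OF a i] by (auto simp: fun_eq_iff)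
          next
            case True
            then show ?thesis by (simp add: m'_def fun_eq_iff)
          qed
        qed
        finally show ?thesis using x(2)[OF m] x(2)[OF m'] x(1) by (simp add: m'_def)
      qed
      show "F a B x = x"
      proof (rule ccontr)
        assume "F a B x \<noteq> x"
        then have "F a B x - x \<in> X" "F a B x - x \<noteq> 0"
          using complex_vector.subspace_diff[OF X Fx x(1)] by auto
        then obtain m where m: "m \<in> lin_dual X" "m (F a B x - x) \<noteq> 0"
          using hom_space_separates[OF X] by blast
        have "m (F a B x) = m ((F a B x - x) + x)" by simp
        also have "\<dots> = m (F a B x - x) + m x"
          using m(1) \<open>F a B x - x \<in> X\<close> x(1) unfolding hom_space_def linear_on_def by blast
        finally show False using eq[OF m(1)] m(2) by simp
      qed
    qed
    have "t l = t (l(B := l B))" by simp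
    also have "\<dots> = l B 0" using x(2)[OF l[OF B]] \<open>x = 0\<close> by simp
    finally have "t l = l B 0" .
    moreover have "l B (0 *\<^sub>C 0) = 0 *\<^sub>C l B 0"
      using l[OF B] complex_vector.subspace_0[OF X] unfolding hom_space_def linear_on_def by blast
    ultimately show ?thesis by simp
  next
    case False
    then show ?thesis using tensor_power_outside[OF t] by auto
  qed
qed

lemma tensor_map_linear:
  "tensor_map e X A (s + t) = tensor_map e X A s + tensor_map e X A t"
  "tensor_map e X A (c *\<^sub>C t) = c *\<^sub>C tensor_map e X A t"
  "tensor_map e X A 0 = 0"
  by (auto simp: tensor_map_def fun_eq_iff scaleC_fun_def)

lemma tensor_map_in:
  assumes X: "complex_vector.subspace X" and A: "\<And>i. i < e \<Longrightarrow> linear_on X X (A i)"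
    and t: "t \<in> tensor_power e X"
  shows "tensor_map e X A t \<in> tensor_power e X"
  using t
proof (induction rule: tensor_power_induct)
  case (pure x)
  have "A i (x i) \<in> X" if "i < e" for i using A[OF that] pure[OF that] by (simp add: linear_on_def)
  then show ?case using tensor_map_pure_tensor[OF A X pure] by (simp add: pure_tensor_in)
next
  case subspace
  show ?case using tensor_power_subspace[of e X]
    by (simp add: complex_vector.subspace_def tensor_map_linear del: zero_fun_apply)
qed

lemma tensor_map_comp:
  assumes X: "complex_vector.subspace X"
    and A: "\<And>i. i < e \<Longrightarrow> linear_on X X (A i)" and B: "\<And>i. i < e \<Longrightarrow> linear_on X X (B i)"
    and C: "\<And>i x. i < e \<Longrightarrow> x \<in> X \<Longrightarrow> C i x = A i (B i x)"
    and t: "t \<in> tensor_power e X"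
  shows "tensor_map e X C t = tensor_map e X A (tensor_map e X B t)"
  using t
proof (induction rule: tensor_power_induct)
  case (pure x)
  have BX: "B i (x i) \<in> X" if "i < e" for i using B[OF that] pure[OF that] by (simp add: linear_on_def)
  have lin: "linear_on X X (C i)" if "i < e" for i
    using A[OF that] B[OF that] C[OF that] X unfolding linear_on_def
    by (simp add: complex_vector.subspace_add complex_vector.subspace_scale)
  show ?case
    using tensor_map_pure_tensor[OF lin X pure] tensor_map_pure_tensor[OF B X pure]
      tensor_map_pure_tensor[OF A X BX] C pure by (simp cong: pure_tensor_cong)
qed (simp add: complex_vector.subspace_def tensor_map_linear del: zero_fun_apply)

lemma tensor_map_id:
  assumes X: "complex_vector.subspace X" and A: "\<And>i x. i < e \<Longrightarrow> x \<in> X \<Longrightarrow> A i x = x"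
    and t: "t \<in> tensor_power e X"
  shows "tensor_map e X A t = t"
  using t
proof (induction rule: tensor_power_induct)
  case (pure x)
  have lin: "linear_on X X (A i)" if "i < e" for i
    using A[OF that] X unfolding linear_on_def
    by (simp add: complex_vector.subspace_add complex_vector.subspace_scale)
  show ?case using tensor_map_pure_tensor[OF lin X pure] A pure by (simp cong: pure_tensor_cong)
qed (simp add: complex_vector.subspace_def tensor_map_linear del: zero_fun_apply)

section \<open>Reduction of the diagonal blocks\<close>

context parahoric
begin

lemma block_index:
  assumes "i < e" "a < f"
  shows "i * f + a < n" "(i * f + a) div f = i" "(i * f + a) mod f = a"
proof -
  have "i * f + a < (i + 1) * f" using assms by simp
  also have "\<dots> \<le> n" using assms by (intro mult_right_mono) auto
  finally show "i * f + a < n" .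
qed (use assms in simp_all)

lemma block_of:
  assumes "l < n"
  shows "l div f < e" "l mod f < f" "l div f * f + l mod f = l"
proof -
  have "f > 0" using assms by (cases f) auto
  then show "l div f < e" "l mod f < f" "l div f * f + l mod f = l"
    using assms by (simp_all add: less_mult_imp_div_less)
qed

definition red_block :: "'F mat \<Rightarrow> nat \<Rightarrow> 'k mat"
  where "red_block A i = map_mat red (mat_block f A i i)"

lemma red_block_carrier [simp]: "red_block A i \<in> carrier_mat f f"
  by (simp add: red_block_def mat_block_def)

lemma red_block_at:
  "a < f \<Longrightarrow> b < f \<Longrightarrow> red_block A i $$ (a, b) = red (A $$ (i * f + a, i * f + b))"
  by (simp add: red_block_def mat_block_def)

text \<open>A cross term between two different blocks has a factor below the block diagonal, and that factor
  lies in the maximal ideal.\<close>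

lemma red_block_mult:
  assumes A: "A \<in> J" and B: "B \<in> J" and i: "i < e"
  shows "red_block (A * B) i = red_block A i * red_block B i"
proof (rule eq_matI)
  fix a b assume "a < dim_row (red_block A i * red_block B i)" "b < dim_col (red_block A i * red_block B i)"
  then have ab: "a < f" "b < f" by (auto simp: red_block_def mat_block_def)
  note r = block_index[OF i ab(1)] and c = block_index[OF i ab(2)]
  let ?r = "i * f + a" and ?c = "i * f + b"
  have le: "nrm (A $$ (?r, l)) \<le> 1" "nrm (B $$ (l, ?c)) \<le> 1" if "l < n" for l
    using order_A_le[OF J_ord[OF A] r(1) that] order_A_le[OF J_ord[OF B] that c(1)] by auto
  have zero: "red (A $$ (?r, l)) * red (B $$ (l, ?c)) = 0" if l: "l < n" "l div f \<noteq> i" for l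
  proof -
    have "nrm (A $$ (?r, l)) < 1 \<or> nrm (B $$ (l, ?c)) < 1"
      using order_A_less[OF J_ord[OF A] r(1) l(1)] order_A_less[OF J_ord[OF B] l(1) c(1)] r(2) c(2) l(2)
      by linarith
    then show ?thesis using red_kernel le[OF l(1)] by auto
  qed
  have "red ((A * B) $$ (?r, ?c)) = red (\<Sum>l<n. A $$ (?r, l) * B $$ (l, ?c))"
    using mult_mat_entry[OF J_mat[OF A] J_mat[OF B] r(1) c(1)] by simp
  also have "\<dots> = (\<Sum>l<n. red (A $$ (?r, l)) * red (B $$ (l, ?c)))"
    by (subst red_sum) (use le in \<open>auto intro!: sum.cong nrm_mult_le_1 red_mult\<close>)
  also have "\<dots> = (\<Sum>l\<in>(\<lambda>l. i * f + l) ` {..<f}. red (A $$ (?r, l)) * red (B $$ (l, ?c)))"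
  proof (rule sum.mono_neutral_right)
    show "(\<lambda>l. i * f + l) ` {..<f} \<subseteq> {..<n}" using block_index(1)[OF i] by auto
    show "\<forall>l\<in>{..<n} - (\<lambda>l. i * f + l) ` {..<f}. red (A $$ (?r, l)) * red (B $$ (l, ?c)) = 0"
    proof
      fix l assume l: "l \<in> {..<n} - (\<lambda>l. i * f + l) ` {..<f}"
      then have "l div f \<noteq> i" using block_of[of l] by force
      then show "red (A $$ (?r, l)) * red (B $$ (l, ?c)) = 0" using zero l by auto
    qed
  qed simp
  also have "\<dots> = (\<Sum>l<f. red_block A i $$ (a, l) * red_block B i $$ (l, b))"
    by (subst sum.reindex) (auto simp: red_block_at ab inj_on_def)
  also have "\<dots> = (red_block A i * red_block B i) $$ (a, b)"
    using mult_mat_entry[OF red_block_carrier red_block_carrier ab] by metis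
  finally show "red_block (A * B) i $$ (a, b) = (red_block A i * red_block B i) $$ (a, b)"
    by (simp add: red_block_at ab)
qed (auto simp: red_block_def mat_block_def)

lemma red_block_eq_one:
  assumes A: "A \<in> carrier_mat n n" and i: "i < e"
    and near: "\<And>k l. k < n \<Longrightarrow> l < n \<Longrightarrow> k div f = i \<Longrightarrow> l div f = i \<Longrightarrow> red (A $$ (k, l)) = (if k = l then 1 else 0)"
  shows "red_block A i = 1\<^sub>m f"
  by (rule eq_matI) (use near block_index[OF i] in \<open>auto simp: red_block_at\<close>, simp_all add: red_block_def mat_block_def)

lemma red_block_one: "i < e \<Longrightarrow> red_block (1\<^sub>m n) i = 1\<^sub>m f"
  by (rule red_block_eq_one) (auto simp: red_one)

lemma red_block_GL:
  assumes A: "A \<in> J" and i: "i < e"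
  shows "red_block A i \<in> carrier (GL f)"
proof -
  obtain B where B: "B \<in> J" "A * B = 1\<^sub>m n" using A by (rule J_E)
  have "red_block A i * red_block B i = 1\<^sub>m f"
    using red_block_mult[OF A B(1) i] B(2) red_block_one[OF i] by simp
  then show ?thesis using GL_I(1) red_block_carrier by blast
qed

lemma type_rep_eq:
  "type_rep red e f X0 lam0 A = tensor_map e X0 (\<lambda>i. lam0 (red_block A i))"
  by (simp add: type_rep_def red_block_def)

end

section \<open>The cuspidal type\<close>

locale cuspidal_type = parahoric nrm unif red e f
  for nrm :: "'F::field \<Rightarrow> real" and unif :: 'F and red :: "'F \<Rightarrow> 'k::field" and e f +
  fixes X0 :: "'x::complex_vector set" and lam0 :: "'k mat \<Rightarrow> 'x \<Rightarrow> 'x"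
  assumes lam0_rep: "representation (GL f) X0 lam0"
    and lam0_cuspidal: "cuspidal_rep f X0 lam0"
begin

abbreviation "W \<equiv> tensor_power e X0"
abbreviation "lam \<equiv> type_rep red e f X0 lam0"

lemma X0_subspace: "complex_vector.subspace X0"
  and lam0_linear: "u \<in> carrier (GL f) \<Longrightarrow> linear_on X0 X0 (lam0 u)"
  and lam0_one: "x \<in> X0 \<Longrightarrow> lam0 (1\<^sub>m f) x = x"
  and lam0_mult: "u \<in> carrier (GL f) \<Longrightarrow> v \<in> carrier (GL f) \<Longrightarrow> x \<in> X0 \<Longrightarrow> lam0 (u * v) x = lam0 u (lam0 v x)"
  using lam0_rep by (auto simp: representation_def)

lemma lam_trivial:
  assumes "\<And>i. i < e \<Longrightarrow> red_block A i = 1\<^sub>m f" "w \<in> W"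
  shows "lam A w = w"
  unfolding type_rep_eq
  by (rule tensor_map_id[OF X0_subspace _ assms(2)]) (simp add: assms(1) lam0_one)

lemma lam_representation: "representation ((GL n)\<lparr>carrier := J\<rparr>) W lam"
  unfolding representation_def
proof (intro conjI ballI)
  show "complex_vector.subspace W" by (rule tensor_power_subspace)
  fix A assume "A \<in> carrier ((GL n)\<lparr>carrier := J\<rparr>)"
  then have A: "A \<in> J" by simp
  note lin = lam0_linear[OF red_block_GL[OF A]]
  show "linear_on W W (lam A)"
    unfolding linear_on_def type_rep_eq
    using tensor_map_in[OF X0_subspace lin] by (simp add: tensor_map_linear)
  fix B w assume "B \<in> carrier ((GL n)\<lparr>carrier := J\<rparr>)" and w: "w \<in> W"
  then have B: "B \<in> J" by simp
  show "lam (A \<otimes>\<^bsub>(GL n)\<lparr>carrier := J\<rparr>\<^esub> B) w = lam A (lam B w)"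
    unfolding type_rep_eq
    by (rule tensor_map_comp[OF X0_subspace lin lam0_linear[OF red_block_GL[OF B]] _ w])
       (simp_all add: red_block_mult[OF A B] lam0_mult red_block_GL A B)
next
  fix w assume "w \<in> W"
  then show "lam \<one>\<^bsub>(GL n)\<lparr>carrier := J\<rparr>\<^esub> w = w"
    using lam_trivial[of "1\<^sub>m n" w] by (simp add: red_block_one)
qed

lemma lam_smooth:
  "\<exists>U. openin (GL_topology nrm n) U \<and> \<one>\<^bsub>GL n\<^esub> \<in> U \<and> U \<subseteq> J \<and> (\<forall>A\<in>U. \<forall>w\<in>W. lam A w = w)"
proof -
  define U where "U = {A \<in> carrier (GL n).
    \<forall>i<n. \<forall>j<n. nrm (A $$ (i, j) - 1\<^sub>m n $$ (i, j)) < 1}"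
  have U: "A \<in> carrier (GL n)" "i < n \<Longrightarrow> j < n \<Longrightarrow> nrm (A $$ (i, j) - 1\<^sub>m n $$ (i, j)) < 1"
    if "A \<in> U" for A i j using that by (simp_all only: U_def mem_Collect_eq)
  have U_J: "A \<in> J" if "A \<in> U" for A
    using near_one_J[OF GL_carrier_mat[OF U(1)[OF that]] U(2)[OF that]] .
  have "openin (GL_topology nrm n) U"
    unfolding openin_GL_topology
  proof (intro conjI ballI)
    fix A assume A: "A \<in> U"
    show "\<exists>\<epsilon>>0. \<forall>B\<in>carrier (GL n). (\<forall>i<n. \<forall>j<n. nrm (B $$ (i, j) - A $$ (i, j)) < \<epsilon>) \<longrightarrow> B \<in> U"
    proof (intro exI[of _ 1] conjI ballI impI)
      fix B assume B: "B \<in> carrier (GL n)" and near: "\<forall>i<n. \<forall>j<n. nrm (B $$ (i, j) - A $$ (i, j)) < 1"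
      have "nrm (B $$ (i, j) - 1\<^sub>m n $$ (i, j)) < 1" if ij: "i < n" "j < n" for i j
        using ultrametric[of "B $$ (i, j) - A $$ (i, j)" "A $$ (i, j) - 1\<^sub>m n $$ (i, j)"]
          near ij U(2)[OF A ij] by fastforce
      then show "B \<in> U" using B unfolding U_def by blast
    qed simp
  qed (auto simp: U_def)
  moreover have "1\<^sub>m n \<in> U" using J_carrier[OF J_I(1)[OF order_A_one order_A_one]] by (simp add: U_def)
  moreover have "lam A w = w" if A: "A \<in> U" and w: "w \<in> W" for A w
  proof (rule lam_trivial[OF red_block_eq_one w])
    show "A \<in> carrier_mat n n" using GL_carrier_mat U(1)[OF A] by blast
    fix k l assume kl: "k < n" "l < n"
    have "red (A $$ (k, l)) = red (1\<^sub>m n $$ (k, l))"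
      using order_A_le[OF J_ord[OF U_J[OF A]] kl] U(2)[OF A kl] by (rule red_cong)
    then show "red (A $$ (k, l)) = (if k = l then 1 else 0)" using kl by (simp add: red_one)
  qed
  ultimately show ?thesis using U_J by (intro exI[of _ U]) auto
qed

sublocale ind: compact_open_rep "GL n" "GL_topology nrm n" J W lam
proof -
  show "compact_open_rep (GL n) (GL_topology nrm n) J W lam"
  proof (intro compact_open_rep.intro compact_open_rep_axioms.intro)
    show "group (GL n :: 'F mat monoid)" by (rule GL_group)
    show "topspace (GL_topology nrm n) = carrier (GL n)" by (rule topspace_GL_topology)
    fix g :: "'F mat" assume "g \<in> carrier (GL n)"
    then show "continuous_map (GL_topology nrm n) (GL_topology nrm n) (\<lambda>x. g \<otimes>\<^bsub>GL n\<^esub> x)"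
      "continuous_map (GL_topology nrm n) (GL_topology nrm n) (\<lambda>x. x \<otimes>\<^bsub>GL n\<^esub> g)"
      using translation_continuous[of g n] by simp_all
  qed (rule J_subgroup J_open J_compact lam_representation lam_smooth)+
qed

section \<open>Support of intertwining functions\<close>

text \<open>Conjugation by the inverse of the monomial matrix carries the matrix unit in position \<open>(i, j)\<close> to
  a multiple of another one, and it carries the integral root subgroup at \<open>(i, j)\<close> into the kernel of
  \<open>\<lambda>\<close> as soon as \<open>\<beta> i < \<beta> j\<close>, where \<open>\<beta> i = e c\<^sub>i + s(i) div f\<close> compares the exponents first and then
  the target blocks. If \<open>\<beta>\<close> were not constant on a block, the unipotent radical of a proper
  parabolic subgroup of this block would fix the image of \<open>\<Psi>(m)\<close>, contrary to cuspidality. The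
  inequality is stated in one direction; exchanging the indices gives equality.\<close>

lemma intertwining_monomial:
  assumes Psi: "\<Psi> \<in> hecke_bar (GL n) J W lam"
    and s: "bij_betw s {..<n} {..<n}" and m: "monomial_mat n s c \<in> carrier (GL n)"
    and v: "v \<in> W" and nz: "\<Psi> (monomial_mat n s c) v \<noteq> 0"
    and ij: "i0 < n" "j0 < n" "i0 div f = j0 div f"
  shows "int e * c j0 + int (s j0 div f) \<le> int e * c i0 + int (s i0 div f)"
proof (rule ccontr)
  define \<beta> where "\<beta> i = int e * c i + int (s i div f)" for i
  assume "\<not> ?thesis"
  then have lt: "\<beta> i0 < \<beta> j0" by (simp add: \<beta>_def)
  let ?m = "monomial_mat n s c"
  define t where "t = inv_into {..<n} s"
  have s_less: "s i < n" and t_less: "t i < n" and ts: "t (s i) = i" and st: "s (t i) = i" if "i < n" for i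
    using that bij_betwE[OF s] bij_betwE[OF bij_betw_inv_into[OF s]]
      bij_betw_inv_into_left[OF s] bij_betw_inv_into_right[OF s] by (simp_all add: t_def)
  define B where "B = i0 div f"
  have B: "B < e" using block_of(1)[OF ij(1)] by (simp add: B_def)
  \<comment> \<open>A labelling with two values that separates \<open>i0\<close> from \<open>j0\<close>; having only two values makes the
    unipotent matrices below of the form \<open>1 + N\<close> with \<open>N\<^sup>2 = 0\<close>.\<close>
  define b where "b a = (if \<beta> (B * f + a) \<le> \<beta> i0 then 0 else 1 :: nat)" for a
  have b1: "b a \<le> 1" for a by (simp add: b_def)
  have "b (i0 mod f) \<noteq> b (j0 mod f)"
    using lt block_of(3)[OF ij(1)] block_of(3)[OF ij(2)] ij(3) by (simp add: b_def B_def)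
  then have b_ne: "\<exists>a<f. \<exists>a'<f. b a \<noteq> b a'"
    using block_of(2)[OF ij(1)] block_of(2)[OF ij(2)] by blast
  \<comment> \<open>Zero has to be lifted to zero, for the lift of a unipotent matrix to keep its shape over \<open>F\<close>.\<close>
  define lift where "lift z = (if z = 0 then 0 else SOME x. nrm x \<le> 1 \<and> red x = z)" for z
  have lift: "nrm (lift z) \<le> 1" "red (lift z) = z" for z
  proof -
    have "z \<in> red ` {x. nrm x \<le> 1}" using red_surj by simp
    then have "\<exists>x. nrm x \<le> 1 \<and> red x = z" by blast
    then have "nrm (SOME x. nrm x \<le> 1 \<and> red x = z) \<le> 1 \<and> red (SOME x. nrm x \<le> 1 \<and> red x = z) = z"
      by (rule someI_ex)
    then show "nrm (lift z) \<le> 1" "red (lift z) = z" by (simp_all add: lift_def)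
  qed
  define N where "N u = mat n n (\<lambda>(i, j). if i div f = B \<and> j div f = B \<and> b (i mod f) < b (j mod f)
    then lift (u $$ (i mod f, j mod f)) else 0)" for u
  \<comment> \<open>The conjugate of \<open>N u\<close> by the inverse of the monomial matrix.\<close>
  define N' where "N' u = mat n n (\<lambda>(i, j). unif powi (c (t j) - c (t i)) * N u $$ (t i, t j))" for u
  have Nm: "N u \<in> carrier_mat n n" "N' u \<in> carrier_mat n n" for u by (simp_all add: N_def N'_def)
  have N_nil: "N u $$ (i, j) = 0 \<or> N u $$ (j, k) = 0" if "i < n" "j < n" "k < n" for u i j k
    using that b1[of "j mod f"] b1[of "k mod f"] by (auto simp: N_def)
  have N_\<beta>: "\<beta> i < \<beta> j" if "i < n" "j < n" "N u $$ (i, j) \<noteq> 0" for u i j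
  proof -
    have 1: "i div f = B" "j div f = B" "b (i mod f) < b (j mod f)"
      using that by (auto simp: N_def split: if_splits)
    then have "\<beta> i \<le> \<beta> i0" "\<not> \<beta> j \<le> \<beta> i0"
      using block_of(3)[OF that(1)] block_of(3)[OF that(2)] by (auto simp: b_def split: if_splits)
    then show ?thesis by simp
  qed
  have N_le: "nrm (N u $$ (i, j)) \<le> 1" if "i < n" "j < n" for u i j
    using that lift(1) by (simp add: N_def)
  have N'_small: "nrm (N' u $$ (i, j)) \<le> 1 \<and> (j div f \<le> i div f \<longrightarrow> nrm (N' u $$ (i, j)) < 1)"
    if "i < n" "j < n" for u i j
  proof (cases "N u $$ (t i, t j) = 0")
    case False
    then have "\<beta> (t i) < \<beta> (t j)" using N_\<beta> t_less that by blast
    then have lt: "int e * c (t i) + int (i div f) < int e * c (t j) + int (j div f)"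
      using st that by (simp add: \<beta>_def)
    define d where "d = c (t j) - c (t i)"
    have d: "int (i div f) < int e * d + int (j div f)"
      using lt by (simp add: d_def right_diff_distrib)
    have "int (j div f) < int e" using block_of(1) that by simp
    then have "int e * d > int e * (-1)" using d by linarith
    then have d0: "d \<ge> 0" using mult_less_cancel_left_pos[of "int e" "-1" d] B by simp
    have pw: "nrm (unif powi d) = nrm unif ^ nat d" using d0 by (simp add: power_int_def nrm_power)
    have pw1: "nrm unif ^ nat d \<le> 1" using nrm_unif by (intro power_le_one) auto
    have "nrm (N' u $$ (i, j)) = nrm (unif powi d) * nrm (N u $$ (t i, t j))"
      using that by (simp add: N'_def nrm_mult d_def)
    also have "\<dots> \<le> nrm unif ^ nat d"
      unfolding pw using N_le[of "t i" "t j" u] t_less that nrm_unif by (intro mult_left_le) auto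
    finally have le: "nrm (N' u $$ (i, j)) \<le> nrm unif ^ nat d" .
    have "nrm unif ^ nat d < 1" if "j div f \<le> i div f"
    proof -
      have "int e * d > 0" using d that by simp
      then have "d > 0" using B by (simp add: zero_less_mult_iff)
      then show ?thesis using nrm_unif by (intro power_less_one_iff[THEN iffD2]) auto
    qed
    then show ?thesis using le pw1 by fastforce
  qed (use that in \<open>simp add: N'_def\<close>)
  define U where "U u = 1\<^sub>m n + N u" for u
  define A where "A u = 1\<^sub>m n + N' u" for u
  have U_J: "U u \<in> J" for u
    unfolding U_def
  proof (rule elementary_J[OF Nm(1) N_le _ N_nil])
    fix i j assume "i < n" "j < n" "j div f < i div f"
    then have "N u $$ (i, j) = 0" by (auto simp: N_def)
    then show "nrm (N u $$ (i, j)) < 1" by simp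
  qed
  have A_J: "A u \<in> J" for u
    unfolding A_def
  proof (rule elementary_J[OF Nm(2)])
    fix i j k assume "i < n" "j < n" "k < n"
    then show "N' u $$ (i, j) = 0 \<or> N' u $$ (j, k) = 0"
      using N_nil[of "t i" "t j" "t k" u] t_less by (auto simp: N'_def)
  qed (use N'_small in auto)
  have A_trivial: "lam (A u) x = x" if "x \<in> W" for u x
  proof (rule lam_trivial[OF red_block_eq_one that])
    show "A u \<in> carrier_mat n n" using J_mat[OF A_J] .
    fix i k l assume kl: "k < n" "l < n" "k div f = i" "l div f = i"
    have "nrm (A u $$ (k, l) - 1\<^sub>m n $$ (k, l)) < 1"
      using N'_small[OF kl(1,2), of u] kl Nm(2)[of u] by (simp add: A_def)
    then have "red (A u $$ (k, l)) = red (1\<^sub>m n $$ (k, l))"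
      using order_A_le[OF J_ord[OF A_J] kl(1,2)] by (intro red_cong)
    then show "red (A u $$ (k, l)) = (if k = l then 1 else 0)" using kl by (simp add: red_one)
  qed
  have red_U: "red_block (U u) i = (if i = B then u else 1\<^sub>m f)"
    if u: "u \<in> unipotent_radical f b" and i: "i < e" for u i
  proof (rule eq_matI)
    have um: "u \<in> carrier_mat f f" using u by (simp add: unipotent_radical_def)
    fix a a' assume "a < dim_row (if i = B then u else 1\<^sub>m f)" "a' < dim_col (if i = B then u else 1\<^sub>m f)"
    then have a: "a < f" "a' < f" using um by (auto split: if_splits)
    note k = block_index[OF i a(1)] block_index[OF i a(2)]
    have eq: "red_block (U u) i $$ (a, a') = red ((if a = a' then 1 else 0) + N u $$ (i * f + a, i * f + a'))"
      using k a Nm(1)[of u] by (simp add: red_block_at U_def)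
    show "red_block (U u) i $$ (a, a') = (if i = B then u else 1\<^sub>m f) $$ (a, a')"
    proof (cases "i = B \<and> b a < b a'")
      case True
      then show ?thesis using eq k a lift by (auto simp: N_def)
    next
      case False
      then have "N u $$ (i * f + a, i * f + a') = 0" using k by (auto simp: N_def)
      moreover have "i = B \<Longrightarrow> u $$ (a, a') = 1\<^sub>m f $$ (a, a')"
        using u a False by (simp add: unipotent_radical_def)
      ultimately show ?thesis using eq a by (auto simp: red_one)
    qed
  next
    have um: "u \<in> carrier_mat f f" using u by (simp add: unipotent_radical_def)
    show "dim_row (red_block (U u) i) = dim_row (if i = B then u else 1\<^sub>m f)"
      "dim_col (red_block (U u) i) = dim_col (if i = B then u else 1\<^sub>m f)"
      using um by (simp_all add: red_block_def mat_block_def)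
  qed
  have mm: "?m \<in> carrier_mat n n" by (simp add: monomial_mat_def)
  have comm: "U u * ?m = ?m * A u" for u
  proof -
    have "N u * ?m = ?m * N' u"
    proof (rule eq_matI)
      fix i j assume "i < dim_row (?m * N' u)" "j < dim_col (?m * N' u)"
      then have ij: "i < n" "j < n" using Nm[of u] mm by auto
      have "(N u * ?m) $$ (i, j) = (\<Sum>l<n. if l = t j then N u $$ (i, l) * unif powi c l else 0)"
        unfolding mult_mat_entry[OF Nm(1) mm ij]
      proof (rule sum.cong[OF refl])
        fix l assume "l \<in> {..<n}"
        then have "j = s l \<longleftrightarrow> l = t j" using ts st ij by auto
        then show "N u $$ (i, l) * ?m $$ (l, j) = (if l = t j then N u $$ (i, l) * unif powi c l else 0)"
          using \<open>l \<in> {..<n}\<close> ij by (simp add: monomial_mat_def)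
      qed
      then have 1: "(N u * ?m) $$ (i, j) = N u $$ (i, t j) * unif powi c (t j)" using t_less[OF ij(2)] by simp
      have "(?m * N' u) $$ (i, j) = (\<Sum>l<n. if l = s i then unif powi c i * N' u $$ (l, j) else 0)"
        unfolding mult_mat_entry[OF mm Nm(2) ij]
        by (rule sum.cong[OF refl]) (use ij in \<open>simp add: monomial_mat_def\<close>)
      then have "(?m * N' u) $$ (i, j) = unif powi c i * (unif powi (c (t j) - c i) * N u $$ (i, t j))"
        using s_less[OF ij(1)] ts[OF ij(1)] ij by (simp add: N'_def)
      also have "\<dots> = (unif powi c i * unif powi (c (t j) - c i)) * N u $$ (i, t j)" by simp
      also have "unif powi c i * unif powi (c (t j) - c i) = unif powi c (t j)"
        using unif_nonzero by (simp add: power_int_add[symmetric])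
      finally show "(N u * ?m) $$ (i, j) = (?m * N' u) $$ (i, j)" using 1 by (simp add: mult.commute)
    qed (use carrier_matD[OF Nm(1)[of u]] carrier_matD[OF Nm(2)[of u]] carrier_matD[OF mm] in simp_all)
    moreover have "U u * ?m = 1\<^sub>m n * ?m + N u * ?m"
      unfolding U_def using Nm mm by (intro add_mult_distrib_mat) auto
    moreover have "?m * A u = ?m * 1\<^sub>m n + ?m * N' u"
      unfolding A_def using Nm mm by (intro mult_add_distrib_mat) auto
    ultimately show ?thesis using mm by simp
  qed
  define x where "x = \<Psi> ?m v"
  note D = ind.hecke_barD[OF Psi]
  have x: "x \<in> W" unfolding x_def by (rule D(1)[OF v])
  have fixed: "lam (U u) x = x" for u
  proof -
    have "lam (U u) x = \<Psi> (U u * ?m) v" using D(5)[OF U_J m v, of u] by (simp add: x_def)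
    also have "\<dots> = \<Psi> (?m * A u) v" by (simp add: comm)
    also have "\<dots> = \<Psi> ?m (lam (A u) v)" using D(6)[OF A_J m v, of u] by simp
    finally show ?thesis using A_trivial[OF v] by (simp add: x_def)
  qed
  have "x = 0"
  proof (rule tensor_slot_invariants[OF X0_subspace x B, where S = "unipotent_radical f b"
        and F = "\<lambda>u i. lam0 (red_block (U u) i)"])
    fix u :: "'k mat" assume u: "u \<in> unipotent_radical f b"
    show "linear_on X0 X0 (lam0 (red_block (U u) B))" using lam0_linear[OF red_block_GL[OF U_J B]] .
    show "tensor_map e X0 (\<lambda>i. lam0 (red_block (U u) i)) x = x" using fixed by (simp add: type_rep_eq)
    show "lam0 (red_block (U u) i) y = y" if "i < e" "i \<noteq> B" "y \<in> X0" for i y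
      using red_U[OF u that(1)] that lam0_one by simp
  next
    fix y assume y: "y \<in> X0" and fix_y: "\<And>u. u \<in> unipotent_radical f b \<Longrightarrow> lam0 (red_block (U u) B) y = y"
    show "y = 0"
      by (rule cuspidal_labelling[OF lam0_cuspidal lam0_rep b1 b_ne y]) (use fix_y red_U B in simp)
  qed
  then show False using nz by (simp add: x_def)
qed

end

section \<open>The affine Weyl group\<close>

context nonarch_local_field
begin

lemma monomial_mat_carrier [simp]: "monomial_mat m s c \<in> carrier_mat m m"
  by (simp add: monomial_mat_def)

lemma monomial_mat_cong:
  assumes "\<And>i. i < m \<Longrightarrow> s i = s' i" "\<And>i. i < m \<Longrightarrow> c i = c' i"
  shows "monomial_mat m s c = monomial_mat m s' c'"
  by (rule eq_matI) (use assms in \<open>auto simp: monomial_mat_def\<close>)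

lemma monomial_mat_mult:
  assumes s: "\<And>i. i < m \<Longrightarrow> s i < m"
  shows "monomial_mat m s c * monomial_mat m s' c' = monomial_mat m (\<lambda>i. s' (s i)) (\<lambda>i. c i + c' (s i))"
proof (rule eq_matI)
  fix i j assume "i < dim_row (monomial_mat m (\<lambda>i. s' (s i)) (\<lambda>i. c i + c' (s i)))"
    "j < dim_col (monomial_mat m (\<lambda>i. s' (s i)) (\<lambda>i. c i + c' (s i)))"
  then have ij: "i < m" "j < m" by (auto simp: monomial_mat_def)
  have "(monomial_mat m s c * monomial_mat m s' c') $$ (i, j)
      = (\<Sum>l<m. if l = s i then unif powi c i * monomial_mat m s' c' $$ (l, j) else 0)"
    unfolding mult_mat_entry[OF monomial_mat_carrier monomial_mat_carrier ij]
    by (rule sum.cong[OF refl]) (use ij in \<open>simp add: monomial_mat_def\<close>)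
  then show "(monomial_mat m s c * monomial_mat m s' c') $$ (i, j)
      = monomial_mat m (\<lambda>i. s' (s i)) (\<lambda>i. c i + c' (s i)) $$ (i, j)"
    using s[OF ij(1)] ij unif_nonzero by (simp add: monomial_mat_def power_int_add)
qed (auto simp: monomial_mat_def)

lemma monomial_mat_GL:
  assumes s: "bij_betw s {..<m} {..<m}"
  shows "monomial_mat m s c \<in> carrier (GL m)"
proof -
  let ?t = "inv_into {..<m} s"
  have "monomial_mat m s c * monomial_mat m ?t (\<lambda>j. - c (?t j))
      = monomial_mat m (\<lambda>i. ?t (s i)) (\<lambda>i. c i + - c (?t (s i)))"
    by (rule monomial_mat_mult) (use bij_betwE[OF s] in simp)
  also have "\<dots> = 1\<^sub>m m"
    by (rule eq_matI) (use bij_betw_inv_into_left[OF s] in \<open>auto simp: monomial_mat_def\<close>)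
  finally show ?thesis using GL_I(1) monomial_mat_carrier by blast
qed

text \<open>A single permutation contributes to the Leibniz formula.\<close>

lemma monomial_mat_det:
  assumes s: "bij_betw s {..<m} {..<m}" and c: "(\<Sum>i<m. c i) = 0"
  shows "det (monomial_mat m s c) = 1 \<or> det (monomial_mat m s c) = - 1"
proof -
  let ?A = "monomial_mat m s c"
  define p where "p i = (if i < m then s i else i)" for i
  have p: "p permutes {0..<m}"
  proof (rule bij_imp_permutes)
    have "bij_betw p {..<m} {..<m}" using s by (subst bij_betw_cong[of _ _ s]) (auto simp: p_def)
    then show "bij_betw p {0..<m} {0..<m}" by (simp add: atLeast0LessThan)
  qed (simp add: p_def)
  let ?t = "\<lambda>q. signof q * (\<Prod>i = 0..<m. ?A $$ (i, q i))"
  have "?t q = 0" if q: "q permutes {0..<m}" "q \<noteq> p" for q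
  proof -
    obtain i where i: "q i \<noteq> p i" using q(2) by (auto simp: fun_eq_iff)
    have "i < m"
    proof (rule ccontr)
      assume "\<not> i < m"
      then have "q i = i" "p i = i" using permutes_not_in[OF q(1), of i] permutes_not_in[OF p, of i] by auto
      then show False using i by simp
    qed
    moreover have "q i < m" using permutes_in_image[OF q(1), of i] \<open>i < m\<close> by simp
    ultimately have "?A $$ (i, q i) = 0" using i by (simp add: monomial_mat_def p_def)
    then have "(\<Prod>i = 0..<m. ?A $$ (i, q i)) = 0" using \<open>i < m\<close> by (intro prod_zero) auto
    then show ?thesis by simp
  qed
  then have "det ?A = (\<Sum>q\<in>{p}. ?t q)"
    unfolding det_def'[OF monomial_mat_carrier]
    by (intro sum.mono_neutral_right) (use p in \<open>auto simp: finite_permutations\<close>)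
  also have "\<dots> = signof p * (\<Prod>i = 0..<m. ?A $$ (i, p i))" by simp
  also have "(\<Prod>i = 0..<m. ?A $$ (i, p i)) = (\<Prod>i = 0..<m. unif powi c i)"
    by (rule prod.cong) (use bij_betwE[OF s] in \<open>auto simp: monomial_mat_def p_def\<close>)
  also have "(\<Prod>i = 0..<m. unif powi c i) = unif powi (\<Sum>i = 0..<m. c i)"
    by (induction m) (simp_all add: power_int_add unif_nonzero)
  also have "\<dots> = 1" using c by (simp add: atLeast0LessThan)
  finally show ?thesis by (simp add: sign_def)
qed

lemma monomial_mat_W0:
  assumes s: "bij_betw s {..<m} {..<m}" and c: "(\<Sum>i<m. c i) = 0"
  shows "monomial_mat m s c \<in> weyl_W0 unif m"
  unfolding weyl_W0_def mem_Collect_eq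
proof (intro conjI allI impI)
  show "monomial_mat m s c \<in> carrier (GL m)" by (rule monomial_mat_GL[OF s])
  show "det (monomial_mat m s c) = 1 \<or> det (monomial_mat m s c) = - 1" by (rule monomial_mat_det[OF s c])
  have nz: "monomial_mat m s c $$ (i, j) \<noteq> 0 \<longleftrightarrow> j = s i" if "i < m" "j < m" for i j
    using that unif_nonzero by (simp add: monomial_mat_def)
  fix i assume i: "i < m"
  show "\<exists>!j. j < m \<and> monomial_mat m s c $$ (i, j) \<noteq> 0"
    using nz[OF i] bij_betwE[OF s] i by (intro ex1I[of _ "s i"]) auto
  let ?t = "inv_into {..<m} s"
  have t: "?t i < m" "s (?t i) = i" and ts: "\<And>k. k < m \<Longrightarrow> ?t (s k) = k"
    using bij_betwE[OF bij_betw_inv_into[OF s]] bij_betw_inv_into_right[OF s]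
      bij_betw_inv_into_left[OF s] i by auto
  show "\<exists>!k. k < m \<and> monomial_mat m s c $$ (k, i) \<noteq> 0"
    by (rule ex1I[of _ "?t i"]) (use nz i t ts in auto)
  fix j assume "j < m" "monomial_mat m s c $$ (i, j) \<noteq> 0"
  then show "\<exists>k. monomial_mat m s c $$ (i, j) = unif powi k"
    using i by (auto simp: monomial_mat_def split: if_splits)
qed

end

context parahoric
begin

lemma perm_mat_J:
  assumes s: "bij_betw s {..<n} {..<n}" and blocks: "\<And>i. i < n \<Longrightarrow> s i div f = i div f"
  shows "(perm_mat n s :: 'F mat) \<in> J"
proof (rule J_I(1))
  let ?t = "inv_into {..<n} s"
  have t: "?t i < n" "s (?t i) = i" if "i < n" for i
    using bij_betwE[OF bij_betw_inv_into[OF s]] bij_betw_inv_into_right[OF s] that by auto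
  have ord: "(perm_mat n r :: 'F mat) \<in> order_A nrm e f" if "\<And>i. i < n \<Longrightarrow> r i div f = i div f" for r
    using that by (auto simp: order_A_def perm_mat_def)
  show "(perm_mat n s :: 'F mat) \<in> order_A nrm e f" using blocks by (rule ord)
  show "(perm_mat n ?t :: 'F mat) \<in> order_A nrm e f"
    by (rule ord) (use blocks t in metis)
  show "perm_mat n s * perm_mat n ?t = (1\<^sub>m n :: 'F mat)"
    by (rule perm_mat_inverse) (use bij_betwE[OF s] bij_betw_inv_into_left[OF s] in auto)
qed

text \<open>The permutation of indices that moves whole blocks by \<open>S\<close>.\<close>

definition block_perm :: "(nat \<Rightarrow> nat) \<Rightarrow> nat \<Rightarrow> nat"
  where "block_perm S r = S (r div f) * f + r mod f"

lemma block_perm: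
  assumes "S (r div f) < e" "r < n"
  shows "block_perm S r < n" "block_perm S r div f = S (r div f)" "block_perm S r mod f = r mod f"
  using block_index[OF assms(1) block_of(2)[OF assms(2)]] by (simp_all add: block_perm_def)

lemma blow_up_monomial:
  assumes S: "\<And>i. i < e \<Longrightarrow> S i < e"
  shows "blow_up e f (monomial_mat e S C) = monomial_mat n (block_perm S) (\<lambda>r. C (r div f))"
proof (rule eq_matI)
  fix r c assume "r < dim_row (monomial_mat n (block_perm S) (\<lambda>r. C (r div f)))"
    "c < dim_col (monomial_mat n (block_perm S) (\<lambda>r. C (r div f)))"
  then have rc: "r < n" "c < n" by (auto simp: monomial_mat_def)
  note b = block_perm[of S r, OF S[OF block_of(1)[OF rc(1)]] rc(1)]
  have "c = block_perm S r \<longleftrightarrow> r mod f = c mod f \<and> c div f = S (r div f)"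
  proof
    assume "r mod f = c mod f \<and> c div f = S (r div f)"
    then show "c = block_perm S r" using block_of(3)[OF rc(2)] by (simp only: block_perm_def)
  qed (use b in simp)
  then show "blow_up e f (monomial_mat e S C) $$ (r, c)
      = monomial_mat n (block_perm S) (\<lambda>r. C (r div f)) $$ (r, c)"
    using rc block_of(1)[OF rc(1)] block_of(1)[OF rc(2)] by (auto simp: blow_up_def monomial_mat_def)
qed (auto simp: blow_up_def monomial_mat_def)

lemma block_perm_bij:
  assumes S: "bij_betw S {..<e} {..<e}"
  shows "bij_betw (block_perm S) {..<n} {..<n}"
proof -
  have less: "S (r div f) < e" if "r < n" for r using bij_betwE[OF S] block_of(1)[OF that] by simp
  have "inj_on (block_perm S) {..<n}"
  proof (rule inj_onI)
    fix r r' assume r: "r \<in> {..<n}" "r' \<in> {..<n}" "block_perm S r = block_perm S r'"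
    then have "S (r div f) = S (r' div f)" "r mod f = r' mod f"
      using block_perm[of S r] block_perm[of S r'] less by auto
    moreover from this have "r div f = r' div f"
      using bij_betw_imp_inj_on[OF S] block_of(1)[of r] block_of(1)[of r'] r by (auto dest: inj_onD)
    ultimately show "r = r'" using block_of(3)[of r] block_of(3)[of r'] r by auto
  qed
  moreover have "block_perm S ` {..<n} \<subseteq> {..<n}" using block_perm(1) less by auto
  ultimately show ?thesis using endo_inj_surj[of "{..<n}" "block_perm S"] by (auto simp: bij_betw_def)
qed

definition cycle :: "nat \<Rightarrow> nat" where "cycle i = (if i = e - 1 then 0 else i + 1)"
definition cycle_inv :: "nat \<Rightarrow> nat" where "cycle_inv j = (if j = 0 then e - 1 else j - 1)"

lemma cycle:
  assumes "i < e"
  shows "cycle i < e" "cycle_inv i < e" "cycle_inv (cycle i) = i" "cycle (cycle_inv i) = i"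
  using assms by (auto simp: cycle_def cycle_inv_def)

lemma cycle_bij: "bij_betw cycle {..<e} {..<e}" "bij_betw cycle_inv {..<e} {..<e}"
  by (rule bij_betw_byWitness[of _ cycle_inv]; use cycle in auto)
     (rule bij_betw_byWitness[of _ cycle]; use cycle in auto)

lemma Pi_matrix_monomial:
  "Pi_matrix unif e f = monomial_mat n (block_perm cycle) (\<lambda>r. if r div f = e - 1 then 1 else 0)"
proof -
  have "mat e e (\<lambda>(i, j). if j = i + 1 then 1 else if i = e - 1 \<and> j = 0 then unif else 0)
      = monomial_mat e cycle (\<lambda>i. if i = e - 1 then 1 else 0)"
    by (rule eq_matI) (auto simp: monomial_mat_def cycle_def)
  then show ?thesis using blow_up_monomial[of cycle] cycle(1) by (simp add: Pi_matrix_def)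
qed

lemma Pi_matrix_GL: "Pi_matrix unif e f \<in> carrier (GL n)"
  unfolding Pi_matrix_monomial by (rule monomial_mat_GL[OF block_perm_bij[OF cycle_bij(1)]])

text \<open>Multiplication by \<open>\<Pi>\<close> rotates the blocks and raises the total exponent by one.\<close>

lemma Pi_mult_blow_up:
  assumes S: "\<And>i. i < e \<Longrightarrow> S i < e"
  shows "Pi_matrix unif e f * blow_up e f (monomial_mat e S C)
    = blow_up e f (monomial_mat e (S \<circ> cycle) (\<lambda>i. (if i = e - 1 then 1 else 0) + C (cycle i)))"
proof -
  have cy: "block_perm cycle r < n" "block_perm cycle r div f = cycle (r div f)"
    "block_perm cycle r mod f = r mod f" if "r < n" for r
    using block_perm[of cycle r] cycle(1)[OF block_of(1)[OF that]] that by simp_all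
  have blow: "blow_up e f (monomial_mat e S C) = monomial_mat n (block_perm S) (\<lambda>r. C (r div f))"
    by (rule blow_up_monomial) (rule S)
  have "Pi_matrix unif e f * blow_up e f (monomial_mat e S C)
      = monomial_mat n (\<lambda>r. block_perm S (block_perm cycle r))
          (\<lambda>r. (if r div f = e - 1 then 1 else 0) + C (block_perm cycle r div f))"
    unfolding Pi_matrix_monomial blow
    by (rule monomial_mat_mult) (use cy in simp)
  also have "\<dots> = monomial_mat n (block_perm (S \<circ> cycle))
      (\<lambda>r. (if r div f = e - 1 then 1 else 0) + C (cycle (r div f)))"
  proof (rule monomial_mat_cong)
    fix r assume r: "r < n"
    show "block_perm S (block_perm cycle r) = block_perm (S \<circ> cycle) r"
      unfolding block_perm_def[of S] block_perm_def[of "S \<circ> cycle"] cy(2,3)[OF r] by simp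
    show "(if r div f = e - 1 then 1 else 0) + C (block_perm cycle r div f)
        = (if r div f = e - 1 then 1 else 0) + C (cycle (r div f))"
      unfolding cy(2)[OF r] ..
  qed
  also have "\<dots> = blow_up e f (monomial_mat e (S \<circ> cycle)
      (\<lambda>i. (if i = e - 1 then 1 else 0) + C (cycle i)))"
    by (rule blow_up_monomial[symmetric]) (use S cycle(1) in simp)
  finally show ?thesis .
qed

text \<open>Induction, upwards and downwards, on the sum of the exponents, which is the valuation of the
  determinant: multiplication by a power of \<open>\<Pi>\<close> reduces it to \<open>0\<close>, where the determinant is
  \<open>\<plusminus>1\<close>.\<close>

lemma blow_up_monomial_in_weyl_W:
  assumes e: "e > 0" and S: "bij_betw S {..<e} {..<e}"
  shows "blow_up e f (monomial_mat e S C) \<in> weyl_W unif e f"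
proof -
  interpret GL: group "GL n :: 'F mat monoid" by (rule GL_group)
  let ?P = "Pi_matrix unif e f"
  let ?blow = "\<lambda>S C. blow_up e f (monomial_mat e S C)"
  have blow_GL: "?blow S C \<in> carrier (GL n)" if S: "bij_betw S {..<e} {..<e}" for S C
  proof -
    have "?blow S C = monomial_mat n (block_perm S) (\<lambda>r. C (r div f))"
      by (rule blow_up_monomial) (use bij_betwE[OF S] in simp)
    then show ?thesis using monomial_mat_GL[OF block_perm_bij[OF S]] by simp
  qed
  have delta: "(\<Sum>i<e. if i = e - 1 then 1 else 0 :: int) = 1" using e by simp
  have "\<forall>S C. bij_betw S {..<e} {..<e} \<longrightarrow> (\<Sum>i<e. C i) = k \<longrightarrow>
    (\<exists>w\<in>weyl_W0 unif e. ?blow S C = ?P [^]\<^bsub>GL n\<^esub> k \<otimes>\<^bsub>GL n\<^esub> blow_up e f w \<and> blow_up e f w \<in> carrier (GL n))"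
    (is "?Q k") for k :: int
  proof (induction k rule: int_induct[where k = 0])
    case base
    show ?case
    proof (intro allI impI)
      fix S C assume S: "bij_betw S {..<e} {..<e}" and C: "(\<Sum>i<e. C i) = (0::int)"
      show "\<exists>w\<in>weyl_W0 unif e. ?blow S C = ?P [^]\<^bsub>GL n\<^esub> (0::int) \<otimes>\<^bsub>GL n\<^esub> blow_up e f w \<and> blow_up e f w \<in> carrier (GL n)"
        using monomial_mat_W0[OF S C] blow_GL[OF S, of C] GL.l_one[OF blow_GL[OF S, of C]]
        by (intro bexI[of _ "monomial_mat e S C"]) (simp_all only: int_pow_0 simp_thms)
    qed
  next
    case (step1 k)
    show ?case
    proof (intro allI impI)
      fix S C assume S: "bij_betw S {..<e} {..<e}" and C: "(\<Sum>i<e. C i) = k + 1"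
      define S' where "S' = S \<circ> cycle_inv"
      define g where "g i = C i - (if i = e - 1 then 1 else 0)" for i
      have S': "bij_betw S' {..<e} {..<e}" unfolding S'_def by (rule bij_betw_trans[OF cycle_bij(2) S])
      have "(\<Sum>i<e. g (cycle_inv i)) = (\<Sum>i<e. g i)" by (rule sum.reindex_bij_betw[OF cycle_bij(2)])
      also have "\<dots> = k" unfolding g_def sum_subtractf using C delta by simp
      finally obtain w where w: "w \<in> weyl_W0 unif e" "blow_up e f w \<in> carrier (GL n)"
        "?blow S' (\<lambda>i. g (cycle_inv i)) = ?P [^]\<^bsub>GL n\<^esub> k \<otimes>\<^bsub>GL n\<^esub> blow_up e f w"
        using step1.IH S' by blast
      have "?P * ?blow S' (\<lambda>i. g (cycle_inv i)) = ?blow (S' \<circ> cycle)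
          (\<lambda>i. (if i = e - 1 then 1 else 0) + g (cycle_inv (cycle i)))"
        by (rule Pi_mult_blow_up) (use bij_betwE[OF S'] in simp)
      also have "monomial_mat e (S' \<circ> cycle) (\<lambda>i. (if i = e - 1 then 1 else 0) + g (cycle_inv (cycle i)))
          = monomial_mat e S C"
        by (rule monomial_mat_cong) (simp_all add: S'_def g_def cycle)
      finally have "?blow S C = ?P \<otimes>\<^bsub>GL n\<^esub> (?P [^]\<^bsub>GL n\<^esub> k \<otimes>\<^bsub>GL n\<^esub> blow_up e f w)" using w(3) by simp
      also have "\<dots> = ?P \<otimes>\<^bsub>GL n\<^esub> ?P [^]\<^bsub>GL n\<^esub> k \<otimes>\<^bsub>GL n\<^esub> blow_up e f w"
        using GL.m_assoc[OF Pi_matrix_GL GL.int_pow_closed[OF Pi_matrix_GL] w(2)] by simp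
      also have "?P \<otimes>\<^bsub>GL n\<^esub> ?P [^]\<^bsub>GL n\<^esub> k = ?P [^]\<^bsub>GL n\<^esub> (1 + k)"
        using GL.int_pow_mult[OF Pi_matrix_GL, of 1 k] GL.int_pow_1[OF Pi_matrix_GL] by simp
      finally show "\<exists>w\<in>weyl_W0 unif e. ?blow S C = ?P [^]\<^bsub>GL n\<^esub> (k + 1) \<otimes>\<^bsub>GL n\<^esub> blow_up e f w \<and> blow_up e f w \<in> carrier (GL n)"
        using w by (intro bexI[of _ w]) (simp_all only: add.commute simp_thms)
    qed
  next
    case (step2 k)
    show ?case
    proof (intro allI impI)
      fix S C assume S: "bij_betw S {..<e} {..<e}" and C: "(\<Sum>i<e. C i) = k - 1"
      define g where "g i = (if i = e - 1 then 1 else 0) + C (cycle i)" for i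
      have S': "bij_betw (S \<circ> cycle) {..<e} {..<e}" by (rule bij_betw_trans[OF cycle_bij(1) S])
      have "(\<Sum>i<e. g i) = 1 + (\<Sum>i<e. C (cycle i))" unfolding g_def sum.distrib using delta by simp
      also have "(\<Sum>i<e. C (cycle i)) = (\<Sum>i<e. C i)" by (rule sum.reindex_bij_betw[OF cycle_bij(1)])
      finally have "(\<Sum>i<e. g i) = k" using C by simp
      then obtain w where w: "w \<in> weyl_W0 unif e" "blow_up e f w \<in> carrier (GL n)"
        "?blow (S \<circ> cycle) g = ?P [^]\<^bsub>GL n\<^esub> k \<otimes>\<^bsub>GL n\<^esub> blow_up e f w"
        using step2.IH S' by blast
      have P: "?P * ?blow S C = ?blow (S \<circ> cycle) g"
        unfolding g_def by (rule Pi_mult_blow_up) (use bij_betwE[OF S] in simp)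
      let ?Pi = "?P [^]\<^bsub>GL n\<^esub> (-1::int)"
      note cl = Pi_matrix_GL GL.int_pow_closed[OF Pi_matrix_GL] blow_GL[OF S, of C]
      have Pi1: "?Pi \<otimes>\<^bsub>GL n\<^esub> ?P = \<one>\<^bsub>GL n\<^esub>"
        using GL.int_pow_mult[OF Pi_matrix_GL, of "-1" 1] GL.int_pow_1[OF Pi_matrix_GL] int_pow_0 by simp
      have "?blow S C = (?Pi \<otimes>\<^bsub>GL n\<^esub> ?P) \<otimes>\<^bsub>GL n\<^esub> ?blow S C"
        using Pi1 GL.l_one[OF cl(3)] by simp
      also have "\<dots> = ?Pi \<otimes>\<^bsub>GL n\<^esub> (?P \<otimes>\<^bsub>GL n\<^esub> ?blow S C)" by (rule GL.m_assoc[OF cl(2) cl(1) cl(3)])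
      also have "\<dots> = ?Pi \<otimes>\<^bsub>GL n\<^esub> (?P [^]\<^bsub>GL n\<^esub> k \<otimes>\<^bsub>GL n\<^esub> blow_up e f w)" using P w(3) by simp
      also have "\<dots> = ?Pi \<otimes>\<^bsub>GL n\<^esub> ?P [^]\<^bsub>GL n\<^esub> k \<otimes>\<^bsub>GL n\<^esub> blow_up e f w"
        by (rule GL.m_assoc[OF cl(2) cl(2) w(2), symmetric])
      also have "?Pi \<otimes>\<^bsub>GL n\<^esub> ?P [^]\<^bsub>GL n\<^esub> k = ?P [^]\<^bsub>GL n\<^esub> (k - 1)"
        using GL.int_pow_mult[OF Pi_matrix_GL, of "-1" k] by simp
      finally show "\<exists>w\<in>weyl_W0 unif e. ?blow S C = ?P [^]\<^bsub>GL n\<^esub> (k - 1) \<otimes>\<^bsub>GL n\<^esub> blow_up e f w \<and> blow_up e f w \<in> carrier (GL n)"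
        using w by (intro bexI[of _ w] conjI)
    qed
  qed
  then show ?thesis using S unfolding weyl_W_def by blast
qed

end

section \<open>Support of Hecke functions and the generalised Steinberg representation\<close>

context cuspidal_type
begin

text \<open>It suffices to treat the monomial matrix \<open>m\<close> in the double coset of \<open>g\<close>. By
  \<open>intertwining_monomial\<close> its exponents and target blocks are constant on blocks, so \<open>m\<close> is a
  block monomial matrix times a permutation matrix that preserves every block.\<close>

theorem support_of_intertwining_functions:
  assumes e: "e > 0" and f: "f > 0" and Psi: "\<Psi> \<in> hecke_bar (GL n) J W lam" and w: "w \<in> W"
    and g: "g \<in> carrier (GL n)" "\<Psi> g w \<noteq> 0"
  shows "g \<in> J <#>\<^bsub>GL n\<^esub> weyl_W unif e f <#>\<^bsub>GL n\<^esub> J"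
proof -
  note D = ind.hecke_barD[OF Psi]
  obtain j1 j2 s c where j: "j1 \<in> J" "j2 \<in> J" and s: "bij_betw s {..<n} {..<n}"
    and eq: "j1 * g * j2 = monomial_mat n s c"
    using affine_bruhat_decomposition[OF g(1)] by blast
  let ?m = "monomial_mat n s c"
  have m: "?m \<in> carrier (GL n)" by (rule monomial_mat_GL[OF s])
  have jc: "j1 \<in> carrier (GL n)" "j2 \<in> carrier (GL n)" using j J_carrier by auto
  define v where "v = lam (inv\<^bsub>GL n\<^esub> j2) w"
  have v: "v \<in> W" unfolding v_def using j w by (intro ind.lam_W ind.J_inv)
  have nz: "\<Psi> ?m v \<noteq> 0"
  proof
    assume z: "\<Psi> ?m v = 0"
    have "\<Psi> ?m v = \<Psi> (j1 * g) (lam j2 v)"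
      using D(6)[OF j(2) _ v, of "j1 * g"] ind.m_closed[OF jc(1) g(1)] eq by simp
    also have "lam j2 v = w" unfolding v_def by (rule ind.lam_inv(2)[OF j(2) w])
    also have "\<Psi> (j1 * g) w = lam j1 (\<Psi> g w)" using D(5)[OF j(1) g(1) w] by simp
    finally have "lam j1 (\<Psi> g w) = 0" using z by metis
    then show False
      using ind.lam_inv(1)[OF j(1) D(1)[OF w]] ind.lam_0[OF ind.J_inv[OF j(1)]] g(2) by metis
  qed
  note mono = intertwining_monomial[where \<Psi> = \<Psi> and s = s and c = c and v = v, OF Psi s m v nz]
  have blocks: "c i = c k \<and> s i div f = s k div f" if ik: "i < n" "k < n" "i div f = k div f" for i k
  proof -
    have "int e * c i + int (s i div f) = int e * c k + int (s k div f)"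
      using mono[OF ik(2,1) ik(3)[symmetric]] mono[OF ik] by (rule antisym)
    moreover have "s i div f < e" "s k div f < e" using bij_betwE[OF s] ik block_of(1) by auto
    moreover have "(int e * x + int y) div int e = x" "(int e * x + int y) mod int e = int y" if "y < e" for x y
      using that by (simp_all add: zdiv_int[symmetric] zmod_int[symmetric])
    ultimately show ?thesis by (metis of_nat_eq_iff)
  qed
  have first: "(r div f) * f < n" "((r div f) * f) div f = r div f" if "r < n" for r
    using block_index[OF block_of(1)[OF that], of 0] f by simp_all
  \<comment> \<open>The induced permutation of the blocks and the exponents, read off at the first index of each
    block.\<close>
  define S where "S k = s (k * f) div f" for k
  define C where "C k = c (k * f)" for k
  have S_eq: "S (r div f) = s r div f" and C_eq: "C (r div f) = c r" if r: "r < n" for r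
    using blocks[OF first(1)[OF r] r first(2)[OF r]] by (simp_all add: S_def C_def)
  have S_less: "S k < e" if k: "k < e" for k
  proof -
    have "k * f < n" using k f by simp
    then show ?thesis using bij_betwE[OF s] block_of(1) by (simp add: S_def)
  qed
  have dec: "\<exists>Y\<in>weyl_W unif e f. \<exists>P\<in>J. Y \<in> carrier (GL n) \<and> ?m = Y * P"
  proof -
    have "S ` {..<e} = {..<e}"
    proof
      show "{..<e} \<subseteq> S ` {..<e}"
      proof
        fix k assume "k \<in> {..<e}"
        then have "k * f \<in> {..<n}" using f by simp
        then obtain r where r: "r < n" "s r = k * f"
          using bij_betw_imp_surj_on[OF s] by (metis imageE lessThan_iff)
        then have "S (r div f) = k" using S_eq[OF r(1)] f by simp
        then show "k \<in> S ` {..<e}" using block_of(1)[OF r(1)] by blast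
      qed
    qed (use S_less in auto)
    then have S: "bij_betw S {..<e} {..<e}" using finite_surj_inj[of "{..<e}" S] by (simp add: bij_betw_def)
    let ?\<sigma> = "block_perm S"
    note \<sigma> = block_perm_bij[OF S]
    have \<sigma>_less: "?\<sigma> r < n" and \<sigma>_div: "?\<sigma> r div f = s r div f" if "r < n" for r
      using block_perm[of S r] S_less[OF block_of(1)[OF that]] that S_eq[OF that] by auto
    define p where "p l = s (inv_into {..<n} ?\<sigma> l)" for l
    have p_\<sigma>: "p (?\<sigma> r) = s r" if "r < n" for r
      using bij_betw_inv_into_left[OF \<sigma>, of r] that by (simp add: p_def)
    have p_bij: "bij_betw p {..<n} {..<n}"
      using bij_betw_trans[OF bij_betw_inv_into[OF \<sigma>] s] by (simp add: p_def[abs_def] o_def)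
    have P: "perm_mat n p \<in> J"
    proof (rule perm_mat_J[OF p_bij])
      fix i assume i: "i < n"
      define r where "r = inv_into {..<n} ?\<sigma> i"
      have "r < n" "?\<sigma> r = i"
        using bij_betwE[OF bij_betw_inv_into[OF \<sigma>]] bij_betw_inv_into_right[OF \<sigma>] i by (auto simp: r_def)
      then show "p i div f = i div f" using p_\<sigma>[of r] \<sigma>_div[of r] by simp
    qed
    let ?Y = "blow_up e f (monomial_mat e S C)"
    have Y: "?Y = monomial_mat n ?\<sigma> (\<lambda>r. C (r div f))" by (rule blow_up_monomial[OF S_less])
    have perm: "perm_mat n p = monomial_mat n p (\<lambda>_. 0)" 
      by (rule eq_matI) (auto simp: perm_mat_def monomial_mat_def)
    have "?Y * perm_mat n p = monomial_mat n (\<lambda>r. p (?\<sigma> r)) (\<lambda>r. C (r div f) + 0)"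
      unfolding Y perm by (rule monomial_mat_mult[OF \<sigma>_less])
    also have "\<dots> = ?m" by (rule monomial_mat_cong) (simp_all add: p_\<sigma> C_eq)
    finally have "?m = ?Y * perm_mat n p" ..
    moreover have "?Y \<in> weyl_W unif e f" by (rule blow_up_monomial_in_weyl_W[OF e S])
    moreover have "?Y \<in> carrier (GL n)" unfolding Y by (rule monomial_mat_GL[OF \<sigma>])
    ultimately show ?thesis using P by blast
  qed
  then obtain Y P where YP: "Y \<in> weyl_W unif e f" "P \<in> J" "Y \<in> carrier (GL n)" "?m = Y * P" by blast
  let ?i1 = "inv\<^bsub>GL n\<^esub> j1" and ?i2 = "inv\<^bsub>GL n\<^esub> j2"
  have i: "?i1 \<in> J" "?i2 \<in> J" using j ind.J_inv by auto
  note cl = jc g(1) ind.inv_closed[OF jc(1)] ind.inv_closed[OF jc(2)] YP(3) J_carrier[OF YP(2)]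
  have "g = ?i1 \<otimes>\<^bsub>GL n\<^esub> (j1 \<otimes>\<^bsub>GL n\<^esub> g \<otimes>\<^bsub>GL n\<^esub> j2) \<otimes>\<^bsub>GL n\<^esub> ?i2"
  proof -
    have "?i1 \<otimes>\<^bsub>GL n\<^esub> (j1 \<otimes>\<^bsub>GL n\<^esub> g \<otimes>\<^bsub>GL n\<^esub> j2) \<otimes>\<^bsub>GL n\<^esub> ?i2
        = (?i1 \<otimes>\<^bsub>GL n\<^esub> j1) \<otimes>\<^bsub>GL n\<^esub> g \<otimes>\<^bsub>GL n\<^esub> (j2 \<otimes>\<^bsub>GL n\<^esub> ?i2)"
      using cl by (simp only: ind.m_assoc ind.m_closed)
    also have "\<dots> = g" using cl by (simp only: ind.l_inv ind.r_inv ind.l_one ind.r_one)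
    finally show ?thesis ..
  qed
  also have "j1 \<otimes>\<^bsub>GL n\<^esub> g \<otimes>\<^bsub>GL n\<^esub> j2 = Y \<otimes>\<^bsub>GL n\<^esub> P" using eq YP(4) by simp
  also have "?i1 \<otimes>\<^bsub>GL n\<^esub> (Y \<otimes>\<^bsub>GL n\<^esub> P) \<otimes>\<^bsub>GL n\<^esub> ?i2 = (?i1 \<otimes>\<^bsub>GL n\<^esub> Y) \<otimes>\<^bsub>GL n\<^esub> (P \<otimes>\<^bsub>GL n\<^esub> ?i2)"
    using cl by (simp only: ind.m_assoc ind.m_closed)
  finally have "g = (?i1 \<otimes>\<^bsub>GL n\<^esub> Y) \<otimes>\<^bsub>GL n\<^esub> (P \<otimes>\<^bsub>GL n\<^esub> ?i2)" .
  moreover have "P \<otimes>\<^bsub>GL n\<^esub> ?i2 \<in> J" using subgroup.m_closed[OF J_subgroup YP(2) i(2)] .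
  ultimately show ?thesis using i(1) YP(1) unfolding set_mult_def by blast
qed

end

theorem proposition3p5:
  fixes nrm :: "'F::field \<Rightarrow> real" and unif :: 'F and red :: "'F \<Rightarrow> 'k::field"
    and e f n :: nat
    and X0 :: "'x::complex_vector set" and lam0 :: "'k mat \<Rightarrow> 'x \<Rightarrow> 'x"
    and Lam0 :: "'F mat \<Rightarrow> 'x \<Rightarrow> 'x"
    and T :: "'t::complex_vector set" and \<tau> :: "'F mat \<Rightarrow> 't \<Rightarrow> 't"
    and V :: "'v::complex_vector set" and \<pi> :: "'F mat \<Rightarrow> 'v \<Rightarrow> 'v"
    and G :: "'F mat monoid" and Top :: "'F mat topology" and J :: "'F mat set"
    and W :: "'x tensor set" and lam :: "'F mat \<Rightarrow> 'x tensor \<Rightarrow> 'x tensor"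
    and W' :: "('x tensor \<Rightarrow> complex) set"
    and lam' :: "'F mat \<Rightarrow> ('x tensor \<Rightarrow> complex) \<Rightarrow> ('x tensor \<Rightarrow> complex)"
    and I :: "('F mat \<Rightarrow> 'x tensor) set"
    and chi :: "('F mat \<Rightarrow> ('x tensor \<Rightarrow> complex) \<Rightarrow> ('x tensor \<Rightarrow> complex)) \<Rightarrow> complex"
    and chi' :: "('F mat \<Rightarrow> 'x tensor \<Rightarrow> 'x tensor) \<Rightarrow> complex"
    and \<Psi> :: "'F mat \<Rightarrow> 'x tensor \<Rightarrow> 'x tensor"
    and w :: "'x tensor" and w' :: "'x tensor \<Rightarrow> complex"
  assumes local_field: "nonarch_local_field nrm unif red"
    and n: "n \<ge> 2" "e > 0" "f > 0" "e * f = n"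
    and G_def: "G = GL n" and Top_def: "Top = GL_topology nrm n"
    and tau: "level0_supercuspidal nrm red f X0 lam0 Lam0 T \<tau>"
    and St: "is_St nrm e f T \<tau> V \<pi>"
    and J_def: "J = type_J nrm e f"
    and W_def: "W = tensor_power e X0"
    and lam_def: "lam = type_rep red e f X0 lam0"
    and W'_def: "W' = contra_space (subtopology Top J) (G\<lparr>carrier := J\<rparr>) W lam"
    and lam'_def: "lam' = contra_rep (G\<lparr>carrier := J\<rparr>) W lam"
    and I_def: "I = cind_space Top G J W lam"
    and chi: "character_of_module (hecke Top G J W' lam') (hecke_action G J W W' I)
                (intertwiner G I (right_translation G) V \<pi>) chi"
    and chi': "\<forall>\<phi>\<in>hecke Top G J W' lam'. chi' (hecke_tilde G W W' \<phi>) = chi \<phi>"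
    and w: "w \<in> W" and w': "w' \<in> W'"
    and Psi: "\<Psi> \<in> hecke_bar G J W lam"
    and eigen: "\<forall>\<phi>\<in>hecke Top G J W lam. hecke_conv G J (\<circ>) \<Psi> \<phi> = chi' \<phi> *\<^sub>C \<Psi>"
  shows "matrix_coefficient Top G V \<pi> (\<lambda>g. w' (\<Psi> g w)) \<and>
         supp_on G (\<lambda>g. w' (\<Psi> g w)) \<subseteq> J <#>\<^bsub>G\<^esub> weyl_W unif e f <#>\<^bsub>G\<^esub> J"
proof -
  have irr: "irreducible_rep (GL f) X0 lam0" and cusp: "cuspidal_rep f X0 lam0"
    using tau by (simp_all add: level0_supercuspidal_def)
  have rep: "representation (GL f) X0 lam0" using irr by (simp add: irreducible_rep_def)
  have T: "cuspidal_type nrm unif red f X0 lam0"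
    using local_field rep cusp
    by (intro cuspidal_type.intro parahoric.intro cuspidal_type_axioms.intro)
  interpret cuspidal_type nrm unif red e f X0 lam0 by (rule T)
  note defs = G_def Top_def J_def W_def lam_def n(4)[symmetric]
  have W'_dual: "W' = lin_dual W"
    unfolding W'_def defs by (rule ind.W'_eq)
  have irrV: "irreducible_rep (GL (e * f)) V \<pi>" using St by (simp add: is_St_def)
  note chi_dual = chi[unfolded W'_dual lam'_def I_def defs]
    and chi'_dual = chi'[unfolded W'_dual lam'_def defs]
    and Psi_J = Psi[unfolded defs] and w_J = w[unfolded defs] and w'_J = w'[unfolded W'_dual defs]
  have coefficient: "matrix_coefficient Top G V \<pi> (\<lambda>g. w' (\<Psi> g w))"
    unfolding defs
    by (rule ind.eigenfunction_matrix_coefficient[where V = V and \<pi> = \<pi> and chi = chi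
          and chi' = chi' and \<Psi> = \<Psi> and w = w and w' = w',
          OF irrV chi_dual bspec[OF chi'_dual] Psi_J bspec[OF eigen[unfolded defs]] w_J w'_J])
  have "supp_on G (\<lambda>g. w' (\<Psi> g w)) \<subseteq> J <#>\<^bsub>G\<^esub> weyl_W unif e f <#>\<^bsub>G\<^esub> J"
  proof
    fix g assume "g \<in> supp_on G (\<lambda>g. w' (\<Psi> g w))"
    then have g: "g \<in> carrier (GL (e * f))" "w' (\<Psi> g w) \<noteq> 0" by (simp_all add: supp_on_def defs)
    have "w' 0 = 0" using ind.lin_dualD(3)[OF w'_J] .
    then have nz: "\<Psi> g w \<noteq> 0" using g(2) by auto
    show "g \<in> J <#>\<^bsub>G\<^esub> weyl_W unif e f <#>\<^bsub>G\<^esub> J"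
      using support_of_intertwining_functions[where \<Psi> = \<Psi> and w = w and g = g,
          OF n(2,3) Psi_J w_J g(1) nz] unfolding defs .
  qed
  with coefficient show ?thesis by blast
qed

end
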